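(* Consider a partially observed Markov decision process with state space $\mathbb{X}$, measurement space $\mathbb{Y}$, action space $\mathbb{U}$, transition kernel $\mathcal{T}$, observation channel $Q$ and stage-wise cost $c$, and its associated belief-MDP $(\mathcal{P}(\mathbb{X}),\mathbb{U},\eta,\tilde c)$, as described in the context. Suppose that $c:\mathbb{X}\times\mathbb{U}\to\mathbb{R}$ is continuous and bounded, that $\mathbb{U}$ is compact, and that at least one of the following two conditions holds: (A) $\mathcal{T}(\cdot|x,u)$ is weakly continuous in $(x,u)$ (i.e. $(x_n,u_n)\to(x,u)$ implies $\mathcal{T}(\cdot|x_n,u_n)\to\mathcal{T}(\cdot|x,u)$ weakly), and $Q(\cdot|x,u)$ is continuous in total variation in $(x,u)$ (i.e. $(x_n,u_n)\to(x,u)$ implies $\|Q(\cdot|x_n,u_n)-Q(\cdot|x,u)\|_{TV}\to 0$); (B) $\mathcal{T}(\cdot|x,u)$ is continuous in total variation in $(x,u)$ (i.e. $(x_n,u_n)\to(x,u)$ implies $\|\mathcal{T}(\cdot|x_n,u_n)-\mathcal{T}(\cdot|x,u)\|_{TV}\to 0$), and the channel $Q(\cdot|x)$ does not depend on the control variable. Then for every $\beta\in(0,1)$ there exists an optimal policy for the discounted cost problem, i.e. a policy $\gamma^*$ with $J_\beta(z,\gamma^* )=J_\beta^*(z)$ for all $z\in\mathcal{P}(\mathbb{X})$, and the value function $J_\beta^*:\mathcal{P}(\mathbb{X})\to\mathbb{R}$ is bounded and continuous (for the weak convergence topology on $\mathcal{P}(\mathbb{X})$). Furthermore, suppose that the channel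 $Q(\cdot|x)$ does not depend on the control variable and that all of the following hold: (1) $(\mathbb{X},d)$ is a compact metric space with diameter $D=\sup_{x,y\in\mathbb{X}}d(x,y)<\infty$; (2) $\mathcal{T}(\cdot|x,u)$ is continuous in total variation in $(x,u)$; (3) there exists $\alpha\in\mathbb{R}_+$ such that $\|\mathcal{T}(\cdot|x,u)-\mathcal{T}(\cdot|x',u)\|_{TV}\le\alpha\, d(x,x')$ for all $x,x'\in\mathbb{X}$, $u\in\mathbb{U}$; (4) there exists $K_1\in\mathbb{R}_+$ such that $|c(x,u)-c(x',u)|\le K_1\, d(x,x')$ for all $x,x'\in\mathbb{X}$, $u\in\mathbb{U}$; (5) $c:\mathbb{X}\times\mathbb{U}\to\mathbb{R}$ is bounded and continuous, and $\mathbb{U}$ is compact. Let $K_2:=\frac{\alpha D(3-2\delta(Q))}{2}$, where $\delta(Q)$ is the Dobrushin coefficient of $Q$. If $\beta\in(0,1)$ satisfies $\beta K_2<1$, then the value function $J_\beta^*$ is Lipschitz continuous on $\mathcal{P}(\mathbb{X})$ with respect to the Wasserstein metric $W_1$.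
   Context: **Model.** $\mathbb{X},\mathbb{Y},\mathbb{U}$ are standard Borel spaces (with the topologies/metrics with respect to which continuity is understood). $\mathcal{P}(S)$ denotes the set of Borel probability measures on $S$, with the topology of weak convergence. The hidden state process $X_k$ is $\mathbb{X}$-valued, with controlled transition kernel $\mathcal{T}(B|x,u)=P(X_{k+1}\in B\mid X_k=x,U_k=u)$. The controller observes $\mathbb{Y}$-valued measurements $Y_k$ generated by the channel $Q$: in general $Y_{k+1}\sim Q(\cdot|X_{k+1},U_k)$, and when the channel is independent of the control, $Y_k\sim Q(\cdot|X_k)$. An admissible policy chooses the $\mathbb{U}$-valued action $U_k$ as a measurable function of $(Y_0,\dots,Y_k,U_0,\dots,U_{k-1})$. The stage-wise cost is $c(X_k,U_k)$, and the discounted cost is $E[\sum_{k\ge0}\beta^k c(X_k,U_k)]$. **Belief-MDP.** The POMDP is equivalently treated as the fully observed MDP $(\mathcal{P}(\mathbb{X}),\mathbb{U},\eta,\tilde c)$ whose state at time $k$ is the belief $\pi_k(\cdot)=P(X_k\in\cdot\mid Y_0,\dots,Y_k,U_0,\dots,U_{k-1})\in\mathcal{P}(\mathbb{X})$. For $\pi\in\mathcal{P}(\mathbb{X})$ and $u\in\mathbb{U}$, let $H(\cdot|\pi,u)=P(Y_{k+1}\in\cdot\mid\pi_k=\pi,U_k=u)=\int_{\mathbb{X}}\int_{\mathbb{X}}Q(\cdot|x',u)\,\mathcal{T}(dx'|x,u)\,\pi(dx)$, and let $F(\pi,u,y)(\cdot)=P(X_{k+1}\in\cdot\mid\pi_k=\pi,U_k=u,Y_{k+1}=y)$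 be a measurable version of the Bayesian update (regular conditional probability). The transition kernel is $$\eta(\cdot|\pi,u)=\int_{\mathbb{Y}}1_{\{F(\pi,u,y)\in\cdot\}}\,H(dy|\pi,u),$$ and the stage cost is $\tilde c(\pi,u)=\int_{\mathbb{X}}c(x,u)\,\pi(dx)$. A policy $\gamma$ for the belief-MDP chooses $U_k$ as a measurable function of $(\pi_0,\dots,\pi_k,U_0,\dots,U_{k-1})$. For an initial belief $\pi_0=z$, $J_\beta(z,\gamma)=E_z^\gamma[\sum_{k\ge0}\beta^k\tilde c(\pi_k,U_k)]$, and the value function is $J_\beta^*(z)=\inf_\gamma J_\beta(z,\gamma)$. **Metrics.** $\|\mu-\nu\|_{TV}=\sup_{\|f\|_\infty\le1}|\int f\,d\mu-\int f\,d\nu|$, with the supremum over measurable real $f$. $W_1(\mu,\nu)=\sup\{|\int f\,d\mu-\int f\,d\nu|: f \text{ is Lipschitz with constant at most } 1 \text{ with respect to } d\}$. **Dobrushin coefficient.** For a stochastic kernel $K$ from $S_1$ to $S_2$, $\delta(K)=\inf\sum_{i=1}^n\min(K(x,A_i),K(y,A_i))$, where the infimum is over all $x,y\in S_1$ and all finite measurable partitions $\{A_i\}_{i=1}^n$ of $S_2$. *)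

theory Defs
  imports "HOL-Probability.Probability"
begin

section \<open>Spaces, probability measures and metrics on them\<close>

text \<open>A standard Borel space, with its topology, is (homeomorphic to) a Borel subset of a
  Polish space; \<^term>\<open>e\<close> is the embedding.\<close>

definition standard_borel_via :: "('a::topological_space \<Rightarrow> 'b::polish_space) \<Rightarrow> bool" where
  "standard_borel_via e \<longleftrightarrow> (\<exists>e'. homeomorphism UNIV (range e) e e') \<and> range e \<in> sets borel"

text \<open>The measurable structure on the set of probability measures is that of
  \<^const>\<open>prob_algebra\<close>, generated by the evaluations on Borel sets; over a separable metrizable
  space it is the Borel \<open>\<sigma>\<close>-algebra of the weak topology below.\<close>

abbreviation prob_measures :: "'a::topological_space measure set" where
  "prob_measures \<equiv> space (prob_algebra borel)"

definition weak_topology :: "'a::topological_space measure topology" where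
  "weak_topology = topology_generated_by
     {{\<mu> \<in> prob_measures. (\<integral>x. f x \<partial>\<mu>) \<in> V} | (f :: 'a \<Rightarrow> real) V.
        continuous_on UNIV f \<and> bounded (range f) \<and> open V}"

text \<open>The total variation distance is normalised so that it takes values in \<open>[0, 2]\<close>.\<close>

definition tv_dist :: "'a::topological_space measure \<Rightarrow> 'a measure \<Rightarrow> real" where
  "tv_dist \<mu> \<nu> = (SUP f \<in> {f :: 'a \<Rightarrow> real. f \<in> borel_measurable borel \<and> (\<forall>x. \<bar>f x\<bar> \<le> 1)}.
     \<bar>(\<integral>x. f x \<partial>\<mu>) - (\<integral>x. f x \<partial>\<nu>)\<bar>)"

definition wasserstein1 :: "'a::metric_space measure \<Rightarrow> 'a measure \<Rightarrow> real" where
  "wasserstein1 \<mu> \<nu> = (SUP f \<in> {f :: 'a \<Rightarrow> real. 1-lipschitz_on UNIV f}.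
     \<bar>(\<integral>x. f x \<partial>\<mu>) - (\<integral>x. f x \<partial>\<nu>)\<bar>)"

definition dobrushin :: "('a \<Rightarrow> 'b::topological_space measure) \<Rightarrow> real" where
  "dobrushin K = Inf {(\<Sum>A\<in>\<A>. min (measure (K x) A) (measure (K y) A)) | x y \<A>.
     finite \<A> \<and> \<A> \<subseteq> sets borel \<and> partition_on UNIV \<A>}"

section \<open>Controlled kernels\<close>

definition controlled_kernel ::
  "('a::topological_space \<Rightarrow> 'u::topological_space \<Rightarrow> 'b::topological_space measure) \<Rightarrow> bool" where
  "controlled_kernel K \<longleftrightarrow> (\<lambda>(x, u). K x u) \<in> borel \<Otimes>\<^sub>M borel \<rightarrow>\<^sub>M prob_algebra borel"

definition weakly_continuous_kernel ::
  "('a::topological_space \<Rightarrow> 'u::topological_space \<Rightarrow> 'b::topological_space measure) \<Rightarrow> bool" where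
  "weakly_continuous_kernel K \<longleftrightarrow>
     (\<forall>xs x us u. xs \<longlonglongrightarrow> x \<longrightarrow> us \<longlonglongrightarrow> u \<longrightarrow>
        limitin weak_topology (\<lambda>n. K (xs n) (us n)) (K x u) sequentially)"

definition tv_continuous_kernel ::
  "('a::topological_space \<Rightarrow> 'u::topological_space \<Rightarrow> 'b::topological_space measure) \<Rightarrow> bool" where
  "tv_continuous_kernel K \<longleftrightarrow>
     (\<forall>xs x us u. xs \<longlonglongrightarrow> x \<longrightarrow> us \<longlonglongrightarrow> u \<longrightarrow>
        (\<lambda>n. tv_dist (K (xs n) (us n)) (K x u)) \<longlonglongrightarrow> 0)"


section \<open>The belief-MDP\<close>

text \<open>Throughout, \<open>T\<close> is the transition kernel, \<open>Q x' u\<close> the law of the next observation given the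
  next state and the current action, \<open>c\<close> the stage cost.\<close>

definition obs_law ::
  "('x::topological_space \<Rightarrow> 'u \<Rightarrow> 'x measure) \<Rightarrow> ('x \<Rightarrow> 'u \<Rightarrow> 'y::topological_space measure)
    \<Rightarrow> 'x measure \<Rightarrow> 'u \<Rightarrow> 'y measure" where
  "obs_law T Q \<pi> u = \<pi> \<bind> (\<lambda>x. T x u \<bind> (\<lambda>x'. Q x' u))"

text \<open>\<open>F \<pi> u y\<close> is a jointly measurable version of the regular conditional law of the next state
  given the next observation \<open>y\<close>: the displayed identity says that integrating it against the law
  of the observation over \<open>B\<close> gives the probability that the next state lies in \<open>A\<close> and the next
  observation in \<open>B\<close>.\<close>

definition belief_update ::
  "('x::topological_space \<Rightarrow> 'u::topological_space \<Rightarrow> 'x measure)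
    \<Rightarrow> ('x \<Rightarrow> 'u \<Rightarrow> 'y::topological_space measure)
    \<Rightarrow> ('x measure \<Rightarrow> 'u \<Rightarrow> 'y \<Rightarrow> 'x measure) \<Rightarrow> bool" where
  "belief_update T Q F \<longleftrightarrow>
     (\<lambda>(\<pi>, u, y). F \<pi> u y) \<in> prob_algebra borel \<Otimes>\<^sub>M (borel \<Otimes>\<^sub>M borel) \<rightarrow>\<^sub>M prob_algebra borel \<and>
     (\<forall>\<pi> \<in> prob_measures. \<forall>u. \<forall>A \<in> sets borel. \<forall>B \<in> sets borel.
        (\<integral>\<^sup>+y\<in>B. emeasure (F \<pi> u y) A \<partial>obs_law T Q \<pi> u) =
        (\<integral>\<^sup>+x. (\<integral>\<^sup>+x'\<in>A. emeasure (Q x' u) B \<partial>T x u) \<partial>\<pi>))"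

definition belief_kernel ::
  "('x::topological_space \<Rightarrow> 'u \<Rightarrow> 'x measure) \<Rightarrow> ('x \<Rightarrow> 'u \<Rightarrow> 'y::topological_space measure)
    \<Rightarrow> ('x measure \<Rightarrow> 'u \<Rightarrow> 'y \<Rightarrow> 'x measure) \<Rightarrow> 'x measure \<Rightarrow> 'u \<Rightarrow> 'x measure measure" where
  "belief_kernel T Q F \<pi> u = distr (obs_law T Q \<pi> u) (prob_algebra borel) (F \<pi> u)"

definition belief_cost :: "('x \<Rightarrow> 'u \<Rightarrow> real) \<Rightarrow> 'x measure \<Rightarrow> 'u \<Rightarrow> real" where
  "belief_cost c \<pi> u = (\<integral>x. c x u \<partial>\<pi>)"

text \<open>At time \<open>k\<close> a policy sees the beliefs at times \<open>0, \<dots>, k\<close> and the actions at times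
  \<open>0, \<dots>, k - 1\<close>, encoded as a pair of functions that are \<^const>\<open>undefined\<close> at all other
  times.\<close>

type_synonym ('x, 'u) policy = "nat \<Rightarrow> (nat \<Rightarrow> 'x measure) \<times> (nat \<Rightarrow> 'u) \<Rightarrow> 'u"

definition policies :: "('x::topological_space, 'u::topological_space) policy set" where
  "policies = {\<gamma>. \<forall>k. \<gamma> k \<in>
     PiM {..k} (\<lambda>_. prob_algebra borel) \<Otimes>\<^sub>M PiM {..<k} (\<lambda>_. borel) \<rightarrow>\<^sub>M borel}"

text \<open>The conditional law of the belief at time \<open>k\<close>, and then of belief and action at time \<open>k\<close>, given
  the beliefs and actions \<open>\<omega>\<close> at times \<open>0, \<dots>, k - 1\<close>; \<open>z\<close> is the initial belief.\<close>

definition next_belief ::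
  "('x::topological_space measure \<Rightarrow> 'u \<Rightarrow> 'x measure measure) \<Rightarrow> 'x measure
    \<Rightarrow> nat \<Rightarrow> (nat \<Rightarrow> 'x measure \<times> 'u) \<Rightarrow> 'x measure measure" where
  "next_belief \<eta> z k \<omega> =
     (case k of 0 \<Rightarrow> return (prob_algebra borel) z
      | Suc j \<Rightarrow> \<eta> (fst (\<omega> j)) (snd (\<omega> j)))"

definition next_stage ::
  "('x::topological_space measure \<Rightarrow> 'u::topological_space \<Rightarrow> 'x measure measure)
    \<Rightarrow> ('x, 'u) policy \<Rightarrow> 'x measure
    \<Rightarrow> nat \<Rightarrow> (nat \<Rightarrow> 'x measure \<times> 'u) \<Rightarrow> ('x measure \<times> 'u) measure" where
  "next_stage \<eta> \<gamma> z k \<omega> =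
     distr (next_belief \<eta> z k \<omega>) (prob_algebra borel \<Otimes>\<^sub>M borel)
       (\<lambda>\<pi>. (\<pi>, \<gamma> k (\<lambda>i\<in>{..k}. if i = k then \<pi> else fst (\<omega> i), \<lambda>i\<in>{..<k}. snd (\<omega> i))))"

text \<open>The law of the whole sequence of beliefs and actions under \<open>\<gamma>\<close>, from the theorem of
  Ionescu-Tulcea (the limit measure of the locale \<^locale>\<open>Ionescu_Tulcea\<close>).\<close>

definition trajectory_law ::
  "('x::topological_space measure \<Rightarrow> 'u::topological_space \<Rightarrow> 'x measure measure)
    \<Rightarrow> ('x, 'u) policy \<Rightarrow> 'x measure \<Rightarrow> (nat \<Rightarrow> 'x measure \<times> 'u) measure" where
  "trajectory_law \<eta> \<gamma> z =
     projective_family.lim UNIV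
       (Ionescu_Tulcea.CI (next_stage \<eta> \<gamma> z) (\<lambda>_. prob_algebra borel \<Otimes>\<^sub>M borel))
       (\<lambda>_. prob_algebra borel \<Otimes>\<^sub>M borel)"

definition discounted_cost ::
  "('x::topological_space measure \<Rightarrow> 'u::topological_space \<Rightarrow> 'x measure measure)
    \<Rightarrow> ('x \<Rightarrow> 'u \<Rightarrow> real) \<Rightarrow> real \<Rightarrow> 'x measure \<Rightarrow> ('x, 'u) policy \<Rightarrow> real" where
  "discounted_cost \<eta> c \<beta> z \<gamma> =
     (\<integral>\<omega>. (\<Sum>k. \<beta> ^ k * belief_cost c (fst (\<omega> k)) (snd (\<omega> k))) \<partial>trajectory_law \<eta> \<gamma> z)"

definition value_function ::
  "('x::topological_space measure \<Rightarrow> 'u::topological_space \<Rightarrow> 'x measure measure)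
    \<Rightarrow> ('x \<Rightarrow> 'u \<Rightarrow> real) \<Rightarrow> real \<Rightarrow> 'x measure \<Rightarrow> real" where
  "value_function \<eta> c \<beta> z = (INF \<gamma> \<in> policies. discounted_cost \<eta> c \<beta> z \<gamma>)"

end

theory Submission
  imports Defs
begin

text \<open>
  The belief process is a fully observed control problem, and the theorem is discounted dynamic
  programming for it. What has to be shown is that the belief kernel is weakly continuous (Feller):
  if \<open>z\<^sub>n \<rightarrow> z\<close> weakly, \<open>u\<^sub>n \<rightarrow> u\<close>, and \<open>w\<close> is bounded and weakly continuous, then the integrals of \<open>w\<close>
  against the laws of the next belief converge.

  The argument is the same under both conditions. For each bounded continuous \<open>g\<close>, the integral of
  \<open>g(x') f(y)\<close> against the joint law of the next state \<open>x'\<close> and the next observation \<open>y\<close> converges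
  uniformly over all measurable \<open>f\<close> with \<open>\<bar>f\<bar> \<le> 1\<close>. Both cases follow from
  \<open>tv_kernel_uniform_convergence\<close>: a kernel that is continuous in total variation maps these
  functions \<open>f\<close> to an equicontinuous family, and weak convergence is uniform on such families. Under
  the first condition the kernel is the channel, integrated against the predicted state, which
  converges weakly; under the second it is the transition, and the channel is absorbed into the
  function of the next state. By the Bayes identity (\<open>bayes\<close>) the uniformity means that the
  observation laws converge in total variation and that the conditional expectations of \<open>g\<close> given
  the observation converge in mean. Countably many \<open>g\<close> determine weak convergence, so along a
  subsequence the updated beliefs converge weakly almost everywhere, and dominated convergence
  gives the Feller property (\<open>integral_belief_kernel_tendsto\<close>).

  The Bellman operator then preserves bounded weakly continuous functions, since the actions are
  compact, and it is a contraction with factor \<open>\<beta>\<close>; its fixed point is the limit of the iterates from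
  \<open>0\<close>. A minimizing action is selected measurably (\<open>measurable_argmin\<close>). Under any policy the
  discounted cost exceeds the fixed point by the discounted sum of the expected gaps in the Bellman
  equation (\<open>expected_bellman_limit_telescope\<close>). The gaps are nonnegative and vanish for the
  selected stationary policy, so the fixed point is the value function and this policy is optimal.

  For the last claim, let \<open>\<delta>\<close> be the Dobrushin coefficient of the channel and \<open>D\<close> the diameter.
  Two beliefs at Wasserstein distance \<open>r\<close> have predictions at total variation distance \<open>t \<le> \<alpha> r\<close>,
  observation laws at distance at most \<open>(1 - \<delta>) t\<close>, and updates whose mean Wasserstein distance is at
  most \<open>(D / 2) (2 - \<delta>) t\<close>. So the integral of an \<open>L\<close>-Lipschitz function of the next belief changes by
  at most \<open>L (D / 2) ((1 - \<delta>) + (2 - \<delta>)) t \<le> K\<^sub>2 L r\<close>, and the Bellman operator turns the Lipschitz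
  constant \<open>L\<close> into \<open>K\<^sub>1 + \<beta> K\<^sub>2 L\<close>. The fixed point \<open>K\<^sub>1 / (1 - \<beta> K\<^sub>2)\<close> of this recursion is a Lipschitz
  constant of all iterates, hence of the value function.
\<close>


section \<open>Weak convergence of probability measures\<close>

lemma prob_measuresD:
  assumes "M \<in> prob_measures"
  shows "prob_space M" "sets M = sets borel" "space M = UNIV"
  using assms sets_eq_imp_space_eq[of M borel] by (auto simp: space_prob_algebra)

lemma integrable_prob_bounded:
  fixes f :: "'a::topological_space \<Rightarrow> real"
  assumes "M \<in> prob_measures" "f \<in> borel_measurable borel" "\<And>x. \<bar>f x\<bar> \<le> B"
  shows "integrable M f"
proof -
  interpret prob_space M using assms(1) by (rule prob_measuresD)
  show ?thesis
    using assms(2,3) by (intro integrable_const_bound[where B=B])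
      (auto simp: measurable_cong_sets[OF prob_measuresD(2)[OF assms(1)] refl])
qed

lemma integral_prob_le:
  fixes f :: "'a::topological_space \<Rightarrow> real"
  assumes "M \<in> prob_measures" "f \<in> borel_measurable borel" "\<And>x. \<bar>f x\<bar> \<le> B"
  shows "\<bar>\<integral>x. f x \<partial>M\<bar> \<le> B"
proof -
  interpret prob_space M using assms(1) by (rule prob_measuresD)
  note i = integrable_prob_bounded[OF assms]
  have "(\<integral>x. f x \<partial>M) \<le> B"
    by (rule integral_le_const[OF i]) (use assms(3) abs_le_iff in auto)
  moreover have "-B \<le> (\<integral>x. f x \<partial>M)"
    by (rule integral_ge_const[OF i]) (use assms(3) in \<open>auto intro!: AE_I2 simp: abs_le_iff minus_le_iff\<close>)
  ultimately show ?thesis by linarith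
qed

text \<open>Weak convergence is handled through sequences; \<open>weakly_continuous_factor\<close> below leads back to
  the topology.\<close>

definition wconv :: "(nat \<Rightarrow> 'a::topological_space measure) \<Rightarrow> 'a measure \<Rightarrow> bool" where
  "wconv M N \<longleftrightarrow> (\<forall>n. M n \<in> prob_measures) \<and> N \<in> prob_measures \<and>
    (\<forall>f :: 'a \<Rightarrow> real. continuous_on UNIV f \<longrightarrow> bounded (range f) \<longrightarrow>
       (\<lambda>n. \<integral>x. f x \<partial>M n) \<longlonglongrightarrow> (\<integral>x. f x \<partial>N))"

lemma wconvD:
  assumes "wconv M N"
  shows "M n \<in> prob_measures" "N \<in> prob_measures"
    "continuous_on UNIV (f :: 'a::topological_space \<Rightarrow> real) \<Longrightarrow> bounded (range f) \<Longrightarrow>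
       (\<lambda>n. \<integral>x. f x \<partial>M n) \<longlonglongrightarrow> (\<integral>x. f x \<partial>N)"
  using assms by (auto simp: wconv_def)

lemma wconv_const: "M \<in> prob_measures \<Longrightarrow> wconv (\<lambda>_. M) M"
  by (auto simp: wconv_def)

lemma wconv_subseq: "wconv M N \<Longrightarrow> strict_mono r \<Longrightarrow> wconv (M \<circ> r) N"
  unfolding wconv_def
  using LIMSEQ_subseq_LIMSEQ[of "\<lambda>n. integral\<^sup>L (M n) f" "integral\<^sup>L N f" r for f]
  by (auto simp: o_def)

section \<open>A countable convergence-determining class\<close>

definition dense_seq :: "nat \<Rightarrow> 'a::{metric_space, second_countable_topology}" where
  "dense_seq = (SOME d. \<forall>x e. 0 < e \<longrightarrow> (\<exists>n. dist (d n) x < e))"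

lemma dense_seq:
  fixes x :: "'a::{metric_space, second_countable_topology}"
  assumes "0 < e"
  shows "\<exists>n. dist (dense_seq n) x < e"
proof -
  obtain D :: "'a set" where D: "countable D" "\<And>X. open X \<Longrightarrow> X \<noteq> {} \<Longrightarrow> \<exists>d\<in>D. d \<in> X"
    using countable_dense_exists[where ?'a='a] by blast
  have "D \<noteq> {}" using D(2)[of UNIV] by auto
  then have r: "range (from_nat_into D) = D" using D(1) by (rule range_from_nat_into)
  have "\<forall>x e. 0 < e \<longrightarrow> (\<exists>n. dist (from_nat_into D n) x < e)"
  proof safe
    fix x :: 'a and e :: real assume "0 < e"
    then have "\<exists>d\<in>D. d \<in> ball x e" by (intro D(2)) auto
    then obtain d where "d \<in> D" "dist d x < e" by (auto simp: dist_commute)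
    then show "\<exists>n. dist (from_nat_into D n) x < e" using r by (metis imageE)
  qed
  then have "\<forall>x e. 0 < e \<longrightarrow> (\<exists>n. dist ((dense_seq :: nat \<Rightarrow> 'a) n) x < e)"
    unfolding dense_seq_def
    by (rule someI[of "\<lambda>d::nat \<Rightarrow> 'a. \<forall>x e. 0 < e \<longrightarrow> (\<exists>n. dist (d n) x < e)"])
  with assms show ?thesis by blast
qed

text \<open>Finite maxima of cones with rational heights, integral slopes and apices in a dense sequence. The
  list only serves to make the class countable and closed under maxima, so that approximations
  from below can be made increasing.\<close>

fun bumps :: "(rat \<times> nat \<times> nat) list \<Rightarrow> 'a::{metric_space, second_countable_topology} \<Rightarrow> real" where
  "bumps [] x = 0"
| "bumps ((q, k, i) # l) x =
     max (\<bar>real_of_rat q\<bar> * max 0 (1 - real k * dist x (dense_seq i))) (bumps l x)"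

lemma bumps_nonneg: "0 \<le> bumps l x"
  by (induction l x rule: bumps.induct) (auto simp: le_max_iff_disj)

lemma bumps_append: "bumps (l @ l') x = max (bumps l x) (bumps l' x)"
  by (induction l x rule: bumps.induct) (auto simp: bumps_nonneg)

lemma bumps_bounded: "\<exists>B. \<forall>x::'a::{metric_space, second_countable_topology}. \<bar>bumps l x\<bar> \<le> B"
proof (induction l)
  case (Cons a l)
  obtain q k i where a: "a = (q, k, i)" by (cases a)
  obtain B where B: "\<And>x::'a. \<bar>bumps l x\<bar> \<le> B" using Cons by blast
  have "\<bar>bumps (a # l) x\<bar> \<le> max \<bar>real_of_rat q\<bar> B" for x :: 'a
  proof -
    have "\<bar>real_of_rat q\<bar> * max 0 (1 - real k * dist x (dense_seq i)) \<le> \<bar>real_of_rat q\<bar> * 1"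
      by (intro mult_left_mono) auto
    then show ?thesis using B[of x] bumps_nonneg[of l x] by (auto simp: a)
  qed
  then show ?case by blast
qed auto

lemma bumps_Lipschitz: "\<exists>K\<ge>0. \<forall>x y::'a::{metric_space, second_countable_topology}. \<bar>bumps l x - bumps l y\<bar> \<le> K * dist x y"
proof (induction l)
  case (Cons a l)
  obtain q k i where a: "a = (q, k, i)" by (cases a)
  obtain K where K: "K \<ge> 0" "\<And>x y::'a. \<bar>bumps l x - bumps l y\<bar> \<le> K * dist x y" using Cons by blast
  let ?b = "\<lambda>x::'a. max 0 (1 - real k * dist x (dense_seq i))"
  let ?K = "max (\<bar>real_of_rat q\<bar> * real k) K"
  have "\<bar>bumps (a # l) x - bumps (a # l) y\<bar> \<le> ?K * dist x y" for x y :: 'a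
  proof -
    have "\<bar>?b x - ?b y\<bar> \<le> \<bar>real k * dist x (dense_seq i) - real k * dist y (dense_seq i)\<bar>" by auto
    also have "\<dots> = real k * \<bar>dist x (dense_seq i) - dist y (dense_seq i)\<bar>"
      by (simp add: abs_mult flip: right_diff_distrib)
    also have "\<dots> \<le> real k * dist x y"
      by (intro mult_left_mono) (metis abs_dist_diff_le dist_commute, simp)
    finally have 1: "\<bar>real_of_rat q\<bar> * \<bar>?b x - ?b y\<bar> \<le> \<bar>real_of_rat q\<bar> * (real k * dist x y)"
      by (intro mult_left_mono) auto
    have "\<bar>\<bar>real_of_rat q\<bar> * ?b x - \<bar>real_of_rat q\<bar> * ?b y\<bar> = \<bar>real_of_rat q\<bar> * \<bar>?b x - ?b y\<bar>"
      by (simp add: abs_mult flip: right_diff_distrib)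
    with 1 have 2: "\<bar>\<bar>real_of_rat q\<bar> * ?b x - \<bar>real_of_rat q\<bar> * ?b y\<bar> \<le> (\<bar>real_of_rat q\<bar> * real k) * dist x y"
      by simp
    have "(\<bar>real_of_rat q\<bar> * real k) * dist x y \<le> ?K * dist x y" "K * dist x y \<le> ?K * dist x y"
      by (intro mult_right_mono; simp)+
    moreover have "\<bar>max a b - max c d\<bar> \<le> e" if "\<bar>a - c\<bar> \<le> e" "\<bar>b - d\<bar> \<le> e" for a b c d e :: real
      using that by (auto simp: max_def)
    ultimately show ?thesis
      unfolding a bumps.simps using 2 K(2)[of x y] by (meson order_trans)
  qed
  moreover have "?K \<ge> 0" using K by auto
  ultimately show ?case by blast
qed auto

lemma Lipschitz_imp_continuous_on:
  fixes f :: "'a::metric_space \<Rightarrow> real"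
  assumes "\<And>x y. \<bar>f x - f y\<bar> \<le> K * dist x y"
  shows "continuous_on UNIV f"
proof -
  have "(max K 0)-lipschitz_on UNIV f"
  proof (rule lipschitz_onI)
    fix x y :: 'a
    have "K * dist x y \<le> max K 0 * dist x y" by (intro mult_right_mono) auto
    with assms[of x y] show "dist (f x) (f y) \<le> max K 0 * dist x y" by (simp add: dist_real_def)
  qed auto
  then show ?thesis by (rule lipschitz_on_continuous_on)
qed

lemma continuous_bumps: "continuous_on UNIV (bumps l)"
  using bumps_Lipschitz[of l] Lipschitz_imp_continuous_on by blast

lemma bounded_range_realI: "(\<And>x. \<bar>f x :: real\<bar> \<le> B) \<Longrightarrow> bounded (range f)"
  by (auto simp: bounded_iff)

lemma bounded_range_realE:
  assumes "bounded (range (f :: 'a \<Rightarrow> real))"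
  obtains B where "\<And>x. \<bar>f x\<bar> \<le> B" "0 \<le> B"
proof -
  from assms obtain B where B: "\<And>x. \<bar>f x\<bar> \<le> B" by (auto simp: bounded_iff)
  from B[of undefined] have "0 \<le> B" by (meson abs_ge_zero order_trans)
  with B show thesis by (rule that)
qed

lemma bounded_bumps: "bounded (range (bumps l))"
  using bumps_bounded[of l] bounded_range_realI by blast

lemma bumps_approximate:
  fixes f :: "'a::{metric_space, second_countable_topology} \<Rightarrow> real"
  assumes f: "continuous_on UNIV f" and nn: "\<And>x. 0 \<le> f x" and t: "0 \<le> t" "t < f x"
  shows "\<exists>l. (\<forall>y. bumps l y \<le> f y) \<and> t < bumps l x"
proof -
  obtain q where q: "t < real_of_rat q" "real_of_rat q < f x" using of_rat_dense[OF t(2)] by blast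
  then have q0: "0 < real_of_rat q" using t by linarith
  have "open {y. real_of_rat q < f y}"
    using f by (intro open_Collect_less) auto
  then obtain r where r: "0 < r" "\<And>y. dist y x < r \<Longrightarrow> real_of_rat q < f y"
    using q(2) by (auto simp: open_dist)
  obtain k :: nat where k: "2 / r < real k" using reals_Archimedean2 by blast
  have "0 < 2 / r" using r by simp
  with k have k0: "0 < real k" by linarith
  have kr: "1 / real k < r / 2" using k r(1) k0 by (simp add: field_simps)
  have "0 < min (r/2) ((1 - t / real_of_rat q) / real k)"
    using q q0 r k0 by (auto simp: field_simps)
  from dense_seq[OF this, of x] obtain i where
    i: "dist x (dense_seq i) < r / 2" "dist x (dense_seq i) < (1 - t / real_of_rat q) / real k"
    by (auto simp: dist_commute)
  let ?l = "[(q, k, i)]"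
  have "bumps ?l y \<le> f y" for y
  proof (cases "1 - real k * dist y (dense_seq i) \<le> 0")
    case True then show ?thesis using nn by (simp add: max_def)
  next
    case False
    then have "dist y (dense_seq i) < 1 / real k" using k0 by (simp add: field_simps)
    with kr i(1) have "dist y x < r"
      using dist_triangle[of y x "dense_seq i"] by (simp add: dist_commute)
    then have "real_of_rat q < f y" by (rule r)
    moreover have "real_of_rat q * max 0 (1 - real k * dist y (dense_seq i)) \<le> real_of_rat q * 1"
      using q0 by (intro mult_left_mono) auto
    ultimately have "real_of_rat q * max 0 (1 - real k * dist y (dense_seq i)) \<le> f y" by linarith
    then show ?thesis using q0 nn[of y] by simp
  qed
  moreover have "t < bumps ?l x"
  proof -
    have "real k * dist x (dense_seq i) < 1 - t / real_of_rat q"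
      using i(2) k0 by (simp add: field_simps)
    then have "t / real_of_rat q < 1 - real k * dist x (dense_seq i)" by linarith
    then have "t < real_of_rat q * (1 - real k * dist x (dense_seq i))"
      using q0 by (simp add: field_simps)
    also have "\<dots> \<le> real_of_rat q * max 0 (1 - real k * dist x (dense_seq i))"
      using q0 by (intro mult_left_mono) auto
    finally show ?thesis using q0 by simp
  qed
  ultimately show ?thesis by blast
qed

lemma bumps_incseq:
  fixes f :: "'a::{metric_space, second_countable_topology} \<Rightarrow> real"
  assumes f: "continuous_on UNIV f" and nn: "\<And>x. 0 \<le> f x"
  obtains h where "\<And>n y. bumps (h n) y \<le> f y" "\<And>y. (\<lambda>n. bumps (h n) y) \<longlonglongrightarrow> f y"
proof -
  let ?S = "{l. \<forall>y. bumps l y \<le> f y}"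
  have "[] \<in> ?S" using nn by simp
  then have ne: "?S \<noteq> {}" by blast
  let ?e = "from_nat_into ?S"
  have e: "\<And>n. ?e n \<in> ?S" using ne by (rule from_nat_into)
  define h where "h = rec_nat [] (\<lambda>n l. ?e n @ l)"
  have h0: "h 0 = []" and hS: "h (Suc n) = ?e n @ h n" for n by (simp_all add: h_def)
  have le: "bumps (h n) y \<le> f y" for n and y :: 'a
    by (induction n) (use nn e in \<open>auto simp: h0 hS bumps_append\<close>)
  have inc: "incseq (\<lambda>n. bumps (h n) y)" for y :: 'a
    by (rule incseq_SucI) (simp add: hS bumps_append)
  have "(\<lambda>n. bumps (h n) y) \<longlonglongrightarrow> f y" for y
  proof (rule increasing_tendsto)
    show "\<forall>\<^sub>F n in sequentially. bumps (h n) y \<le> f y" using le by simp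
    fix t assume t: "t < f y"
    have "\<exists>N. t < bumps (h N) y"
    proof (cases "0 \<le> t")
      case True
      from bumps_approximate[OF f nn True t] obtain l where l: "l \<in> ?S" "t < bumps l y" by auto
      then obtain N where "?e N = l" using from_nat_into_surj[of ?S l] by auto
      with l have "t < bumps (h (Suc N)) y" by (simp add: hS bumps_append)
      then show ?thesis ..
    qed (auto simp: h0 intro!: exI[of _ 0])
    then obtain N where N: "t < bumps (h N) y" ..
    show "\<forall>\<^sub>F n in sequentially. t < bumps (h n) y"
      using incseqD[OF inc] N by (intro eventually_sequentiallyI[of N]) (rule less_le_trans)
  qed
  with le show thesis by (rule that)
qed

lemma borel_measurable_continuous_UNIV:
  "continuous_on UNIV f \<Longrightarrow> f \<in> borel_measurable borel"
  by (rule borel_measurable_continuous_onI)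

lemma bumps_measurable [measurable]: "bumps l \<in> borel_measurable borel"
  using continuous_bumps by (rule borel_measurable_continuous_UNIV)

lemma bumps_liminf:
  fixes f :: "'a::{metric_space, second_countable_topology} \<Rightarrow> real"
  assumes M: "\<And>n. M n \<in> prob_measures" and N: "N \<in> prob_measures"
    and conv: "\<And>l. (\<lambda>n. \<integral>x. bumps l x \<partial>M n) \<longlonglongrightarrow> (\<integral>x. bumps l x \<partial>N)"
    and f: "continuous_on UNIV f" "\<And>x. 0 \<le> f x" "\<And>x. f x \<le> B" and e: "0 < e"
  shows "\<forall>\<^sub>F n in sequentially. (\<integral>x. f x \<partial>N) - e < (\<integral>x. f x \<partial>M n)"
proof -
  obtain h where h: "\<And>n (y::'a). bumps (h n) y \<le> f y" "\<And>y. (\<lambda>n. bumps (h n) y) \<longlonglongrightarrow> f y"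
    using bumps_incseq[OF f(1,2)] by blast
  have fm: "f \<in> borel_measurable borel" using f(1) by (rule borel_measurable_continuous_UNIV)
  have fB: "\<bar>f x\<bar> \<le> B" for x using f(2,3)[of x] by simp
  have hB: "\<bar>bumps (h n) x\<bar> \<le> B" for n and x :: 'a
    using h(1)[of n x] f(3)[of x] bumps_nonneg[of "h n" x] by linarith
  note eqs = measurable_cong_sets[OF prob_measuresD(2)[OF N] refl]
  interpret N: prob_space N using N by (rule prob_measuresD)
  have "(\<lambda>n. \<integral>x. bumps (h n) x \<partial>N) \<longlonglongrightarrow> (\<integral>x. f x \<partial>N)"
    by (rule integral_dominated_convergence[where w="\<lambda>_. B"]) (use fm h hB in \<open>auto simp: eqs\<close>)
  then have "\<forall>\<^sub>F n in sequentially. (\<integral>x. f x \<partial>N) - e < (\<integral>x. bumps (h n) x \<partial>N)"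
    by (rule order_tendstoD) (use e in auto)
  then obtain m where m: "(\<integral>x. f x \<partial>N) - e < (\<integral>x. bumps (h m) x \<partial>N)"
    by (auto simp: eventually_sequentially)
  have "\<forall>\<^sub>F n in sequentially. (\<integral>x. f x \<partial>N) - e < (\<integral>x. bumps (h m) x \<partial>M n)"
    using conv m by (rule order_tendstoD)
  then show ?thesis
  proof eventually_elim
    case (elim n)
    have "(\<integral>x. bumps (h m) x \<partial>M n) \<le> (\<integral>x. f x \<partial>M n)"
      by (intro integral_mono integrable_prob_bounded[OF M] bumps_measurable fm) (use h hB fB in auto)
    with elim show ?case by linarith
  qed
qed

text \<open>Every nonnegative continuous function is the supremum of an increasing sequence of
  functions \<^const>\<open>bumps\<close>, so convergence of their integrals gives a lower bound
  for the limit inferior; applied to \<open>B + f\<close> and to \<open>B - f\<close> this gives weak convergence.\<close>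

lemma wconv_if_bumps:
  fixes M :: "nat \<Rightarrow> 'a::{metric_space, second_countable_topology} measure"
  assumes M: "\<And>n. M n \<in> prob_measures" and N: "N \<in> prob_measures"
    and conv: "\<And>l. (\<lambda>n. \<integral>x. bumps l x \<partial>M n) \<longlonglongrightarrow> (\<integral>x. bumps l x \<partial>N)"
  shows "wconv M N"
  unfolding wconv_def
proof (intro conjI allI impI M N)
  fix f :: "'a \<Rightarrow> real" assume f: "continuous_on UNIV f" "bounded (range f)"
  obtain B where B: "\<And>x. \<bar>f x\<bar> \<le> B" "0 \<le> B" using bounded_range_realE[OF f(2)] by blast
  have fm: "f \<in> borel_measurable borel" using f(1) by (rule borel_measurable_continuous_UNIV)
  have i: "integrable K f" if "K \<in> prob_measures" for K
    using integrable_prob_bounded[OF that fm B(1)] .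
  have p: "(\<integral>x. B + f x \<partial>K) = B + (\<integral>x. f x \<partial>K)" "(\<integral>x. B - f x \<partial>K) = B - (\<integral>x. f x \<partial>K)"
    if K: "K \<in> prob_measures" for K
  proof -
    interpret prob_space K using K by (rule prob_measuresD)
    show "(\<integral>x. B + f x \<partial>K) = B + (\<integral>x. f x \<partial>K)" "(\<integral>x. B - f x \<partial>K) = B - (\<integral>x. f x \<partial>K)"
      using i[OF K] by (simp_all add: prob_space)
  qed
  have nn: "0 \<le> B + f x" "0 \<le> B - f x" "B + f x \<le> 2 * B" "B - f x \<le> 2 * B" for x
    using B(1)[of x] by linarith+
  show "(\<lambda>n. \<integral>x. f x \<partial>M n) \<longlonglongrightarrow> (\<integral>x. f x \<partial>N)"
  proof (rule LIMSEQ_I)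
    fix e :: real assume e: "0 < e"
    have "continuous_on UNIV (\<lambda>x. B + f x)" "continuous_on UNIV (\<lambda>x. B - f x)"
      using f(1) by (auto intro!: continuous_intros)
    from bumps_liminf[OF M N conv this(1) nn(1,3) e] bumps_liminf[OF M N conv this(2) nn(2,4) e]
    have "\<forall>\<^sub>F n in sequentially. (\<integral>x. B + f x \<partial>N) - e < (\<integral>x. B + f x \<partial>M n)"
      "\<forall>\<^sub>F n in sequentially. (\<integral>x. B - f x \<partial>N) - e < (\<integral>x. B - f x \<partial>M n)" .
    then have "\<forall>\<^sub>F n in sequentially. norm ((\<integral>x. f x \<partial>M n) - (\<integral>x. f x \<partial>N)) < e"
      by eventually_elim (use M N p in \<open>simp add: abs_less_iff\<close>)
    then show "\<exists>no. \<forall>n\<ge>no. norm ((\<integral>x. f x \<partial>M n) - (\<integral>x. f x \<partial>N)) < e"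
      by (simp add: eventually_sequentially)
  qed
qed

section \<open>Weakly continuous functions\<close>

definition weakly_continuous :: "('a::topological_space measure \<Rightarrow> real) \<Rightarrow> bool" where
  "weakly_continuous v \<longleftrightarrow> (\<forall>M N. wconv M N \<longrightarrow> (\<lambda>n. v (M n)) \<longlonglongrightarrow> v N)"

definition coords :: "'a::{metric_space, second_countable_topology} measure \<Rightarrow> nat \<Rightarrow> real" where
  "coords \<mu> i = (\<integral>x. bumps (from_nat i) x \<partial>\<mu>)"

lemma wconv_coords:
  assumes "\<And>n. M n \<in> prob_measures" "N \<in> prob_measures"
    "\<And>i. (\<lambda>n. coords (M n) i) \<longlonglongrightarrow> coords N i"
  shows "wconv M N"
proof (rule wconv_if_bumps[OF assms(1,2)])
  fix l show "(\<lambda>n. \<integral>x. bumps l x \<partial>M n) \<longlonglongrightarrow> (\<integral>x. bumps l x \<partial>N)"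
    using assms(3)[of "to_nat l"] by (simp add: coords_def)
qed

text \<open>Convergence in \<open>prob_measures\<close> is convergence of countably many integrals. A sequentially
  continuous function therefore factors through the metrizable, second countable space
  \<open>nat \<Rightarrow> real\<close>, where sequential continuity is continuity and continuous functions are Borel. This
  yields both the continuity of value functions for the weak topology and their measurability for
  \<open>prob_algebra borel\<close>.\<close>

lemma weakly_continuous_factor:
  fixes v :: "'a::{metric_space, second_countable_topology} measure \<Rightarrow> real"
  assumes "weakly_continuous v"
  obtains v' where "continuous_on (coords ` (prob_measures :: 'a measure set)) v'"
    "\<And>\<mu>. \<mu> \<in> prob_measures \<Longrightarrow> v \<mu> = v' (coords \<mu>)"
proof -
  let ?P = "prob_measures :: 'a measure set"
  let ?i = "inv_into ?P coords"
  have i: "?i y \<in> ?P" "coords (?i y) = y" if "y \<in> coords ` ?P" for y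
    using that by (auto simp: inv_into_into f_inv_into_f)
  have "continuous_on (coords ` ?P) (\<lambda>y. v (?i y))"
    unfolding continuous_on_sequentially
  proof (intro allI ballI impI, elim conjE)
    fix s :: "nat \<Rightarrow> nat \<Rightarrow> real" and a assume a: "a \<in> coords ` ?P" and s: "\<forall>n. s n \<in> coords ` ?P" "s \<longlonglongrightarrow> a"
    have "wconv (\<lambda>n. ?i (s n)) (?i a)"
    proof (rule wconv_coords)
      fix j
      have "(\<lambda>n. s n j) \<longlonglongrightarrow> a j"
        using continuous_on_tendsto_compose[OF continuous_on_product_coordinates s(2), of j] by simp
      then show "(\<lambda>n. coords (?i (s n)) j) \<longlonglongrightarrow> coords (?i a) j" using i a s(1) by simp
    qed (use i a s in auto)
    with assms show "((\<lambda>y. v (?i y)) \<circ> s) \<longlonglongrightarrow> v (?i a)"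
      by (auto simp: weakly_continuous_def o_def)
  qed
  moreover have "v \<mu> = v (?i (coords \<mu>))" if \<mu>: "\<mu> \<in> ?P" for \<mu>
  proof -
    have c: "coords \<mu> \<in> coords ` ?P" using \<mu> by auto
    have "wconv (\<lambda>_. \<mu>) (?i (coords \<mu>))"
      by (rule wconv_coords) (use i[OF c] \<mu> in auto)
    with assms have "(\<lambda>_::nat. v \<mu>) \<longlonglongrightarrow> v (?i (coords \<mu>))" by (auto simp: weakly_continuous_def)
    then show ?thesis by (simp add: LIMSEQ_const_iff)
  qed
  ultimately show thesis by (rule that)
qed

lemma measurable_integral_prob [measurable]:
  fixes f :: "'a \<Rightarrow> real"
  assumes "f \<in> borel_measurable N"
  shows "(\<lambda>\<mu>. \<integral>x. f x \<partial>\<mu>) \<in> borel_measurable (prob_algebra N)"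
  unfolding prob_algebra_def
  by (intro measurable_restrict_space1 integral_measurable_subprob_algebra assms)

lemma measurable_coords: "coords \<in> borel_measurable (prob_algebra borel)"
proof -
  have "coords \<in> prob_algebra borel \<rightarrow>\<^sub>M (\<Pi>\<^sub>M i\<in>UNIV. borel)"
    by (rule measurable_PiM_single') (auto simp: coords_def)
  then show ?thesis by (simp add: measurable_cong_sets[OF refl sets_PiM_equal_borel])
qed

lemma weakly_continuous_measurable:
  fixes v :: "'a::{metric_space, second_countable_topology} measure \<Rightarrow> real"
  assumes "weakly_continuous v"
  shows "v \<in> borel_measurable (prob_algebra borel)"
proof -
  obtain v' where v': "continuous_on (coords ` (prob_measures :: 'a measure set)) v'"
    "\<And>\<mu>. \<mu> \<in> prob_measures \<Longrightarrow> v \<mu> = v' (coords \<mu> :: nat \<Rightarrow> real)"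
    using weakly_continuous_factor[OF assms] by blast
  have 1: "(coords :: 'a measure \<Rightarrow> _) \<in> prob_algebra borel \<rightarrow>\<^sub>M restrict_space borel (coords ` (prob_measures :: 'a measure set))"
    by (rule measurable_restrict_space2) (auto intro: measurable_coords)
  have 2: "v' \<in> borel_measurable (restrict_space borel (coords ` (prob_measures :: 'a measure set)))"
    using v'(1) by (rule borel_measurable_continuous_on_restrict)
  from measurable_compose[OF 1 2] show ?thesis
    by (rule measurable_cong[THEN iffD1, rotated]) (simp add: v')
qed

lemma topspace_weak_topology: "topspace weak_topology = prob_measures"
proof -
  have "prob_measures = {\<mu> \<in> prob_measures. (\<integral>x. (0::real) \<partial>\<mu>) \<in> UNIV}" by simp
  then have "prob_measures \<in> {{\<mu> \<in> prob_measures. (\<integral>x. f x \<partial>\<mu>) \<in> V} | (f :: 'a \<Rightarrow> real) V.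
        continuous_on UNIV f \<and> bounded (range f) \<and> open V}"
    by (intro CollectI exI[of _ "\<lambda>_. 0"] exI[of _ UNIV]) auto
  then show ?thesis unfolding weak_topology_def topology_generated_by_topspace by blast
qed

lemma continuous_map_integral:
  fixes f :: "'a::topological_space \<Rightarrow> real"
  assumes "continuous_on UNIV f" "bounded (range f)"
  shows "continuous_map weak_topology euclideanreal (\<lambda>\<mu>. \<integral>x. f x \<partial>\<mu>)"
  unfolding continuous_map_def topspace_weak_topology
proof (intro conjI allI impI)
  fix V :: "real set" assume "openin euclidean V"
  then have "open V" by simp
  with assms show "openin weak_topology {\<mu> \<in> prob_measures. (\<integral>x. f x \<partial>\<mu>) \<in> V}"
    unfolding weak_topology_def by (intro topology_generated_by_Basis) blast
qed auto

lemma weakly_continuous_continuous_map: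
  fixes v :: "'a::{metric_space, second_countable_topology} measure \<Rightarrow> real"
  assumes "weakly_continuous v"
  shows "continuous_map weak_topology euclideanreal v"
proof -
  obtain v' where v': "continuous_on (coords ` (prob_measures :: 'a measure set)) v'"
    "\<And>\<mu>. \<mu> \<in> prob_measures \<Longrightarrow> v \<mu> = v' (coords \<mu> :: nat \<Rightarrow> real)"
    using weakly_continuous_factor[OF assms] by blast
  have "continuous_map weak_topology (product_topology (\<lambda>_. euclideanreal) UNIV)
    (coords :: 'a measure \<Rightarrow> _)"
    unfolding continuous_map_componentwise_UNIV coords_def
    using continuous_map_integral continuous_bumps bounded_bumps by blast
  then have "continuous_map weak_topology euclidean (coords :: 'a measure \<Rightarrow> _)"
    by (simp add: euclidean_product_topology)
  then have "continuous_map weak_topology (top_of_set (coords ` (prob_measures :: 'a measure set)))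
      (coords :: 'a measure \<Rightarrow> _)"
    by (auto simp: continuous_map_in_subtopology topspace_weak_topology)
  moreover have "continuous_map (top_of_set (coords ` (prob_measures :: 'a measure set))) euclideanreal v'"
    using v'(1) by (simp add: continuous_map_iff_continuous)
  ultimately have "continuous_map weak_topology euclideanreal (v' \<circ> (coords :: 'a measure \<Rightarrow> _))"
    by (rule continuous_map_compose)
  then show ?thesis
    by (rule continuous_map_eq) (simp add: v' topspace_weak_topology)
qed

lemma limitin_weak_topology_imp_wconv:
  assumes M: "\<And>n. M n \<in> prob_measures" and lim: "limitin weak_topology M N sequentially"
  shows "wconv M N"
  unfolding wconv_def
proof (intro conjI allI impI M)
  show N: "N \<in> prob_measures" using lim by (auto simp: limitin_def topspace_weak_topology)
  fix f :: "'a \<Rightarrow> real" assume f: "continuous_on UNIV f" "bounded (range f)"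
  show "(\<lambda>n. \<integral>x. f x \<partial>M n) \<longlonglongrightarrow> (\<integral>x. f x \<partial>N)"
    using continuous_map_limit[OF continuous_map_integral[OF f] lim] by (simp add: o_def)
qed

section \<open>Weak convergence with a convergent parameter\<close>

text \<open>The products of \<open>M n\<close> with the point mass at \<open>u n\<close> converge weakly: the test functions
  \<open>bumps\<close> on the product space are Lipschitz, so replacing \<open>u n\<close> by its limit costs at most a
  multiple of the distance between the two.\<close>

lemma wconv_parameter:
  fixes M :: "nat \<Rightarrow> 'a::{metric_space, second_countable_topology} measure"
    and u :: "nat \<Rightarrow> 'b::{metric_space, second_countable_topology}"
    and f :: "'a \<times> 'b \<Rightarrow> real"
  assumes M: "wconv M N" and u: "u \<longlonglongrightarrow> v" and f: "continuous_on UNIV f" "bounded (range f)"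
  shows "(\<lambda>n. \<integral>x. f (x, u n) \<partial>M n) \<longlonglongrightarrow> (\<integral>x. f (x, v) \<partial>N)"
proof -
  let ?D = "\<lambda>K w. distr K borel (\<lambda>x. (x, w))"
  have pm: "(\<lambda>x::'a. (x, w::'b)) \<in> K \<rightarrow>\<^sub>M borel" if "K \<in> prob_measures" for K w
    unfolding measurable_cong_sets[OF prob_measuresD(2)[OF that] refl]
    by (intro borel_measurable_continuous_onI continuous_intros)
  have D: "?D K w \<in> prob_measures" if "K \<in> prob_measures" for K :: "'a measure" and w :: 'b
    using prob_space.prob_space_distr[OF prob_measuresD(1)[OF that] pm[OF that]]
    by (auto simp: space_prob_algebra)
  have I: "(\<integral>p. g p \<partial>?D K w) = (\<integral>x. g (x, w) \<partial>K)"
    if "K \<in> prob_measures" "g \<in> borel_measurable borel" for K :: "'a measure" and w :: 'b and g :: "_ \<Rightarrow> real"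
    using that pm[OF that(1)] by (intro integral_distr) auto
  note MN = wconvD(1,2)[OF M]
  have "wconv (\<lambda>n. ?D (M n) (u n)) (?D N v)"
  proof (rule wconv_if_bumps)
    fix l
    obtain K where K: "0 \<le> K" "\<And>p q :: 'a \<times> 'b. \<bar>bumps l p - bumps l q\<bar> \<le> K * dist p q"
      using bumps_Lipschitz[of l] by blast
    obtain B where B: "\<bar>bumps l p\<bar> \<le> B" for p :: "'a \<times> 'b" using bumps_bounded[of l] by blast
    have c: "continuous_on UNIV (\<lambda>x::'a. bumps l (x, w::'b))" for w
      by (intro continuous_on_compose2[OF continuous_bumps] continuous_intros) auto
    have cm: "(\<lambda>x::'a. bumps l (x, w::'b)) \<in> borel_measurable borel" for w
      by (rule borel_measurable_continuous_UNIV[OF c])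
    have 1: "(\<lambda>n. \<integral>x. bumps l (x, v) \<partial>M n) \<longlonglongrightarrow> (\<integral>x. bumps l (x, v) \<partial>N)"
      by (rule wconvD(3)[OF M c bounded_range_realI]) (rule B)
    have 2: "(\<lambda>n. (\<integral>x. bumps l (x, u n) \<partial>M n) - (\<integral>x. bumps l (x, v) \<partial>M n)) \<longlonglongrightarrow> 0"
    proof (rule Lim_null_comparison)
      show "(\<lambda>n. K * dist (u n) v) \<longlonglongrightarrow> 0"
        using tendsto_mult_right_zero[OF tendsto_dist_iff[THEN iffD1, OF u]] .
      have "norm ((\<integral>x. bumps l (x, u n) \<partial>M n) - (\<integral>x. bumps l (x, v) \<partial>M n)) \<le> K * dist (u n) v" for n
      proof -
        have "(\<integral>x. bumps l (x, u n) \<partial>M n) - (\<integral>x. bumps l (x, v) \<partial>M n)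
            = (\<integral>x. bumps l (x, u n) - bumps l (x, v) \<partial>M n)"
          by (intro Bochner_Integration.integral_diff[symmetric] integrable_prob_bounded[OF MN(1) cm]; rule B)
        moreover have "\<bar>\<integral>x. bumps l (x, u n) - bumps l (x, v) \<partial>M n\<bar> \<le> K * dist (u n) v"
        proof (intro integral_prob_le[OF MN(1)] borel_measurable_diff cm)
          fix x :: 'a
          show "\<bar>bumps l (x, u n) - bumps l (x, v)\<bar> \<le> K * dist (u n) v"
            using K(2)[of "(x, u n)" "(x, v)"] by (simp add: dist_Pair_Pair)
        qed
        ultimately show ?thesis by simp
      qed
      then show "\<forall>\<^sub>F n in sequentially. norm ((\<integral>x. bumps l (x, u n) \<partial>M n) - (\<integral>x. bumps l (x, v) \<partial>M n)) \<le> K * dist (u n) v"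
        by simp
    qed
    from tendsto_add[OF 1 2] show "(\<lambda>n. \<integral>p. bumps l p \<partial>?D (M n) (u n)) \<longlonglongrightarrow> (\<integral>p. bumps l p \<partial>?D N v)"
      by (simp add: I MN)
  qed (use D MN in auto)
  from wconvD(3)[OF this f] show ?thesis
    by (simp add: I MN borel_measurable_continuous_UNIV[OF f(1)])
qed

section \<open>Total variation and kernels\<close>

lemma tv_dist_bound:
  fixes f :: "'a::topological_space \<Rightarrow> real"
  assumes "\<mu> \<in> prob_measures" "\<nu> \<in> prob_measures" "f \<in> borel_measurable borel" "\<And>x. \<bar>f x\<bar> \<le> 1"
  shows "\<bar>(\<integral>x. f x \<partial>\<mu>) - (\<integral>x. f x \<partial>\<nu>)\<bar> \<le> tv_dist \<mu> \<nu>"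
  unfolding tv_dist_def
proof (rule cSUP_upper)
  show "bdd_above ((\<lambda>f. \<bar>(\<integral>x. f x \<partial>\<mu>) - (\<integral>x. f x \<partial>\<nu>)\<bar>) `
      {f :: 'a \<Rightarrow> real. f \<in> borel_measurable borel \<and> (\<forall>x. \<bar>f x\<bar> \<le> 1)})"
  proof (rule bdd_aboveI2[where M=2])
    fix h :: "'a \<Rightarrow> real" assume "h \<in> {f. f \<in> borel_measurable borel \<and> (\<forall>x. \<bar>f x\<bar> \<le> 1)}"
    then have "\<bar>\<integral>x. h x \<partial>\<mu>\<bar> \<le> 1" "\<bar>\<integral>x. h x \<partial>\<nu>\<bar> \<le> 1"
      using assms(1,2) by (auto intro!: integral_prob_le)
    then show "\<bar>(\<integral>x. h x \<partial>\<mu>) - (\<integral>x. h x \<partial>\<nu>)\<bar> \<le> 2" by linarith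
  qed
qed (use assms in auto)

lemma tv_dist_least:
  assumes "\<And>f :: 'a::topological_space \<Rightarrow> real. f \<in> borel_measurable borel \<Longrightarrow> (\<And>x. \<bar>f x\<bar> \<le> 1)
    \<Longrightarrow> \<bar>(\<integral>x. f x \<partial>\<mu>) - (\<integral>x. f x \<partial>\<nu>)\<bar> \<le> e"
  shows "tv_dist \<mu> \<nu> \<le> e"
  unfolding tv_dist_def
proof (rule cSUP_least)
  have "(\<lambda>_. 0) \<in> {f :: 'a \<Rightarrow> real. f \<in> borel_measurable borel \<and> (\<forall>x. \<bar>f x\<bar> \<le> 1)}" by simp
  then show "{f :: 'a \<Rightarrow> real. f \<in> borel_measurable borel \<and> (\<forall>x. \<bar>f x\<bar> \<le> 1)} \<noteq> {}" by blast
qed (use assms in auto)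

text \<open>Only homogeneity is asked of \<open>\<Phi>\<close>: differences of integrals have it even for functions that are
  not integrable.\<close>

lemma bounded_by_scaling:
  fixes \<Phi> :: "('a::topological_space \<Rightarrow> real) \<Rightarrow> real"
  assumes "\<And>f. f \<in> borel_measurable borel \<Longrightarrow> (\<And>x. \<bar>f x\<bar> \<le> 1) \<Longrightarrow> \<bar>\<Phi> f\<bar> \<le> e"
    and "\<And>f c. \<Phi> (\<lambda>x. f x / c) = \<Phi> f / c"
    and "f \<in> borel_measurable borel" "\<And>x. \<bar>f x\<bar> \<le> C" "0 < C"
  shows "\<bar>\<Phi> f\<bar> \<le> C * e"
proof -
  have "\<bar>\<Phi> (\<lambda>x. f x / C)\<bar> \<le> e"
    using assms(3-5) by (intro assms(1)) auto
  then show ?thesis using assms(2,5) by (simp add: field_simps)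
qed

lemma tv_dist_bound_scaled:
  fixes f :: "'a::topological_space \<Rightarrow> real"
  assumes "\<mu> \<in> prob_measures" "\<nu> \<in> prob_measures" "f \<in> borel_measurable borel" "\<And>x. \<bar>f x\<bar> \<le> C"
  shows "\<bar>(\<integral>x. f x \<partial>\<mu>) - (\<integral>x. f x \<partial>\<nu>)\<bar> \<le> C * tv_dist \<mu> \<nu>"
proof (cases "C = 0")
  case True then show ?thesis using assms(4) by simp
next
  case False
  moreover have "0 \<le> C" using assms(4)[of undefined] by (meson abs_ge_zero order_trans)
  ultimately show ?thesis
    by (intro bounded_by_scaling[where \<Phi>="\<lambda>f. (\<integral>x. f x \<partial>\<mu>) - (\<integral>x. f x \<partial>\<nu>)"] assms(3,4) tv_dist_bound assms(1,2))
      (auto simp: diff_divide_distrib)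
qed

lemma tv_dist_nonneg:
  assumes "\<mu> \<in> prob_measures" "\<nu> \<in> prob_measures"
  shows "0 \<le> tv_dist \<mu> \<nu>"
  using tv_dist_bound[OF assms, of "\<lambda>_. 0"] by simp

lemma bind_prob_measures:
  assumes "M \<in> prob_measures" "K \<in> borel \<rightarrow>\<^sub>M prob_algebra borel"
  shows "M \<bind> K \<in> prob_measures"
  using prob_space_bind'[OF assms] sets_bind'[OF assms] by (simp add: space_prob_algebra)

lemma integral_bind_prob:
  fixes f :: "'b::topological_space \<Rightarrow> real"
  assumes "M \<in> prob_measures" "K \<in> borel \<rightarrow>\<^sub>M prob_algebra borel"
    and "f \<in> borel_measurable borel" "\<And>x. \<bar>f x\<bar> \<le> B"
  shows "(\<integral>x. f x \<partial>(M \<bind> K)) = (\<integral>x. (\<integral>y. f y \<partial>K x) \<partial>M)"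
proof (rule integral_bind[where K=borel and B=B and B'=1])
  interpret prob_space M using assms(1) by (rule prob_measuresD)
  show "finite_measure M" by (rule finite_measure_axioms)
  show K: "K \<in> M \<rightarrow>\<^sub>M subprob_algebra borel"
    unfolding measurable_cong_sets[OF prob_measuresD(2)[OF assms(1)] refl]
    using assms(2) by (rule measurable_prob_algebraD)
  have "K x \<in> prob_measures" for x using measurable_space[OF assms(2)] by simp
  from prob_space.emeasure_space_1[OF prob_measuresD(1)[OF this]]
  show "AE x in M. emeasure (K x) (space (K x)) \<le> ennreal 1" by simp
qed (use assms in auto)

lemma measurable_kernel_integral:
  fixes f :: "'b::topological_space \<Rightarrow> real"
  assumes "K \<in> M \<rightarrow>\<^sub>M prob_algebra borel" "f \<in> borel_measurable borel"
  shows "(\<lambda>x. \<integral>y. f y \<partial>K x) \<in> borel_measurable M"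
  using measurable_compose[OF assms(1) measurable_integral_prob[OF assms(2)]] .

lemma controlled_kernelD:
  fixes K :: "'a::topological_space \<Rightarrow> 'u::topological_space \<Rightarrow> 'b::topological_space measure"
  assumes "controlled_kernel K"
  shows "(\<lambda>x. K x u) \<in> borel \<rightarrow>\<^sub>M prob_algebra borel" "K x u \<in> prob_measures"
proof -
  have "(\<lambda>x. (x, u)) \<in> borel \<rightarrow>\<^sub>M borel \<Otimes>\<^sub>M (borel :: 'u measure)" by simp
  from measurable_compose[OF this assms[unfolded controlled_kernel_def]]
  show 1: "(\<lambda>x. K x u) \<in> borel \<rightarrow>\<^sub>M prob_algebra borel" by simp
  from measurable_space[OF this] show "K x u \<in> prob_measures" by simp
qed

lemma tendsto_dist_inverse:
  fixes s :: "nat \<Rightarrow> 'a::metric_space"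
  assumes "\<And>n. dist (s n) a < inverse (real (Suc n))"
  shows "s \<longlonglongrightarrow> a"
  by (rule tendsto_dist_iff[THEN iffD2], rule Lim_null_comparison[OF _ LIMSEQ_inverse_real_of_nat])
    (use assms in \<open>auto intro!: always_eventually less_imp_le\<close>)

lemma tv_continuous_local:
  fixes K :: "'a::metric_space \<Rightarrow> 'u::metric_space \<Rightarrow> 'b::topological_space measure"
  assumes K: "tv_continuous_kernel K" and e: "0 < e"
  shows "\<exists>r>0. \<forall>y w. dist y x < r \<longrightarrow> dist w v < r \<longrightarrow> tv_dist (K y w) (K x v) < e"
proof (rule ccontr)
  assume "\<not> ?thesis"
  then have "\<exists>y w. dist y x < inverse (Suc n) \<and> dist w v < inverse (Suc n) \<and> e \<le> tv_dist (K y w) (K x v)" for n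
    by (metis inverse_positive_iff_positive not_le of_nat_0_less_iff zero_less_Suc)
  then obtain y w where yw: "\<And>n. dist (y n) x < inverse (Suc n)" "\<And>n. dist (w n) v < inverse (Suc n)"
    "\<And>n. e \<le> tv_dist (K (y n) (w n)) (K x v)" by metis
  have "y \<longlonglongrightarrow> x" "w \<longlonglongrightarrow> v"
    using yw(1,2) by (auto intro: tendsto_dist_inverse)
  with K have "(\<lambda>n. tv_dist (K (y n) (w n)) (K x v)) \<longlonglongrightarrow> 0"
    by (auto simp: tv_continuous_kernel_def)
  from LIMSEQ_le_const[OF this] yw(3) e show False by (meson linorder_not_le)
qed

text \<open>The functions \<open>x \<mapsto> \<integral>f dK(x, u)\<close> with \<open>\<bar>f\<bar> \<le> 1\<close> are equicontinuous, so weak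
  convergence is uniform over them: up to a set of small mass the space is covered by finitely
  many balls on which all these functions are nearly constant, and a subordinate continuous
  partition of unity replaces each of them by a combination of finitely many fixed continuous
  functions with bounded coefficients.\<close>

lemma tv_kernel_uniform_convergence:
  fixes K :: "'a::{metric_space, second_countable_topology} \<Rightarrow> 'u::metric_space \<Rightarrow> 'b::topological_space measure"
    and g :: "'a \<Rightarrow> real"
  assumes K: "controlled_kernel K" "tv_continuous_kernel K"
    and M: "wconv M N" and u: "u \<longlonglongrightarrow> v"
    and g: "continuous_on UNIV g" "\<And>x. \<bar>g x\<bar> \<le> C" and e0: "0 < e0"
  shows "\<forall>\<^sub>F n in sequentially. \<forall>f :: 'b \<Rightarrow> real. f \<in> borel_measurable borel \<longrightarrow> (\<forall>y. \<bar>f y\<bar> \<le> 1) \<longrightarrow>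
    \<bar>(\<integral>x. g x * (\<integral>y. f y \<partial>K x (u n)) \<partial>M n) - (\<integral>x. g x * (\<integral>y. f y \<partial>K x v) \<partial>N)\<bar> \<le> e0"
proof -
  have Kp: "K x u \<in> prob_measures" for x u using controlled_kernelD(2)[OF K(1)] .
  note MN = wconvD(1,2)[OF M]
  have C: "0 \<le> C" using g(2)[of undefined] abs_ge_zero[of "g undefined"] by linarith
  \<comment> \<open>Each of the two integrals contributes \<open>C e\<close> for the oscillation on the balls and \<open>C e\<close> for the
    uncovered mass; the coefficients contribute another \<open>e\<close>.\<close>
  define e where "e = e0 / (4 * C + 1)"
  have e: "0 < e" using e0 C by (simp add: e_def)
  have ee: "4 * C * e + e = e0" proof -
    have "(4 * C + 1) * e = e0" using C by (simp add: e_def)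
    then show ?thesis by (simp add: distrib_right)
  qed
  have "\<forall>x. \<exists>r. 0 < r \<and> (\<forall>y w. dist y x < r \<longrightarrow> dist w v < r \<longrightarrow> tv_dist (K y w) (K x v) < e)"
    using tv_continuous_local[OF K(2) e, of _ v] by blast
  from choice[OF this] obtain r where
    r: "\<And>x. 0 < r x" "\<And>x y w. dist y x < r x \<Longrightarrow> dist w v < r x \<Longrightarrow> tv_dist (K y w) (K x v) < e"
    by blast
  obtain \<U> where \<U>: "\<U> \<subseteq> range (\<lambda>x. ball x (r x))" "countable \<U>" "\<Union>\<U> = \<Union>(range (\<lambda>x. ball x (r x)))"
    by (rule Lindelof[of "range (\<lambda>x. ball x (r x))"]) auto
  then obtain X where X: "countable X" "\<U> = (\<lambda>x. ball x (r x)) ` X"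
    using countable_subset_image[of \<U> "\<lambda>x. ball x (r x)" UNIV] by auto
  have cov: "\<exists>x\<in>X. dist y x < r x" for y
  proof -
    have "y \<in> ball y (r y)" using r(1)[of y] by simp
    then have "y \<in> \<Union>\<U>" unfolding \<U>(3) by blast
    then obtain x where "x \<in> X" "y \<in> ball x (r x)" unfolding X(2) by blast
    then show ?thesis by (intro bexI[of _ x]) (simp_all add: dist_commute)
  qed
  define c where "c = from_nat_into X"
  have "X \<noteq> {}" using cov by blast
  then have c: "range c = X" unfolding c_def using X(1) by (rule range_from_nat_into)
  \<comment> \<open>The functions \<open>p m j\<close> with \<open>j < m\<close> together with \<open>q m\<close> form a partition of unity; \<open>p m j\<close> vanishes
    outside the \<open>j\<close>-th ball, and \<open>q m\<close>, the uncovered part, tends to \<open>0\<close> because the balls cover the space.\<close>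
  define b where "b j x = max 0 (1 - dist x (c j) / r (c j))" for j x
  define S where "S m x = (\<Sum>j<m. b j x)" for m :: nat and x
  define q where "q m x = 1 / (real (Suc m) * S m x + 1)" for m x
  define p where "p m j x = real (Suc m) * b j x / (real (Suc m) * S m x + 1)" for m j x
  have b0: "0 \<le> b j x" for j x by (simp add: b_def)
  have bpos: "dist x (c j) < r (c j)" if "b j x \<noteq> 0" for j x
  proof (rule ccontr)
    assume "\<not> dist x (c j) < r (c j)"
    then have "1 \<le> dist x (c j) / r (c j)" using r(1)[of "c j"] by simp
    with that show False by (simp add: b_def)
  qed
  have bpos': "0 < b j x" if "dist x (c j) < r (c j)" for j x
    using that r(1)[of "c j"] by (simp add: b_def less_max_iff_disj)
  have S0: "0 \<le> S m x" for m x by (simp add: S_def b0 sum_nonneg)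
  have den: "0 < real (Suc m) * S m x + 1" for m x
    using S0[of m x] by (intro add_nonneg_pos mult_nonneg_nonneg) auto
  have q0: "0 \<le> q m x" "q m x \<le> 1" for m x
  proof -
    have "1 \<le> real (Suc m) * S m x + 1" using S0[of m x] by simp
    then show "0 \<le> q m x" "q m x \<le> 1" unfolding q_def by (simp_all add: divide_le_eq)
  qed
  have p0: "0 \<le> p m j x" for m j x
    unfolding p_def using b0 den[of m x] by (intro divide_nonneg_pos mult_nonneg_nonneg) auto
  have pq: "(\<Sum>j<m. p m j x) + q m x = 1" for m x
  proof -
    have "(\<Sum>j<m. p m j x) = real (Suc m) * S m x / (real (Suc m) * S m x + 1)"
      unfolding p_def S_def by (simp add: sum_divide_distrib[symmetric] sum_distrib_left[symmetric])
    then show ?thesis using den[of m x] by (simp add: q_def add_divide_distrib[symmetric])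
  qed
  have cb: "continuous_on UNIV (b j)" for j
    unfolding b_def using r(1)[of "c j"] by (intro continuous_intros) auto
  have cS: "continuous_on UNIV (S m)" for m
    unfolding S_def by (intro continuous_intros cb)
  have cq: "continuous_on UNIV (q m)" for m
    unfolding q_def using den[of m] by (intro continuous_intros cS) (auto simp: less_imp_neq[symmetric])
  have cp: "continuous_on UNIV (p m j)" for m j
    unfolding p_def using den[of m] by (intro continuous_intros cS cb) (auto simp: less_imp_neq[symmetric])
  have qlim: "(\<lambda>m. q m x) \<longlonglongrightarrow> 0" for x
  proof -
    obtain j where j: "dist x (c j) < r (c j)" using cov[of x] c by auto
    have le: "q m x \<le> inverse (b j x) * inverse (real (Suc m))" if "j < m" for m
    proof -
      have "b j x \<le> S m x" unfolding S_def using that b0 by (intro member_le_sum) auto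
      then have "real (Suc m) * b j x \<le> real (Suc m) * S m x" by (intro mult_left_mono) auto
      then have "real (Suc m) * b j x \<le> real (Suc m) * S m x + 1" by linarith
      then have "q m x \<le> 1 / (real (Suc m) * b j x)"
        unfolding q_def using bpos'[OF j] by (intro divide_left_mono mult_pos_pos den) auto
      then show ?thesis by (simp add: field_simps)
    qed
    show ?thesis
    proof (rule tendsto_sandwich[OF _ _ tendsto_const])
      show "\<forall>\<^sub>F m in sequentially. q m x \<le> inverse (b j x) * inverse (real (Suc m))"
        using le by (intro eventually_sequentiallyI[of "Suc j"]) auto
      show "(\<lambda>m. inverse (b j x) * inverse (real (Suc m))) \<longlonglongrightarrow> 0"
        using tendsto_mult_right_zero[OF LIMSEQ_inverse_real_of_nat] .
    qed (simp add: q0)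
  qed
  have qm: "q m \<in> borel_measurable borel" for m using cq by (rule borel_measurable_continuous_UNIV)
  interpret N: prob_space N using MN(2) by (rule prob_measuresD)
  have "(\<lambda>m. \<integral>x. q m x \<partial>N) \<longlonglongrightarrow> (\<integral>x. 0 \<partial>N)"
    by (rule integral_dominated_convergence[where w="\<lambda>_. 1"])
      (use qlim q0 qm in \<open>auto simp: measurable_cong_sets[OF prob_measuresD(2)[OF MN(2)] refl]\<close>)
  then have "\<forall>\<^sub>F m in sequentially. (\<integral>x. q m x \<partial>N) < e" using e by (auto dest: order_tendstoD)
  then obtain m where m: "(\<integral>x. q m x \<partial>N) < e" by (auto simp: eventually_sequentially)
  have key: "\<bar>(\<integral>x. g x * (\<integral>y. f y \<partial>K x w) \<partial>L) - (\<Sum>j<m. (\<integral>y. f y \<partial>K (c j) v) * (\<integral>x. g x * p m j x \<partial>L))\<bar>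
      \<le> C * e + C * (\<integral>x. q m x \<partial>L)"
    if L: "L \<in> prob_measures" and w: "\<forall>j<m. dist w v < r (c j)"
      and f: "f \<in> borel_measurable borel" "\<And>y. \<bar>f y\<bar> \<le> 1" for L w and f :: "'b \<Rightarrow> real"
  proof -
    interpret L: prob_space L using L by (rule prob_measuresD)
    let ?\<psi> = "\<lambda>x. \<integral>y. f y \<partial>K x w" and ?a = "\<lambda>j. \<integral>y. f y \<partial>K (c j) v"
    have \<psi>1: "\<bar>?\<psi> x\<bar> \<le> 1" for x using f by (intro integral_prob_le Kp)
    have \<psi>m: "?\<psi> \<in> borel_measurable borel"
      using controlled_kernelD(1)[OF K(1)] f(1) by (rule measurable_kernel_integral)
    have gm: "g \<in> borel_measurable borel" using g(1) by (rule borel_measurable_continuous_UNIV)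
    have pm: "p m j \<in> borel_measurable borel" for j using cp by (rule borel_measurable_continuous_UNIV)
    have p1: "p m j x \<le> 1" if "j < m" for j x
    proof -
      have "p m j x \<le> (\<Sum>j<m. p m j x)" using that p0 by (intro member_le_sum) auto
      then show ?thesis using pq[of m x] q0(1)[of m x] by linarith
    qed
    have igp: "integrable L (\<lambda>x. g x * p m j x)" if "j < m" for j
    proof (rule integrable_prob_bounded[OF L])
      show "(\<lambda>x. g x * p m j x) \<in> borel_measurable borel" using gm pm by simp
      show "\<bar>g x * p m j x\<bar> \<le> C * 1" for x
        unfolding abs_mult by (rule mult_mono) (use g(2) p0 p1[OF that] C in auto)
    qed
    have ig: "integrable L (\<lambda>x. g x * ?\<psi> x)"
    proof (rule integrable_prob_bounded[OF L])
      show "(\<lambda>x. g x * ?\<psi> x) \<in> borel_measurable borel" using gm \<psi>m by simp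
      show "\<bar>g x * ?\<psi> x\<bar> \<le> C * 1" for x
        unfolding abs_mult by (rule mult_mono) (use g(2) \<psi>1 C in auto)
    qed
    have iq: "integrable L (q m)"
      by (rule integrable_prob_bounded[OF L qm, of _ 1]) (use q0 in auto)
    have pw: "\<bar>g x * ?\<psi> x - (\<Sum>j<m. ?a j * (g x * p m j x))\<bar> \<le> C * (e + q m x)" for x
    proof -
      have "?\<psi> x = (\<Sum>j<m. p m j x * ?\<psi> x) + q m x * ?\<psi> x"
        using pq[of m x] by (metis distrib_right mult_1 sum_distrib_right)
      moreover have "(\<Sum>j<m. p m j x * (?\<psi> x - ?a j)) = (\<Sum>j<m. p m j x * ?\<psi> x) - (\<Sum>j<m. p m j x * ?a j)"
        by (simp only: right_diff_distrib sum_subtractf)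
      ultimately have "(\<Sum>j<m. p m j x * (?\<psi> x - ?a j)) + q m x * ?\<psi> x = ?\<psi> x - (\<Sum>j<m. p m j x * ?a j)"
        by linarith
      moreover have "(\<Sum>j<m. ?a j * (g x * p m j x)) = g x * (\<Sum>j<m. p m j x * ?a j)"
        by (simp only: sum_distrib_left mult.assoc mult.commute mult.left_commute)
      ultimately have "g x * ?\<psi> x - (\<Sum>j<m. ?a j * (g x * p m j x))
          = g x * ((\<Sum>j<m. p m j x * (?\<psi> x - ?a j)) + q m x * ?\<psi> x)"
        by (simp only: right_diff_distrib)
      moreover have "\<bar>(\<Sum>j<m. p m j x * (?\<psi> x - ?a j)) + q m x * ?\<psi> x\<bar> \<le> e + q m x"
      proof -
        have "\<bar>\<Sum>j<m. p m j x * (?\<psi> x - ?a j)\<bar> \<le> (\<Sum>j<m. p m j x * e)"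
        proof (rule sum_abs[THEN order_trans], rule sum_mono)
          fix j assume "j \<in> {..<m}"
          then have wj: "dist w v < r (c j)" using w by auto
          show "\<bar>p m j x * (?\<psi> x - ?a j)\<bar> \<le> p m j x * e"
          proof (cases "b j x = 0")
            case False
            have "\<bar>?\<psi> x - ?a j\<bar> \<le> tv_dist (K x w) (K (c j) v)"
              using f by (intro tv_dist_bound Kp)
            also have "\<dots> < e" using bpos[OF False] wj by (rule r(2))
            finally show ?thesis using p0[of m j x] by (simp add: abs_mult mult_left_mono)
          qed (simp add: p_def)
        qed
        also have "\<dots> = (\<Sum>j<m. p m j x) * e" by (simp add: sum_distrib_right)
        also have "\<dots> \<le> 1 * e" using pq[of m x] q0(1)[of m x] e by (intro mult_right_mono) auto
        finally have 1: "\<bar>\<Sum>j<m. p m j x * (?\<psi> x - ?a j)\<bar> \<le> e" by simp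
        have "\<bar>q m x * ?\<psi> x\<bar> \<le> q m x * 1"
          unfolding abs_mult using \<psi>1 q0 by (intro mult_mono) auto
        with 1 show ?thesis by linarith
      qed
      ultimately show ?thesis using g(2)[of x] C by (simp add: abs_mult mult_mono)
    qed
    have i: "integrable L (\<lambda>x. ?a j * (g x * p m j x))" if "j \<in> {..<m}" for j
      using igp[of j] that by (intro integrable_mult_right) auto
    have "(\<integral>x. (\<Sum>j<m. ?a j * (g x * p m j x)) \<partial>L) = (\<Sum>j<m. ?a j * (\<integral>x. g x * p m j x \<partial>L))"
      using i by (subst Bochner_Integration.integral_sum) auto
    moreover have isum: "integrable L (\<lambda>x. \<Sum>j<m. ?a j * (g x * p m j x))"
      using i by (rule Bochner_Integration.integrable_sum)
    ultimately have "(\<integral>x. g x * ?\<psi> x \<partial>L) - (\<Sum>j<m. ?a j * (\<integral>x. g x * p m j x \<partial>L))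
        = (\<integral>x. g x * ?\<psi> x - (\<Sum>j<m. ?a j * (g x * p m j x)) \<partial>L)"
      using Bochner_Integration.integral_diff[OF ig isum] by simp
    also have "\<bar>\<dots>\<bar> \<le> (\<integral>x. \<bar>g x * ?\<psi> x - (\<Sum>j<m. ?a j * (g x * p m j x))\<bar> \<partial>L)"
      by (rule integral_abs_bound)
    also have "\<dots> \<le> (\<integral>x. C * (e + q m x) \<partial>L)"
      using iq pw by (intro integral_mono integrable_abs Bochner_Integration.integrable_diff ig isum) auto
    also have "\<dots> = C * e + C * (\<integral>x. q m x \<partial>L)"
      using iq by (simp add: L.prob_space distrib_left)
    finally show ?thesis .
  qed
  have ev1: "\<forall>\<^sub>F n in sequentially. \<forall>j<m. dist (u n) v < r (c j)"
  proof -
    have "\<forall>\<^sub>F n in sequentially. \<forall>j\<in>{..<m}. dist (u n) v < r (c j)"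
      using u r(1) by (intro eventually_ball_finite) (auto simp: tendsto_iff)
    then show ?thesis by (rule eventually_mono) auto
  qed
  have ev2: "\<forall>\<^sub>F n in sequentially. (\<integral>x. q m x \<partial>M n) < e"
    using wconvD(3)[OF M cq bounded_range_realI[of _ 1]] m q0 by (intro order_tendstoD) auto
  have "(\<lambda>n. \<Sum>j<m. \<bar>(\<integral>x. g x * p m j x \<partial>M n) - (\<integral>x. g x * p m j x \<partial>N)\<bar>) \<longlonglongrightarrow> 0"
  proof (intro tendsto_null_sum tendsto_rabs_zero LIM_zero wconvD(3)[OF M])
    fix j assume j: "j \<in> {..<m}"
    show "continuous_on UNIV (\<lambda>x. g x * p m j x)" by (intro continuous_intros g cp)
    have "\<bar>g x * p m j x\<bar> \<le> C * 1" for x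
    proof -
      have "p m j x \<le> (\<Sum>j<m. p m j x)" using j p0 by (intro member_le_sum) auto
      then have "p m j x \<le> 1" using pq[of m x] q0(1)[of m x] by linarith
      then show ?thesis unfolding abs_mult by (intro mult_mono) (use g(2) p0 C in auto)
    qed
    then show "bounded (range (\<lambda>x. g x * p m j x))" by (rule bounded_range_realI)
  qed
  then have ev3: "\<forall>\<^sub>F n in sequentially. (\<Sum>j<m. \<bar>(\<integral>x. g x * p m j x \<partial>M n) - (\<integral>x. g x * p m j x \<partial>N)\<bar>) < e"
    using e by (rule order_tendstoD)
  show ?thesis using ev1 ev2 ev3
  proof eventually_elim
    case (elim n)
    show ?case
    proof (intro allI impI)
      fix f :: "'b \<Rightarrow> real" assume f: "f \<in> borel_measurable borel" "\<forall>y. \<bar>f y\<bar> \<le> 1"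
      let ?a = "\<lambda>j. \<integral>y. f y \<partial>K (c j) v"
      let ?I = "\<lambda>L j. \<integral>x. g x * p m j x \<partial>L"
      have 1: "\<bar>(\<integral>x. g x * (\<integral>y. f y \<partial>K x (u n)) \<partial>M n) - (\<Sum>j<m. ?a j * ?I (M n) j)\<bar> \<le> C * e + C * e"
        using key[OF MN(1)[of n] elim(1) f(1) f(2)[rule_format]] mult_left_mono[OF less_imp_le[OF elim(2)] C] by linarith
      have 2: "\<bar>(\<integral>x. g x * (\<integral>y. f y \<partial>K x v) \<partial>N) - (\<Sum>j<m. ?a j * ?I N j)\<bar> \<le> C * e + C * e"
        using key[OF MN(2) _ f(1) f(2)[rule_format], of v] r(1) mult_left_mono[OF less_imp_le[OF m] C] by simp
      have "\<bar>(\<Sum>j<m. ?a j * ?I (M n) j) - (\<Sum>j<m. ?a j * ?I N j)\<bar> = \<bar>\<Sum>j<m. ?a j * (?I (M n) j - ?I N j)\<bar>"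
        by (simp add: sum_subtractf right_diff_distrib)
      also have "\<dots> \<le> (\<Sum>j<m. \<bar>?I (M n) j - ?I N j\<bar>)"
      proof (rule sum_abs[THEN order_trans], rule sum_mono)
        fix j
        have "\<bar>?a j\<bar> \<le> 1" using f by (intro integral_prob_le Kp) auto
        then show "\<bar>?a j * (?I (M n) j - ?I N j)\<bar> \<le> \<bar>?I (M n) j - ?I N j\<bar>"
          by (simp add: abs_mult mult_left_le_one_le)
      qed
      finally show "\<bar>(\<integral>x. g x * (\<integral>y. f y \<partial>K x (u n)) \<partial>M n) - (\<integral>x. g x * (\<integral>y. f y \<partial>K x v) \<partial>N)\<bar> \<le> e0"
        using 1 2 elim(3) ee by linarith
    qed
  qed
qed

section \<open>Weak continuity of the belief kernel\<close>

lemma tendsto_if_subseq: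
  fixes x :: "nat \<Rightarrow> 'a::metric_space"
  assumes "\<And>r :: nat \<Rightarrow> nat. strict_mono r \<Longrightarrow> \<exists>s :: nat \<Rightarrow> nat. strict_mono s \<and> (\<lambda>n. x (r (s n))) \<longlonglongrightarrow> l"
  shows "x \<longlonglongrightarrow> l"
proof (rule ccontr)
  assume "\<not> x \<longlonglongrightarrow> l"
  then obtain e where e: "0 < e" "\<not> (\<forall>\<^sub>F n in sequentially. dist (x n) l < e)"
    by (auto simp: tendsto_iff)
  have "infinite {n. e \<le> dist (x n) l}"
    using e(2) by (simp add: INFM_iff_infinite[symmetric] cofinite_eq_sequentially[symmetric] not_eventually not_less)
  then obtain r :: "nat \<Rightarrow> nat" where r: "strict_mono r" "\<And>n. e \<le> dist (x (r n)) l"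
    using infinite_enumerate by blast
  from assms[OF r(1)] obtain s :: "nat \<Rightarrow> nat" where "(\<lambda>n. x (r (s n))) \<longlonglongrightarrow> l" by blast
  from tendstoD[OF this e(1)] show False using r(2) by (auto simp: not_less[symmetric])
qed

lemma tendsto_subseq:
  assumes "x \<longlonglongrightarrow> l" "strict_mono (r :: nat \<Rightarrow> nat)"
  shows "(\<lambda>n. x (r n)) \<longlonglongrightarrow> l"
  using LIMSEQ_subseq_LIMSEQ[OF assms] by (simp add: o_def)

locale pomdp =
  fixes T :: "'x::{metric_space, second_countable_topology}
                \<Rightarrow> 'u::{metric_space, second_countable_topology} \<Rightarrow> 'x measure"
    and Q :: "'x \<Rightarrow> 'u \<Rightarrow> 'y::{metric_space, second_countable_topology} measure"
    and F :: "'x measure \<Rightarrow> 'u \<Rightarrow> 'y \<Rightarrow> 'x measure"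
  assumes T: "controlled_kernel T" and Q: "controlled_kernel Q" and F: "belief_update T Q F"
begin

definition predict :: "'x measure \<Rightarrow> 'u \<Rightarrow> 'x measure" where
  "predict z u = z \<bind> (\<lambda>x. T x u)"

lemmas T_measurable = controlled_kernelD(1)[OF T] and T_prob = controlled_kernelD(2)[OF T]
lemmas Q_measurable = controlled_kernelD(1)[OF Q] and Q_prob = controlled_kernelD(2)[OF Q]

lemma predict_prob: "z \<in> prob_measures \<Longrightarrow> predict z u \<in> prob_measures"
  unfolding predict_def by (intro bind_prob_measures T_measurable)

lemma integral_predict:
  fixes f :: "'x \<Rightarrow> real"
  assumes "z \<in> prob_measures" "f \<in> borel_measurable borel" "\<And>x. \<bar>f x\<bar> \<le> B"
  shows "(\<integral>x. f x \<partial>predict z u) = (\<integral>x. (\<integral>x'. f x' \<partial>T x u) \<partial>z)"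
  unfolding predict_def by (rule integral_bind_prob[OF assms(1) T_measurable assms(2,3)])

lemma obs_law_eq: 
  assumes "z \<in> prob_measures"
  shows "obs_law T Q z u = predict z u \<bind> (\<lambda>x. Q x u)"
  unfolding obs_law_def predict_def
  by (rule bind_assoc[symmetric])
    (use assms T_measurable Q_measurable in \<open>auto intro!: measurable_prob_algebraD simp: measurable_cong_sets[OF prob_measuresD(2)[OF assms] refl]\<close>)

lemma obs_law_prob: "z \<in> prob_measures \<Longrightarrow> obs_law T Q z u \<in> prob_measures"
  by (simp add: obs_law_eq bind_prob_measures[OF predict_prob Q_measurable])

lemma integral_obs_law:
  fixes f :: "'y \<Rightarrow> real"
  assumes "z \<in> prob_measures" "f \<in> borel_measurable borel" "\<And>x. \<bar>f x\<bar> \<le> B"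
  shows "(\<integral>y. f y \<partial>obs_law T Q z u) = (\<integral>x. (\<integral>y. f y \<partial>Q x u) \<partial>predict z u)"
  unfolding obs_law_eq[OF assms(1)]
  by (rule integral_bind_prob[OF predict_prob[OF assms(1)] Q_measurable assms(2,3)])

lemma F_measurable:
  assumes "z \<in> prob_measures"
  shows "F z u \<in> borel \<rightarrow>\<^sub>M prob_algebra borel"
proof -
  have "(\<lambda>y. (z, u, y)) \<in> borel \<rightarrow>\<^sub>M prob_algebra borel \<Otimes>\<^sub>M (borel \<Otimes>\<^sub>M borel)"
    using assms by (intro measurable_Pair measurable_const) auto
  moreover have "(\<lambda>(\<pi>, u, y). F \<pi> u y) \<in> prob_algebra borel \<Otimes>\<^sub>M (borel \<Otimes>\<^sub>M borel) \<rightarrow>\<^sub>M prob_algebra borel"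
    using F by (simp only: belief_update_def)
  ultimately have "(\<lambda>y. (\<lambda>(\<pi>, u, y). F \<pi> u y) (z, u, y)) \<in> borel \<rightarrow>\<^sub>M prob_algebra borel"
    by (rule measurable_compose)
  then show ?thesis by simp
qed

lemma F_prob: "z \<in> prob_measures \<Longrightarrow> F z u y \<in> prob_measures"
  using measurable_space[OF F_measurable, of z y u] by simp

text \<open>The defining identity of the belief update says that two laws on pairs of a state
  and an observation agree on rectangles; hence they are equal, and integrate all bounded functions
  alike.\<close>

lemma bayes:
  fixes f :: "'y \<Rightarrow> real" and g :: "'x \<Rightarrow> real"
  assumes z: "z \<in> prob_measures"
    and f: "f \<in> borel_measurable borel" "\<And>y. \<bar>f y\<bar> \<le> A"
    and g: "g \<in> borel_measurable borel" "\<And>x. \<bar>g x\<bar> \<le> B"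
  shows "(\<integral>y. f y * (\<integral>x. g x \<partial>F z u y) \<partial>obs_law T Q z u)
       = (\<integral>x. g x * (\<integral>y. f y \<partial>Q x u) \<partial>predict z u)"
proof -
  let ?R = "borel \<Otimes>\<^sub>M borel :: ('x \<times> 'y) measure"
  let ?H = "obs_law T Q z u" and ?\<mu> = "predict z u"
  let ?K1 = "\<lambda>y. distr (F z u y) ?R (\<lambda>x. (x, y))" and ?K2 = "\<lambda>x. distr (Q x u) ?R (\<lambda>y. (x, y))"
  let ?R1 = "?H \<bind> ?K1" and ?R2 = "?\<mu> \<bind> ?K2"
  note H = obs_law_prob[OF z, of u] and \<mu> = predict_prob[OF z, of u]
  have sF: "sets (F z u y) = sets borel" for y using prob_measuresD(2)[OF F_prob[OF z]] .
  have sQ: "sets (Q x u) = sets borel" for x using prob_measuresD(2)[OF Q_prob] .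
  note cF = measurable_cong_sets[OF sF refl] and cQ = measurable_cong_sets[OF sQ refl]
  note cH = measurable_cong_sets[OF prob_measuresD(2)[OF H] refl]
  note c\<mu> = measurable_cong_sets[OF prob_measuresD(2)[OF \<mu>] refl]
  have K1: "?K1 \<in> borel \<rightarrow>\<^sub>M prob_algebra ?R"
    by (rule measurable_distr_prob_space2[OF F_measurable[OF z]]) simp
  have K2: "?K2 \<in> borel \<rightarrow>\<^sub>M prob_algebra ?R"
    by (rule measurable_distr_prob_space2[OF Q_measurable]) simp
  have eK1: "emeasure (?K1 y) (a \<times> b) = emeasure (F z u y) a * indicator b y"
    if "a \<in> sets borel" "b \<in> sets borel" for a b y
    using that by (subst emeasure_distr)
      (auto simp: cF vimage_def prob_measuresD(3)[OF F_prob[OF z]] split: split_indicator)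
  have eK2: "emeasure (?K2 x) (a \<times> b) = emeasure (Q x u) b * indicator a x"
    if "a \<in> sets borel" "b \<in> sets borel" for a b x
    using that by (subst emeasure_distr)
      (auto simp: cQ vimage_def prob_measuresD(3)[OF Q_prob] split: split_indicator)
  have e1: "emeasure ?R1 S = (\<integral>\<^sup>+y. emeasure (?K1 y) S \<partial>?H)" if "S \<in> sets ?R" for S
    using that K1 prob_measuresD(3)[OF H]
    by (intro emeasure_bind[where N="?R"]) (auto intro!: measurable_prob_algebraD simp: cH)
  have e2: "emeasure ?R2 S = (\<integral>\<^sup>+x. emeasure (?K2 x) S \<partial>?\<mu>)" if "S \<in> sets ?R" for S
    using that K2 prob_measuresD(3)[OF \<mu>]
    by (intro emeasure_bind[where N="?R"]) (auto intro!: measurable_prob_algebraD simp: c\<mu>)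
  have "?R1 = ?R2"
  proof (rule measure_eqI_generator_eq[where E="{a \<times> b | a b. a \<in> sets borel \<and> b \<in> sets borel}"
        and A="\<lambda>_. UNIV \<times> UNIV" and \<Omega>="UNIV"])
    show "Int_stable {a \<times> b | (a :: 'x set) (b :: 'y set). a \<in> sets borel \<and> b \<in> sets borel}"
      using Int_stable_pair_measure_generator[of borel borel] by simp
    show "sets ?R1 = sigma_sets UNIV {a \<times> b | a b. a \<in> sets borel \<and> b \<in> sets borel}"
      "sets ?R2 = sigma_sets UNIV {a \<times> b | a b. a \<in> sets borel \<and> b \<in> sets borel}"
      using sets_bind[of ?H ?K1 ?R] sets_bind[of ?\<mu> ?K2 ?R] prob_measuresD(3)[OF H] prob_measuresD(3)[OF \<mu>]
      by (simp_all add: sets_pair_measure)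
    show "emeasure ?R1 S = emeasure ?R2 S"
      if S: "S \<in> {a \<times> b | a b. a \<in> sets borel \<and> b \<in> sets borel}" for S
    proof -
      obtain a b where ab: "S = a \<times> b" "a \<in> sets borel" "b \<in> sets borel" using S by blast
      have SR: "a \<times> b \<in> sets ?R" using ab by auto
      have "emeasure ?R1 S = (\<integral>\<^sup>+y\<in>b. emeasure (F z u y) a \<partial>?H)"
        unfolding ab(1) e1[OF SR] by (simp add: eK1 ab)
      also have "\<dots> = (\<integral>\<^sup>+x. (\<integral>\<^sup>+x'\<in>a. emeasure (Q x' u) b \<partial>T x u) \<partial>z)"
        using F ab z unfolding belief_update_def by blast
      also have "\<dots> = (\<integral>\<^sup>+x'\<in>a. emeasure (Q x' u) b \<partial>?\<mu>)"
        unfolding predict_def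
      proof (rule nn_integral_bind[symmetric, where B=borel])
        show "(\<lambda>x. T x u) \<in> z \<rightarrow>\<^sub>M subprob_algebra borel"
          using measurable_prob_algebraD[OF T_measurable] by (simp add: measurable_cong_sets[OF prob_measuresD(2)[OF z] refl])
        have "(\<lambda>x'. emeasure (Q x' u) b) \<in> borel_measurable borel"
          using measurable_emeasure_kernel[OF measurable_prob_algebraD[OF Q_measurable] ab(3)] .
        then show "(\<lambda>x'. emeasure (Q x' u) b * indicator a x') \<in> borel_measurable borel"
          using ab(2) by simp
      qed
      also have "\<dots> = emeasure ?R2 S"
        unfolding ab(1) e2[OF SR] by (simp add: eK2 ab)
      finally show ?thesis .
    qed
    show "emeasure ?R1 (UNIV \<times> UNIV) \<noteq> \<infinity>"
      using prob_space.emeasure_le_1[OF prob_space_bind'[OF _ K1], of ?H "UNIV \<times> UNIV"] H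
      by (auto simp: top_unique)
  qed (auto intro!: exI[of _ UNIV])
  define h where "h p = f (snd p) * g (fst p)" for p
  have hm: "h \<in> borel_measurable ?R" unfolding h_def using f(1) g(1) by simp
  have hB: "\<bar>h p\<bar> \<le> \<bar>A\<bar> * \<bar>B\<bar>" for p
    unfolding h_def abs_mult using f(2)[of "snd p"] g(2)[of "fst p"] by (intro mult_mono) auto
  have "(\<integral>p. h p \<partial>?R1) = (\<integral>y. (\<integral>p. h p \<partial>?K1 y) \<partial>?H)"
  proof (rule integral_bind[where K="?R" and B="\<bar>A\<bar> * \<bar>B\<bar>" and B'=1, OF hm hB])
    show "?K1 \<in> ?H \<rightarrow>\<^sub>M subprob_algebra ?R"
      using measurable_prob_algebraD[OF K1] by (simp add: cH)
    show "finite_measure ?H" using prob_space.finite_measure[OF prob_measuresD(1)[OF H]] .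
    have "prob_space (?K1 x)" for x
      using measurable_space[OF K1, of x] by (simp add: space_prob_algebra)
    from prob_space.emeasure_space_1[OF this]
    show "AE x in ?H. emeasure (?K1 x) (space (?K1 x)) \<le> ennreal 1" by simp
  qed
  also have "\<dots> = (\<integral>y. f y * (\<integral>x. g x \<partial>F z u y) \<partial>?H)"
  proof -
    have "(\<integral>p. h p \<partial>?K1 y) = (\<integral>x. h (x, y) \<partial>F z u y)" for y
      by (rule integral_distr[OF _ hm]) (simp add: cF)
    then show ?thesis by (simp add: h_def)
  qed
  finally have 1: "(\<integral>p. h p \<partial>?R1) = (\<integral>y. f y * (\<integral>x. g x \<partial>F z u y) \<partial>?H)" .
  have "(\<integral>p. h p \<partial>?R2) = (\<integral>x. (\<integral>p. h p \<partial>?K2 x) \<partial>?\<mu>)"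
  proof (rule integral_bind[where K="?R" and B="\<bar>A\<bar> * \<bar>B\<bar>" and B'=1, OF hm hB])
    show "?K2 \<in> ?\<mu> \<rightarrow>\<^sub>M subprob_algebra ?R"
      using measurable_prob_algebraD[OF K2] by (simp add: c\<mu>)
    show "finite_measure ?\<mu>" using prob_space.finite_measure[OF prob_measuresD(1)[OF \<mu>]] .
    have "prob_space (?K2 x)" for x
      using measurable_space[OF K2, of x] by (simp add: space_prob_algebra)
    from prob_space.emeasure_space_1[OF this]
    show "AE x in ?\<mu>. emeasure (?K2 x) (space (?K2 x)) \<le> ennreal 1" by simp
  qed
  also have "\<dots> = (\<integral>x. g x * (\<integral>y. f y \<partial>Q x u) \<partial>?\<mu>)"
  proof -
    have "(\<integral>p. h p \<partial>?K2 x) = (\<integral>y. h (x, y) \<partial>Q x u)" for x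
      by (rule integral_distr[OF _ hm]) (simp add: cQ)
    then show ?thesis by (simp add: h_def mult.commute)
  qed
  finally show ?thesis using 1 \<open>?R1 = ?R2\<close> by simp
qed

lemma integral_belief_kernel:
  fixes w :: "'x measure \<Rightarrow> real"
  assumes "z \<in> prob_measures" "w \<in> borel_measurable (prob_algebra borel)"
  shows "(\<integral>\<pi>. w \<pi> \<partial>belief_kernel T Q F z u) = (\<integral>y. w (F z u y) \<partial>obs_law T Q z u)"
  unfolding belief_kernel_def
  by (rule integral_distr)
    (use assms F_measurable[OF assms(1)] in
      \<open>auto simp: measurable_cong_sets[OF prob_measuresD(2)[OF obs_law_prob[OF assms(1)]] refl]\<close>)

text \<open>Uniform convergence of the joint laws of state and observation makes the conditional
  expectations \<open>\<integral>g dF\<close> converge in mean for each test function \<open>g\<close>. Along a subsequence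
  this holds almost everywhere for all members of the countable convergence-determining class at
  once, that is, the updated beliefs converge weakly almost everywhere.\<close>

lemma integral_belief_kernel_tendsto:
  fixes w :: "'x measure \<Rightarrow> real"
  assumes z: "wconv Z z"
    and joint: "\<And>(g :: 'x \<Rightarrow> real) C e. continuous_on UNIV g \<Longrightarrow> (\<And>x. \<bar>g x\<bar> \<le> C) \<Longrightarrow> 0 < e \<Longrightarrow>
      \<forall>\<^sub>F n in sequentially. \<forall>f :: 'y \<Rightarrow> real. f \<in> borel_measurable borel \<longrightarrow> (\<forall>y. \<bar>f y\<bar> \<le> 1) \<longrightarrow>
        \<bar>(\<integral>x. g x * (\<integral>y. f y \<partial>Q x (u n)) \<partial>predict (Z n) (u n))
          - (\<integral>x. g x * (\<integral>y. f y \<partial>Q x v) \<partial>predict z v)\<bar> \<le> e"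
    and w: "weakly_continuous w" "\<And>\<pi>. \<pi> \<in> prob_measures \<Longrightarrow> \<bar>w \<pi>\<bar> \<le> B"
  shows "(\<lambda>n. \<integral>\<pi>. w \<pi> \<partial>belief_kernel T Q F (Z n) (u n)) \<longlonglongrightarrow> (\<integral>\<pi>. w \<pi> \<partial>belief_kernel T Q F z v)"
proof -
  note Zz = wconvD(1,2)[OF z]
  let ?H = "\<lambda>n. obs_law T Q (Z n) (u n)" and ?Hl = "obs_law T Q z v"
  let ?F = "\<lambda>n. F (Z n) (u n)" and ?Fl = "F z v"
  note Hn = obs_law_prob[OF Zz(1)] and H0 = obs_law_prob[OF Zz(2)]
  interpret H0: prob_space ?Hl using H0 by (rule prob_measuresD)
  note Fn = F_prob[OF Zz(1)] and F0 = F_prob[OF Zz(2)]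
  note cH0 = measurable_cong_sets[OF prob_measuresD(2)[OF H0] refl]
  have H: "\<forall>\<^sub>F n in sequentially. \<forall>f :: 'y \<Rightarrow> real. f \<in> borel_measurable borel \<longrightarrow> (\<forall>y. \<bar>f y\<bar> \<le> C) \<longrightarrow>
      \<bar>(\<integral>y. f y \<partial>?H n) - (\<integral>y. f y \<partial>?Hl)\<bar> \<le> e" if e: "0 < e" and C: "0 < C" for e C
  proof -
    have "0 < e / C" using e C by simp
    from joint[of "\<lambda>_. 1" 1, OF _ _ this] have
      "\<forall>\<^sub>F n in sequentially. \<forall>f :: 'y \<Rightarrow> real. f \<in> borel_measurable borel \<longrightarrow> (\<forall>y. \<bar>f y\<bar> \<le> 1) \<longrightarrow>
        \<bar>(\<integral>x. 1 * (\<integral>y. f y \<partial>Q x (u n)) \<partial>predict (Z n) (u n))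
          - (\<integral>x. 1 * (\<integral>y. f y \<partial>Q x v) \<partial>predict z v)\<bar> \<le> e / C" by simp
    then show ?thesis
    proof eventually_elim
      case (elim n)
      show ?case
      proof (intro allI impI)
        fix f :: "'y \<Rightarrow> real" assume f: "f \<in> borel_measurable borel" "\<forall>y. \<bar>f y\<bar> \<le> C"
        have "\<bar>(\<integral>y. f y \<partial>?H n) - (\<integral>y. f y \<partial>?Hl)\<bar> \<le> C * (e / C)"
        proof (rule bounded_by_scaling[where \<Phi>="\<lambda>f. (\<integral>y. f y \<partial>?H n) - (\<integral>y. f y \<partial>?Hl)"])
          fix h :: "'y \<Rightarrow> real" assume h: "h \<in> borel_measurable borel" "\<And>y. \<bar>h y\<bar> \<le> 1"
          show "\<bar>(\<integral>y. h y \<partial>?H n) - (\<integral>y. h y \<partial>?Hl)\<bar> \<le> e / C"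
            using elim h by (simp add: integral_obs_law[OF Zz(1) h] integral_obs_law[OF Zz(2) h])
        qed (use f C in \<open>auto simp: diff_divide_distrib\<close>)
        then show "\<bar>(\<integral>y. f y \<partial>?H n) - (\<integral>y. f y \<partial>?Hl)\<bar> \<le> e" using C by simp
      qed
    qed
  qed
  have L1: "(\<lambda>n. \<integral>y. \<bar>(\<integral>x. g x \<partial>?F n y) - (\<integral>x. g x \<partial>?Fl y)\<bar> \<partial>?Hl) \<longlonglongrightarrow> 0"
    if g: "continuous_on UNIV g" "\<And>x. \<bar>g x\<bar> \<le> C" "0 < C" for g :: "'x \<Rightarrow> real" and C
  proof (rule LIMSEQ_I)
    fix e :: real assume e: "0 < e"
    have gm: "g \<in> borel_measurable borel" using g(1) by (rule borel_measurable_continuous_UNIV)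
    have rm: "(\<lambda>y. \<integral>x. g x \<partial>F \<pi> a y) \<in> borel_measurable borel" if "\<pi> \<in> prob_measures" for \<pi> a
      using F_measurable[OF that] gm by (rule measurable_kernel_integral)
    have rB: "\<bar>\<integral>x. g x \<partial>F \<pi> a y\<bar> \<le> C" if "\<pi> \<in> prob_measures" for \<pi> a y
      using F_prob[OF that] gm g(2) by (rule integral_prob_le)
    \<comment> \<open>The sign of the difference of the two conditional expectations, as a function of the observation,
      is one of the functions \<open>f\<close> over which the convergence is uniform.\<close>
    have e3: "0 < e / 3" using e by simp
    from joint[OF g(1,2) e3] H[OF e3 g(3)]
    have "\<forall>\<^sub>F n in sequentially. norm ((\<integral>y. \<bar>(\<integral>x. g x \<partial>?F n y) - (\<integral>x. g x \<partial>?Fl y)\<bar> \<partial>?Hl) - 0) < e"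
    proof eventually_elim
      case (elim n)
      let ?r = "\<lambda>y. \<integral>x. g x \<partial>?F n y" and ?rl = "\<lambda>y. \<integral>x. g x \<partial>?Fl y"
      let ?f = "\<lambda>y. sgn (?r y - ?rl y)"
      note rmn = rm[OF Zz(1), of n "u n"] and rm0 = rm[OF Zz(2), of v]
      note rBn = rB[OF Zz(1), of n "u n"] and rB0 = rB[OF Zz(2), of v]
      have fm: "?f \<in> borel_measurable borel" using rmn rm0 by simp
      have f1: "\<bar>?f y\<bar> \<le> 1" for y by (simp add: sgn_if)
      have frm: "(\<lambda>y. ?f y * ?r y) \<in> borel_measurable borel" "(\<lambda>y. ?f y * ?rl y) \<in> borel_measurable borel"
        using fm rmn rm0 by simp_all
      have frB: "\<bar>?f y * ?r y\<bar> \<le> C" "\<bar>?f y * ?rl y\<bar> \<le> C" for y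
        unfolding abs_mult using mult_mono[OF f1 rBn, of y y] mult_mono[OF f1 rB0, of y y] by simp_all
      have "(\<integral>y. \<bar>?r y - ?rl y\<bar> \<partial>?Hl) = (\<integral>y. ?f y * ?r y - ?f y * ?rl y \<partial>?Hl)"
        by (intro Bochner_Integration.integral_cong) (auto simp: sgn_if right_diff_distrib)
      also have "\<dots> = (\<integral>y. ?f y * ?r y \<partial>?Hl) - (\<integral>y. ?f y * ?rl y \<partial>?Hl)"
        by (intro Bochner_Integration.integral_diff integrable_prob_bounded[OF H0 frm(1) frB(1)]
            integrable_prob_bounded[OF H0 frm(2) frB(2)])
      finally have 1: "(\<integral>y. \<bar>?r y - ?rl y\<bar> \<partial>?Hl) = (\<integral>y. ?f y * ?r y \<partial>?Hl) - (\<integral>y. ?f y * ?rl y \<partial>?Hl)" .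
      have 2: "\<bar>(\<integral>y. ?f y * ?r y \<partial>?H n) - (\<integral>y. ?f y * ?r y \<partial>?Hl)\<bar> \<le> e / 3"
        using elim(2) frm(1) frB(1) by blast
      have 3: "\<bar>(\<integral>y. ?f y * ?r y \<partial>?H n) - (\<integral>y. ?f y * ?rl y \<partial>?Hl)\<bar> \<le> e / 3"
        unfolding bayes[OF Zz(1) fm f1 gm g(2)] bayes[OF Zz(2) fm f1 gm g(2)]
        using elim(1) fm f1 by blast
      have "0 \<le> (\<integral>y. \<bar>?r y - ?rl y\<bar> \<partial>?Hl)" by (rule integral_nonneg_AE) simp
      moreover have "(\<integral>y. \<bar>?r y - ?rl y\<bar> \<partial>?Hl) \<le> 2 * (e / 3)" using 1 2 3 by linarith
      ultimately show ?case using e by simp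
    qed
    then show "\<exists>no. \<forall>n\<ge>no. norm ((\<integral>y. \<bar>(\<integral>x. g x \<partial>?F n y) - (\<integral>x. g x \<partial>?Fl y)\<bar> \<partial>?Hl) - 0) < e"
      by (simp add: eventually_sequentially)
  qed
  \<comment> \<open>Summing truncated coordinate distances with weights lets a single almost everywhere convergent
    subsequence serve all coordinates.\<close>
  define d where "d i n y = (1/2) ^ i * min 1 \<bar>coords (?F n y) i - coords (?Fl y) i\<bar>" for i n y
  have d0: "0 \<le> d i n y" "d i n y \<le> (1/2) ^ i" for i n y
    by (auto simp: d_def intro!: mult_left_le)
  have cm: "(\<lambda>y. coords (F \<pi> a y) i) \<in> borel_measurable borel" if "\<pi> \<in> prob_measures" for \<pi> a i
    unfolding coords_def using F_measurable[OF that] by (rule measurable_kernel_integral) simp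
  have dm: "d i n \<in> borel_measurable borel" for i n
    unfolding d_def by (intro borel_measurable_abs borel_measurable_diff borel_measurable_min borel_measurable_times borel_measurable_const cm Zz)
  have dB: "\<bar>d i n y\<bar> \<le> (1/2) ^ i" for i n y using d0[of i n y] by simp
  note di = integrable_prob_bounded[OF H0 dm dB]
  have d_int: "0 \<le> (\<integral>y. d i n y \<partial>?Hl)" "(\<integral>y. d i n y \<partial>?Hl) \<le> (1/2) ^ i" for i n
    using integral_prob_le[OF H0 dm[of i n] dB] by (auto intro!: integral_nonneg_AE simp: d0)
  have d_lim: "(\<lambda>n. \<integral>y. d i n y \<partial>?Hl) \<longlonglongrightarrow> 0" for i
  proof -
    obtain C where C: "\<And>x :: 'x. \<bar>bumps (from_nat i) x\<bar> \<le> C" "0 \<le> C"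
      using bounded_range_realE[OF bounded_bumps] by blast
    have "\<bar>bumps (from_nat i) x\<bar> \<le> C + 1" for x :: 'x using C(1)[of x] by linarith
    from L1[OF continuous_bumps this] C(2)
    have lim: "(\<lambda>n. \<integral>y. \<bar>coords (?F n y) i - coords (?Fl y) i\<bar> \<partial>?Hl) \<longlonglongrightarrow> 0"
      by (simp add: coords_def)
    show ?thesis
    proof (rule tendsto_sandwich[OF _ _ tendsto_const lim])
      have cb: "\<bar>coords (F \<pi> a y) i\<bar> \<le> C" if "\<pi> \<in> prob_measures" for \<pi> a y
        unfolding coords_def using F_prob[OF that] _ C(1) by (rule integral_prob_le) simp
      have "(\<integral>y. d i n y \<partial>?Hl) \<le> (\<integral>y. \<bar>coords (?F n y) i - coords (?Fl y) i\<bar> \<partial>?Hl)" for n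
      proof (rule integral_mono[OF di])
        show "integrable ?Hl (\<lambda>y. \<bar>coords (?F n y) i - coords (?Fl y) i\<bar>)"
        proof (rule integrable_prob_bounded[OF H0])
          show "(\<lambda>y. \<bar>coords (?F n y) i - coords (?Fl y) i\<bar>) \<in> borel_measurable borel"
            by (intro borel_measurable_abs borel_measurable_diff borel_measurable_min borel_measurable_times borel_measurable_const cm Zz)
          show "\<bar>\<bar>coords (?F n y) i - coords (?Fl y) i\<bar>\<bar> \<le> 2 * C" for y
            using cb[OF Zz(1), of n "u n" y] cb[OF Zz(2), of v y] by linarith
        qed
        show "d i n y \<le> \<bar>coords (?F n y) i - coords (?Fl y) i\<bar>" for y
        proof -
          have "d i n y \<le> 1 * min 1 \<bar>coords (?F n y) i - coords (?Fl y) i\<bar>"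
            unfolding d_def by (intro mult_right_mono) (auto simp: power_le_one)
          then show ?thesis by (rule order_trans) simp
        qed
      qed
      then show "\<forall>\<^sub>F n in sequentially. (\<integral>y. d i n y \<partial>?Hl) \<le> (\<integral>y. \<bar>coords (?F n y) i - coords (?Fl y) i\<bar> \<partial>?Hl)"
        by simp
    qed (use d_int in auto)
  qed
  define D where "D n y = (\<Sum>i. d i n y)" for n y
  have sd: "summable (\<lambda>i. d i n y)" for n y
    by (rule summable_comparison_test'[OF summable_geometric[of "1/2::real"]]) (use dB in auto)
  have D0: "0 \<le> D n y" "D n y \<le> 2" for n y
  proof -
    show "0 \<le> D n y" unfolding D_def using sd d0 by (intro suminf_nonneg)
    have "D n y \<le> (\<Sum>i. (1/2) ^ i)" unfolding D_def using d0 sd by (intro suminf_le) auto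
    then show "D n y \<le> 2" by (simp add: suminf_geometric)
  qed
  have Dm: "D n \<in> borel_measurable borel" for n unfolding D_def using dm by simp
  have Di: "integrable ?Hl (D n)" for n
    using D0 by (intro integrable_prob_bounded[OF H0 Dm, of _ 2]) auto
  have D_int: "(\<integral>y. D n y \<partial>?Hl) = (\<Sum>i. \<integral>y. d i n y \<partial>?Hl)" for n
    unfolding D_def
  proof (rule integral_suminf[OF di])
    show "AE y in ?Hl. summable (\<lambda>i. norm (d i n y))" using sd d0 by simp
    show "summable (\<lambda>i. \<integral>y. norm (d i n y) \<partial>?Hl)"
      by (rule summable_comparison_test'[OF summable_geometric[of "1/2::real"]]) (use d_int d0 in auto)
  qed
  have D_lim: "(\<lambda>n. \<integral>y. norm (D n y) \<partial>?Hl) \<longlonglongrightarrow> 0"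
  proof -
    have "(\<lambda>n. \<Sum>i. \<integral>y. d i n y \<partial>?Hl) \<longlonglongrightarrow> (\<Sum>i. 0)"
    proof (rule tannerys_theorem[where M="\<lambda>i. (1/2) ^ i", THEN conjunct2, THEN conjunct2])
      have "norm (\<integral>y. d i n y \<partial>?Hl) \<le> (1/2) ^ i" for i n using d_int[of i n] by simp
      then show "\<forall>\<^sub>F (i, n) in at_top \<times>\<^sub>F sequentially. norm (\<integral>y. d i n y \<partial>?Hl) \<le> (1/2) ^ i"
        by (intro always_eventually) auto
    qed (use d_lim in \<open>auto simp: summable_geometric\<close>)
    then show ?thesis using D0(1) by (simp add: D_int)
  qed
  have wm: "w \<in> borel_measurable (prob_algebra borel)" using w(1) by (rule weakly_continuous_measurable)
  have wFm: "(\<lambda>y. w (F \<pi> a y)) \<in> borel_measurable borel" if "\<pi> \<in> prob_measures" for \<pi> a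
    using measurable_compose[OF F_measurable[OF that] wm] .
  have wFB: "\<bar>w (F \<pi> a y)\<bar> \<le> B" if "\<pi> \<in> prob_measures" for \<pi> a y
    using w(2) F_prob[OF that] .
  have B0: "0 \<le> B" using wFB[OF Zz(2), of undefined undefined] abs_ge_zero order_trans by blast
  have lim0: "(\<lambda>n. \<integral>y. w (?F n y) \<partial>?Hl) \<longlonglongrightarrow> (\<integral>y. w (?Fl y) \<partial>?Hl)"
  proof (rule tendsto_if_subseq)
    fix r :: "nat \<Rightarrow> nat" assume r: "strict_mono r"
    from tendsto_L1_AE_subseq[OF Di tendsto_subseq[OF D_lim r]] obtain s :: "nat \<Rightarrow> nat"
      where s: "strict_mono s" "AE y in ?Hl. (\<lambda>n. D (r (s n)) y) \<longlonglongrightarrow> 0" by auto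
    have "(\<lambda>n. w (?F (r (s n)) y)) \<longlonglongrightarrow> w (?Fl y)" if y: "(\<lambda>n. D (r (s n)) y) \<longlonglongrightarrow> 0" for y
    proof -
      have "wconv (\<lambda>n. ?F (r (s n)) y) (?Fl y)"
      proof (rule wconv_coords[OF Fn F0])
        fix i
        let ?m = "\<lambda>n. min 1 \<bar>coords (?F (r (s n)) y) i - coords (?Fl y) i\<bar>"
        have "?m n \<le> 2 ^ i * D (r (s n)) y" for n
        proof -
          have "d i (r (s n)) y \<le> D (r (s n)) y"
            unfolding D_def using sum_le_suminf[OF sd, of "{i}" "r (s n)" y] d0 by simp
          then show ?thesis by (simp add: d_def power_one_over field_simps)
        qed
        then have m: "?m \<longlonglongrightarrow> 0"
          by (intro tendsto_sandwich[OF _ _ tendsto_const tendsto_mult_right_zero[OF y, of "2 ^ i"]]) auto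
        have "\<forall>\<^sub>F n in sequentially. ?m n < 1" using m by (rule order_tendstoD) simp
        then have "\<forall>\<^sub>F n in sequentially. ?m n = \<bar>coords (?F (r (s n)) y) i - coords (?Fl y) i\<bar>"
          by eventually_elim auto
        from Lim_transform_eventually[OF m this]
        show "(\<lambda>n. coords (?F (r (s n)) y) i) \<longlonglongrightarrow> coords (?Fl y) i"
          by (intro LIM_zero_cancel[of _ "coords (?Fl y) i"]) (simp add: tendsto_rabs_zero_iff)
      qed
      with w(1) show ?thesis by (auto simp: weakly_continuous_def)
    qed
    with s(2) have ae: "AE y in ?Hl. (\<lambda>n. w (?F (r (s n)) y)) \<longlonglongrightarrow> w (?Fl y)" by auto
    have "(\<lambda>n. \<integral>y. w (?F (r (s n)) y) \<partial>?Hl) \<longlonglongrightarrow> (\<integral>y. w (?Fl y) \<partial>?Hl)"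
      by (rule integral_dominated_convergence[where w="\<lambda>_. B", OF _ _ _ ae])
        (use wFm[OF Zz(1)] wFm[OF Zz(2)] wFB[OF Zz(1)] in \<open>auto simp: cH0\<close>)
    with s(1) show "\<exists>s. strict_mono s \<and> (\<lambda>n. \<integral>y. w (?F (r (s n)) y) \<partial>?Hl) \<longlonglongrightarrow> (\<integral>y. w (?Fl y) \<partial>?Hl)"
      by blast
  qed
  have "(\<lambda>n. (\<integral>y. w (?F n y) \<partial>?H n) - (\<integral>y. w (?F n y) \<partial>?Hl)) \<longlonglongrightarrow> 0"
  proof (rule tendstoI)
    fix e :: real assume e: "0 < e"
    have "0 < e / 2" "0 < B + 1" using e B0 by auto
    from H[OF this] show "\<forall>\<^sub>F n in sequentially. dist ((\<integral>y. w (?F n y) \<partial>?H n) - (\<integral>y. w (?F n y) \<partial>?Hl)) 0 < e"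
    proof eventually_elim
      case (elim n)
      have "\<bar>w (?F n y)\<bar> \<le> B + 1" for y using wFB[OF Zz(1), of n "u n" y] by linarith
      with elim wFm[OF Zz(1)] have "\<bar>(\<integral>y. w (?F n y) \<partial>?H n) - (\<integral>y. w (?F n y) \<partial>?Hl)\<bar> \<le> e / 2"
        by blast
      then show ?case using e by (simp add: dist_real_def)
    qed
  qed
  from tendsto_add[OF this lim0] show ?thesis
    by (simp add: integral_belief_kernel[OF Zz(1) wm] integral_belief_kernel[OF Zz(2) wm])
qed

end

context pomdp
begin

text \<open>The integral of a continuous function against \<open>T x u\<close> is jointly continuous in \<open>(x, u)\<close>, so that
  this is an instance of \<open>wconv_parameter\<close>.\<close>

lemma predict_wconv:
  assumes T: "weakly_continuous_kernel T" and z: "wconv Z z" and u: "u \<longlonglongrightarrow> v"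
  shows "wconv (\<lambda>n. predict (Z n) (u n)) (predict z v)"
  unfolding wconv_def
proof (intro conjI allI impI)
  note Zz = wconvD(1,2)[OF z]
  show "predict (Z n) (u n) \<in> prob_measures" "predict z v \<in> prob_measures" for n
    using Zz predict_prob by auto
  fix f :: "'x \<Rightarrow> real" assume f: "continuous_on UNIV f" "bounded (range f)"
  obtain B where B: "\<And>x. \<bar>f x\<bar> \<le> B" using bounded_range_realE[OF f(2)] by blast
  have fm: "f \<in> borel_measurable borel" using f(1) by (rule borel_measurable_continuous_UNIV)
  define \<phi> where "\<phi> p = (\<integral>x'. f x' \<partial>T (fst p) (snd p))" for p
  have "continuous_on UNIV \<phi>"
    unfolding continuous_on_sequentially
  proof (intro allI ballI impI, elim conjE)
    fix s and a :: "'x \<times> 'u" assume s: "s \<longlonglongrightarrow> a"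
    then have "(\<lambda>n. fst (s n)) \<longlonglongrightarrow> fst a" "(\<lambda>n. snd (s n)) \<longlonglongrightarrow> snd a"
      by (auto intro: tendsto_fst tendsto_snd)
    with T have "limitin weak_topology (\<lambda>n. T (fst (s n)) (snd (s n))) (T (fst a) (snd a)) sequentially"
      by (auto simp: weakly_continuous_kernel_def)
    from wconvD(3)[OF limitin_weak_topology_imp_wconv[OF T_prob this] f]
    show "(\<phi> \<circ> s) \<longlonglongrightarrow> \<phi> a" by (simp add: \<phi>_def o_def)
  qed
  moreover have "bounded (range \<phi>)"
    unfolding \<phi>_def by (rule bounded_range_realI) (rule integral_prob_le[OF T_prob fm B])
  ultimately have "(\<lambda>n. \<integral>x. \<phi> (x, u n) \<partial>Z n) \<longlonglongrightarrow> (\<integral>x. \<phi> (x, v) \<partial>z)"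
    using wconv_parameter[OF z u] by blast
  then show "(\<lambda>n. \<integral>x. f x \<partial>predict (Z n) (u n)) \<longlonglongrightarrow> (\<integral>x. f x \<partial>predict z v)"
    by (simp add: \<phi>_def integral_predict[OF Zz(1) fm B] integral_predict[OF Zz(2) fm B])
qed

definition feller :: bool where
  "feller \<longleftrightarrow> (\<forall>Z z u v w B. wconv Z z \<longrightarrow> u \<longlonglongrightarrow> v \<longrightarrow> weakly_continuous w \<longrightarrow>
     (\<forall>\<pi>\<in>prob_measures. \<bar>w \<pi>\<bar> \<le> B) \<longrightarrow>
     (\<lambda>n. \<integral>\<pi>. w \<pi> \<partial>belief_kernel T Q F (Z n) (u n)) \<longlonglongrightarrow> (\<integral>\<pi>. w \<pi> \<partial>belief_kernel T Q F z v))"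

text \<open>The predicted state converges weakly, and the channel provides the uniformity over functions
  of the observation.\<close>

lemma feller_if_weak_transition:
  assumes "weakly_continuous_kernel T" "tv_continuous_kernel Q"
  shows feller
  unfolding feller_def
proof (intro allI impI)
  fix Z :: "nat \<Rightarrow> 'x measure" and z B and u :: "nat \<Rightarrow> 'u" and v and w :: "'x measure \<Rightarrow> real"
  assume Z: "wconv Z z" and u: "u \<longlonglongrightarrow> v" and w: "weakly_continuous w" "\<forall>\<pi>\<in>prob_measures. \<bar>w \<pi>\<bar> \<le> B"
  show "(\<lambda>n. \<integral>\<pi>. w \<pi> \<partial>belief_kernel T Q F (Z n) (u n)) \<longlonglongrightarrow> (\<integral>\<pi>. w \<pi> \<partial>belief_kernel T Q F z v)"
    using tv_kernel_uniform_convergence[OF Q assms(2) predict_wconv[OF assms(1) Z u] u] w(2)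
    by (intro integral_belief_kernel_tendsto[OF Z _ w(1), of _ _ B]) blast+
qed

text \<open>Here the uniformity comes from the transition: the predicted state converges in total variation,
  and \<open>g x * (\<integral>y. f y \<partial>Q\<^sub>0 x)\<close> is one fixed bounded measurable function of the next state, however
  irregular the channel is.\<close>

lemma feller_if_tv_transition:
  assumes T': "tv_continuous_kernel T" and Q\<^sub>0: "\<And>x u. Q x u = Q\<^sub>0 x"
  shows feller
  unfolding feller_def
proof (intro allI impI)
  fix Z :: "nat \<Rightarrow> 'x measure" and z B and u :: "nat \<Rightarrow> 'u" and v and w :: "'x measure \<Rightarrow> real"
  assume Z: "wconv Z z" and u: "u \<longlonglongrightarrow> v" and w: "weakly_continuous w" "\<forall>\<pi>\<in>prob_measures. \<bar>w \<pi>\<bar> \<le> B"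
  note Zz = wconvD(1,2)[OF Z]
  show "(\<lambda>n. \<integral>\<pi>. w \<pi> \<partial>belief_kernel T Q F (Z n) (u n)) \<longlonglongrightarrow> (\<integral>\<pi>. w \<pi> \<partial>belief_kernel T Q F z v)"
  proof (rule integral_belief_kernel_tendsto[OF Z _ w(1), of _ _ B])
    fix g :: "'x \<Rightarrow> real" and C e :: real
    assume g: "continuous_on UNIV g" "\<And>x. \<bar>g x\<bar> \<le> C" and e: "0 < e"
    have gm: "g \<in> borel_measurable borel" using g(1) by (rule borel_measurable_continuous_UNIV)
    have C: "0 < \<bar>C\<bar> + 1" by simp
    have e': "0 < e / (\<bar>C\<bar> + 1)" using e by (intro divide_pos_pos) auto
    have "\<forall>\<^sub>F n in sequentially. \<forall>f :: 'x \<Rightarrow> real. f \<in> borel_measurable borel \<longrightarrow> (\<forall>y. \<bar>f y\<bar> \<le> 1) \<longrightarrow>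
       \<bar>(\<integral>x. 1 * (\<integral>y. f y \<partial>T x (u n)) \<partial>Z n) - (\<integral>x. 1 * (\<integral>y. f y \<partial>T x v) \<partial>z)\<bar> \<le> e / (\<bar>C\<bar> + 1)"
      by (rule tv_kernel_uniform_convergence[OF T T' Z u _ _ e', of _ 1]) auto
    then show "\<forall>\<^sub>F n in sequentially. \<forall>f :: 'y \<Rightarrow> real. f \<in> borel_measurable borel \<longrightarrow> (\<forall>y. \<bar>f y\<bar> \<le> 1) \<longrightarrow>
        \<bar>(\<integral>x. g x * (\<integral>y. f y \<partial>Q x (u n)) \<partial>predict (Z n) (u n))
          - (\<integral>x. g x * (\<integral>y. f y \<partial>Q x v) \<partial>predict z v)\<bar> \<le> e"
    proof eventually_elim
      case (elim n)
      show ?case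
      proof (intro allI impI)
        fix f :: "'y \<Rightarrow> real" assume f: "f \<in> borel_measurable borel" "\<forall>y. \<bar>f y\<bar> \<le> 1"
        let ?h = "\<lambda>x. g x * (\<integral>y. f y \<partial>Q\<^sub>0 x)"
        have q: "(\<integral>y. f y \<partial>Q x a) = (\<integral>y. f y \<partial>Q\<^sub>0 x)" for x a by (simp add: Q\<^sub>0)
        have "(\<lambda>x. \<integral>y. f y \<partial>Q x v) \<in> borel_measurable borel"
          using Q_measurable f(1) by (rule measurable_kernel_integral)
        then have hm: "?h \<in> borel_measurable borel" using gm by (simp add: q)
        have hB: "\<bar>?h x\<bar> \<le> \<bar>C\<bar> + 1" for x
        proof -
          have "\<bar>\<integral>y. f y \<partial>Q x v\<bar> \<le> 1" using f by (intro integral_prob_le Q_prob) auto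
          then have "\<bar>g x\<bar> * \<bar>\<integral>y. f y \<partial>Q\<^sub>0 x\<bar> \<le> \<bar>C\<bar> * 1"
            using g(2)[of x] by (intro mult_mono) (auto simp: q)
          then show ?thesis by (simp add: abs_mult)
        qed
        have "\<bar>(\<integral>x. ?h x \<partial>predict (Z n) (u n)) - (\<integral>x. ?h x \<partial>predict z v)\<bar> \<le> (\<bar>C\<bar> + 1) * (e / (\<bar>C\<bar> + 1))"
        proof (rule bounded_by_scaling[where \<Phi>="\<lambda>h. (\<integral>x. h x \<partial>predict (Z n) (u n)) - (\<integral>x. h x \<partial>predict z v)",
              OF _ _ hm hB C])
          fix h :: "'x \<Rightarrow> real" assume h: "h \<in> borel_measurable borel" "\<And>x. \<bar>h x\<bar> \<le> 1"
          show "\<bar>(\<integral>x. h x \<partial>predict (Z n) (u n)) - (\<integral>x. h x \<partial>predict z v)\<bar> \<le> e / (\<bar>C\<bar> + 1)"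
            using elim h by (simp add: integral_predict[OF Zz(1) h] integral_predict[OF Zz(2) h])
        qed (simp add: diff_divide_distrib)
        then show "\<bar>(\<integral>x. g x * (\<integral>y. f y \<partial>Q x (u n)) \<partial>predict (Z n) (u n))
          - (\<integral>x. g x * (\<integral>y. f y \<partial>Q x v) \<partial>predict z v)\<bar> \<le> e"
          using C by (simp add: q)
      qed
    qed
  qed (use w(2) in auto)
qed

lemma belief_kernel_measurable:
  "(\<lambda>(\<pi>, u). belief_kernel T Q F \<pi> u) \<in> prob_algebra borel \<Otimes>\<^sub>M borel \<rightarrow>\<^sub>M prob_algebra (prob_algebra borel)"
proof -
  let ?S = "prob_algebra borel \<Otimes>\<^sub>M borel :: ('x measure \<times> 'u) measure"
  have T': "(\<lambda>(p, x). T x (snd p)) \<in> ?S \<Otimes>\<^sub>M borel \<rightarrow>\<^sub>M prob_algebra borel"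
  proof -
    have "(\<lambda>p. (snd p, snd (fst p))) \<in> ?S \<Otimes>\<^sub>M (borel :: 'x measure) \<rightarrow>\<^sub>M borel \<Otimes>\<^sub>M borel" by measurable
    from measurable_compose[OF this T[unfolded controlled_kernel_def]] show ?thesis
      by (simp add: case_prod_beta)
  qed
  have Q': "(\<lambda>(p, x). Q x (snd p)) \<in> ?S \<Otimes>\<^sub>M borel \<rightarrow>\<^sub>M prob_algebra borel"
  proof -
    have "(\<lambda>p. (snd p, snd (fst p))) \<in> ?S \<Otimes>\<^sub>M (borel :: 'x measure) \<rightarrow>\<^sub>M borel \<Otimes>\<^sub>M borel" by measurable
    from measurable_compose[OF this Q[unfolded controlled_kernel_def]] show ?thesis
      by (simp add: case_prod_beta)
  qed
  have pr: "(\<lambda>p. fst p \<bind> (\<lambda>x. T x (snd p))) \<in> ?S \<rightarrow>\<^sub>M prob_algebra borel"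
    by (rule measurable_bind_prob_space2[OF measurable_fst T'])
  have "(\<lambda>p. (fst p \<bind> (\<lambda>x. T x (snd p))) \<bind> (\<lambda>x. Q x (snd p))) \<in> ?S \<rightarrow>\<^sub>M prob_algebra borel"
    by (rule measurable_bind_prob_space2[OF pr Q'])
  then have ol: "(\<lambda>p. obs_law T Q (fst p) (snd p)) \<in> ?S \<rightarrow>\<^sub>M prob_algebra borel"
    by (rule measurable_cong[THEN iffD1, rotated])
      (auto simp: space_pair_measure obs_law_eq predict_def)
  have "(\<lambda>(p, y). F (fst p) (snd p) y) \<in> ?S \<Otimes>\<^sub>M borel \<rightarrow>\<^sub>M prob_algebra borel"
  proof -
    have "(\<lambda>p. (fst (fst p), snd (fst p), snd p)) \<in> ?S \<Otimes>\<^sub>M (borel :: 'y measure) \<rightarrow>\<^sub>M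
        prob_algebra borel \<Otimes>\<^sub>M (borel \<Otimes>\<^sub>M borel)" by measurable
    moreover have "(\<lambda>(\<pi>, u, y). F \<pi> u y) \<in> prob_algebra borel \<Otimes>\<^sub>M (borel \<Otimes>\<^sub>M borel) \<rightarrow>\<^sub>M prob_algebra borel"
      using F by (simp only: belief_update_def)
    ultimately have "(\<lambda>p. (\<lambda>(\<pi>, u, y). F \<pi> u y) (fst (fst p), snd (fst p), snd p))
        \<in> ?S \<Otimes>\<^sub>M borel \<rightarrow>\<^sub>M prob_algebra borel"
      by (rule measurable_compose)
    then show ?thesis by (simp add: case_prod_beta)
  qed
  from measurable_distr_prob_space2[OF ol this] show ?thesis
    by (simp add: belief_kernel_def case_prod_beta)
qed

end

section \<open>Measurable selection of minimizers\<close>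

lemma cINF_eq_minimum:
  fixes f :: "'a \<Rightarrow> real"
  assumes "a \<in> S" "\<And>v. v \<in> S \<Longrightarrow> f a \<le> f v"
  shows "(INF u\<in>S. f u) = f a"
  using assms by (intro cInf_eq_minimum) auto

lemma measurable_INF_compact:
  fixes f :: "'a \<Rightarrow> 'u::{metric_space, second_countable_topology} \<Rightarrow> real"
  assumes f: "\<And>u. (\<lambda>z. f z u) \<in> borel_measurable M" "\<And>z. z \<in> space M \<Longrightarrow> continuous_on UNIV (f z)"
    and S: "compact S" "S \<noteq> {}"
  shows "(\<lambda>z. INF u\<in>S. f z u) \<in> borel_measurable M"
  unfolding borel_measurable_iff_less
proof
  fix t
  obtain D where D: "countable D" "D \<subseteq> S" "S \<subseteq> closure D" using separable by blast
  have "(INF u\<in>S. f z u) < t \<longleftrightarrow> (\<exists>d\<in>D. f z d < t)" if z: "z \<in> space M" for z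
  proof -
    have c: "continuous_on S (f z)" using f(2)[OF z] by (rule continuous_on_subset) simp
    have "bdd_below (f z ` S)"
      using compact_continuous_image[OF c S(1)] by (intro bounded_imp_bdd_below compact_imp_bounded)
    then have "(INF u\<in>S. f z u) < t \<longleftrightarrow> (\<exists>u\<in>S. f z u < t)" using S(2) by (intro cINF_less_iff) auto
    also have "\<dots> \<longleftrightarrow> (\<exists>d\<in>D. f z d < t)"
    proof
      assume "\<exists>u\<in>S. f z u < t"
      then obtain u where u: "u \<in> S" "f z u < t" by blast
      have "open {u. f z u < t}" using f(2)[OF z] by (intro open_Collect_less) auto
      moreover have "u \<in> closure D" using u D by blast
      ultimately have "{u. f z u < t} \<inter> D \<noteq> {}" using u(2) by (auto simp: closure_iff_nhds_not_empty)
      then show "\<exists>d\<in>D. f z d < t" by blast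
    qed (use D in blast)
    finally show ?thesis .
  qed
  then have "{z \<in> space M. (INF u\<in>S. f z u) < t} = (\<Union>d\<in>D. {z \<in> space M. f z d < t})" by auto
  also have "\<dots> \<in> sets M"
    using f(1) D(1) by (intro sets.countable_UN'') (auto simp: borel_measurable_iff_less)
  finally show "{z \<in> space M. (INF u\<in>S. f z u) < t} \<in> sets M" .
qed

text \<open>A minimizer is selected measurably by successive minimization: among the minimizers of
  \<open>f z\<close> choose those closest to the first point of a dense sequence, among these the ones closest
  to the second point, and so on. The compact sets so obtained shrink to a point whose distances
  to the dense sequence depend measurably on \<open>z\<close>.\<close>

lemma measurable_argmin:
  fixes f :: "'a \<Rightarrow> 'u::{metric_space, second_countable_topology} \<Rightarrow> real"
  assumes f: "\<And>u. (\<lambda>z. f z u) \<in> borel_measurable M" "\<And>z. z \<in> space M \<Longrightarrow> continuous_on UNIV (f z)"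
    and U: "compact (UNIV :: 'u set)"
  shows "\<exists>s \<in> M \<rightarrow>\<^sub>M borel. \<forall>z \<in> space M. \<forall>u. f z (s z) \<le> f z u"
proof -
  \<comment> \<open>The successive sets of minimizers are the zero sets of functions that are nonnegative, measurable
    in \<open>z\<close> and continuous in \<open>u\<close>: passing to the next set adds the deviation from the least distance
    to the next point of the dense sequence.\<close>
  define excess where "excess e \<longleftrightarrow> (\<forall>u. (\<lambda>z. e z u) \<in> borel_measurable M) \<and>
    (\<forall>z\<in>space M. continuous_on UNIV (e z) \<and> (\<forall>u. 0 \<le> e z u) \<and> (\<exists>u. e z u = 0))" for e :: "'a \<Rightarrow> 'u \<Rightarrow> real"
  define m where "m e i z = (INF u\<in>{u. e z u = 0}. dist u (dense_seq i))" for e :: "'a \<Rightarrow> 'u \<Rightarrow> real" and i z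
  define next_excess where "next_excess i e z u = e z u + \<bar>dist u (dense_seq i) - m e i z\<bar>"
    for i and e :: "'a \<Rightarrow> 'u \<Rightarrow> real" and z u
  have zero_compact: "compact {u. e z u = 0}" if "excess e" "z \<in> space M" for e z
  proof -
    have "closed {u. e z u = 0}" using that by (intro closed_Collect_eq) (auto simp: excess_def)
    with U show ?thesis using compact_Int_closed[OF U] by fastforce
  qed
  have m_attained: "\<exists>u. e z u = 0 \<and> dist u (dense_seq i) = m e i z" if e: "excess e" "z \<in> space M" for e i z
  proof -
    have "{u. e z u = 0} \<noteq> {}" using e by (auto simp: excess_def)
    moreover have "continuous_on {u. e z u = 0} (\<lambda>u. dist u (dense_seq i))"
      by (intro continuous_intros)
    ultimately obtain u where u: "e z u = 0" "\<And>v. e z v = 0 \<Longrightarrow> dist u (dense_seq i) \<le> dist v (dense_seq i)"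
      using continuous_attains_inf[OF zero_compact[OF e]] by blast
    have "m e i z = dist u (dense_seq i)"
      unfolding m_def using u by (intro cINF_eq_minimum) auto
    with u show ?thesis by auto
  qed
  have m_le: "m e i z \<le> dist u (dense_seq i)" if "e z u = 0" for e i z u
    unfolding m_def using that by (intro cINF_lower bdd_belowI2[of _ 0]) auto
  have m_measurable: "m e i \<in> borel_measurable M" if e: "excess e" for e i
    unfolding borel_measurable_iff_le
  proof
    fix t
    let ?C = "{u :: 'u. dist u (dense_seq i) \<le> t}"
    have "closed ?C" by (intro closed_Collect_le continuous_intros)
    then have C: "compact ?C" using compact_Int_closed[OF U] by fastforce
    show "{z \<in> space M. m e i z \<le> t} \<in> sets M"
    proof (cases "?C = {}")
      case True
      then have "{z \<in> space M. m e i z \<le> t} = {}"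
        using m_attained[OF e] by (metis (mono_tags, lifting) Collect_empty_eq)
      then show ?thesis by (simp only: sets.empty_sets)
    next
      case False
      \<comment> \<open>The least distance is at most \<open>t\<close> if and only if the zero set meets the compact ball \<open>?C\<close>, which is a
        statement about an infimum over a fixed set.\<close>
      have "m e i z \<le> t \<longleftrightarrow> (INF u\<in>?C. e z u) = 0" if z: "z \<in> space M" for z
      proof
        assume "m e i z \<le> t"
        then obtain u where u: "e z u = 0" "u \<in> ?C" using m_attained[OF e z, of i] by auto
        moreover have "(INF u\<in>?C. e z u) = e z u"
          by (rule cINF_eq_minimum) (use e z u in \<open>auto simp: excess_def\<close>)
        ultimately show "(INF u\<in>?C. e z u) = 0" by simp
      next
        assume 0: "(INF u\<in>?C. e z u) = 0"
        have "continuous_on ?C (e z)" using e z by (auto simp: excess_def intro: continuous_on_subset)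
        from continuous_attains_inf[OF C False this] obtain u where
          u: "u \<in> ?C" "\<And>v. v \<in> ?C \<Longrightarrow> e z u \<le> e z v" by auto
        then have "(INF u\<in>?C. e z u) = e z u" by (intro cINF_eq_minimum) auto
        with 0 have "e z u = 0" by simp
        from m_le[of e z u i, OF this] u(1) show "m e i z \<le> t" by auto
      qed
      then have "{z \<in> space M. m e i z \<le> t} = (\<lambda>z. INF u\<in>?C. e z u) -` {0} \<inter> space M" by auto
      also have "\<dots> \<in> sets M"
        using e C False by (intro measurable_sets[OF measurable_INF_compact]) (auto simp: excess_def)
      finally show ?thesis .
    qed
  qed
  have next_excess: "excess (next_excess i e)" if e: "excess e" for i e
    unfolding excess_def
  proof (intro conjI allI ballI)
    fix u
    have "(\<lambda>z. e z u) \<in> borel_measurable M" using e by (auto simp: excess_def)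
    then show "(\<lambda>z. next_excess i e z u) \<in> borel_measurable M"
      unfolding next_excess_def using m_measurable[OF e, of i] by simp
  next
    fix z assume z: "z \<in> space M"
    have "continuous_on UNIV (e z)" using e z by (auto simp: excess_def)
    then show "continuous_on UNIV (next_excess i e z)"
      unfolding next_excess_def by (intro continuous_intros)
    show "0 \<le> next_excess i e z u" for u using e z by (auto simp: next_excess_def excess_def)
    show "\<exists>u. next_excess i e z u = 0"
    proof -
      obtain u where "e z u = 0" "dist u (dense_seq i) = m e i z" using m_attained[OF e z] by blast
      then show ?thesis by (intro exI[of _ u]) (simp add: next_excess_def)
    qed
  qed
  define E where "E = rec_nat (\<lambda>z u. f z u - (INF v. f z v)) next_excess"
  have E0: "E 0 z u = f z u - (INF v. f z v)" and ES: "E (Suc i) = next_excess i (E i)" for i z u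
    by (simp_all add: E_def)
  have inf_att: "\<exists>u. (INF v. f z v) = f z u \<and> (\<forall>v. f z u \<le> f z v)" if "z \<in> space M" for z
  proof -
    from continuous_attains_inf[OF U _ f(2)[OF that]] obtain u where u: "\<And>v. f z u \<le> f z v" by auto
    then have "(INF v. f z v) = f z u" by (intro cINF_eq_minimum) auto
    with u show ?thesis by blast
  qed
  have "excess (E 0)"
    unfolding excess_def
  proof (intro conjI allI ballI)
    have "(\<lambda>z. INF v. f z v) \<in> borel_measurable M"
      using measurable_INF_compact[OF f U] by simp
    then show "(\<lambda>z. E 0 z u) \<in> borel_measurable M" for u
      unfolding E0 using f(1)[of u] by simp
  next
    fix z assume z: "z \<in> space M"
    show "continuous_on UNIV (E 0 z)" unfolding E0 using f(2)[OF z] by (intro continuous_intros)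
    show "0 \<le> E 0 z u" for u using inf_att[OF z] by (auto simp: E0)
    show "\<exists>u. E 0 z u = 0" using inf_att[OF z] by (auto simp: E0)
  qed
  then have E: "excess (E i)" for i by (induction i) (auto simp: ES next_excess)
  define s where "s z = (SOME u. \<forall>i. E i z u = 0)" for z
  have s: "E i z (s z) = 0" if z: "z \<in> space M" for i z
  proof -
    have step: "{u. E (Suc i) z u = 0} \<subseteq> {u. E i z u = 0}" for i
    proof
      fix u assume "u \<in> {u. E (Suc i) z u = 0}"
      then have "E i z u + \<bar>dist u (dense_seq i) - m (E i) i z\<bar> = 0" by (simp add: ES next_excess_def)
      moreover have "0 \<le> E i z u" using E[of i] z unfolding excess_def by blast
      ultimately show "u \<in> {u. E i z u = 0}" by simp
    qed
    have "\<forall>n. \<exists>u. E n z u = 0" using E z by (auto simp: excess_def)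
    from choice[OF this] obtain a where a: "\<And>n. E n z (a n) = 0" by blast
    obtain u r where ur: "strict_mono (r :: nat \<Rightarrow> nat)" "(a \<circ> r) \<longlonglongrightarrow> u"
      using seq_compactE[OF compact_imp_seq_compact[OF U], of a] by blast
    have "E i z u = 0" for i
    proof -
      have "continuous_on UNIV (E i z)" using E z by (auto simp: excess_def)
      from continuous_on_tendsto_compose[OF this ur(2)]
      have "(\<lambda>n. E i z (a (r n))) \<longlonglongrightarrow> E i z u" by (simp add: o_def)
      moreover have "E i z (a (r n)) = 0" if "i \<le> n" for n
      proof -
        have "i \<le> r n" using that seq_suble[OF ur(1), of n] by linarith
        from lift_Suc_antimono_le[of "\<lambda>i. {u. E i z u = 0}", OF step this] a[of "r n"] show ?thesis by auto
      qed
      then have "\<forall>\<^sub>F n in sequentially. E i z (a (r n)) = 0" by (rule eventually_sequentiallyI)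
      then have "(\<lambda>n. E i z (a (r n))) \<longlonglongrightarrow> 0" by (rule tendsto_eventually)
      ultimately show ?thesis by (rule LIMSEQ_unique)
    qed
    then have "\<exists>u. \<forall>i. E i z u = 0" by blast
    then have "\<forall>i. E i z (s z) = 0" unfolding s_def by (rule someI_ex)
    then show ?thesis ..
  qed
  have s_dist: "dist (s z) (dense_seq i) = m (E i) i z" if z: "z \<in> space M" for i z
    using s[OF z, of "Suc i"] s[OF z, of i] by (simp add: ES next_excess_def)
  have dm: "(\<lambda>z. dist (s z) (dense_seq i)) \<in> borel_measurable M" for i
    using m_measurable[OF E, of i i] by (rule measurable_cong[THEN iffD1, rotated]) (simp add: s_dist)
  have "s \<in> M \<rightarrow>\<^sub>M borel"
  proof (rule borel_measurableI)
    fix S :: "'u set" assume S: "open S"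
    let ?I = "{(i, k :: nat). \<forall>v. dist v (dense_seq i) < 1 / real (Suc k) \<longrightarrow> v \<in> S}"
    have "s -` S \<inter> space M = (\<Union>(i, k)\<in>?I. {z \<in> space M. dist (s z) (dense_seq i) < 1 / real (Suc k)})" (is "_ = ?R")
    proof (intro equalityI subsetI)
      fix z assume z: "z \<in> s -` S \<inter> space M"
      then obtain r where r: "0 < r" "\<And>v. dist v (s z) < r \<Longrightarrow> v \<in> S"
        using S by (auto simp: open_dist)
      obtain k where k: "1 / real (Suc k) < r / 2"
        using reals_Archimedean[of "r / 2"] r(1) by (auto simp: inverse_eq_divide)
      have "0 < 1 / real (Suc k)" by simp
      from dense_seq[OF this, of "s z"] obtain i where i: "dist (dense_seq i) (s z) < 1 / real (Suc k)" by blast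
      have "v \<in> S" if "dist v (dense_seq i) < 1 / real (Suc k)" for v
        using that i k dist_triangle[of v "s z" "dense_seq i"] by (intro r(2)) linarith
      then have "(i, k) \<in> ?I" by blast
      then show "z \<in> ?R" using i z by (auto simp: dist_commute)
    qed auto
    also have "\<dots> \<in> sets M"
    proof (rule sets.countable_UN'')
      fix p assume "p \<in> ?I"
      show "(case p of (i, k) \<Rightarrow> {z \<in> space M. dist (s z) (dense_seq i) < 1 / real (Suc k)}) \<in> sets M"
        using dm by (cases p) (auto simp: borel_measurable_iff_less)
    qed simp
    finally show "s -` S \<inter> space M \<in> sets M" .
  qed
  moreover have "f z (s z) \<le> f z u" if z: "z \<in> space M" for z u
    using s[OF z, of 0] inf_att[OF z] by (auto simp: E0)
  ultimately show ?thesis by blast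
qed

section \<open>The Bellman equation\<close>

lemma (in prob_space) integrable_bounded:
  fixes f :: "'a \<Rightarrow> real"
  assumes "f \<in> borel_measurable M" "\<And>x. x \<in> space M \<Longrightarrow> \<bar>f x\<bar> \<le> B"
  shows "integrable M f"
  using assms by (intro integrable_const_bound[where B=B]) auto

lemma (in prob_space) integral_bounded:
  fixes f :: "'a \<Rightarrow> real"
  assumes "f \<in> borel_measurable M" "\<And>x. x \<in> space M \<Longrightarrow> \<bar>f x\<bar> \<le> B"
  shows "\<bar>\<integral>x. f x \<partial>M\<bar> \<le> B"
proof -
  have "\<bar>\<integral>x. f x \<partial>M\<bar> \<le> (\<integral>x. \<bar>f x\<bar> \<partial>M)" by (rule integral_abs_bound)
  also have "\<dots> \<le> B"
    using assms by (intro integral_le_const integrable_abs integrable_bounded[OF assms]) auto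
  finally show ?thesis .
qed

definition bounded_on_beliefs :: "('x::topological_space measure \<Rightarrow> real) \<Rightarrow> real \<Rightarrow> bool" where
  "bounded_on_beliefs w B \<longleftrightarrow> (\<forall>\<pi>\<in>prob_measures. \<bar>w \<pi>\<bar> \<le> B)"

locale feller_control =
  fixes eta :: "'x::{metric_space, second_countable_topology} measure
      \<Rightarrow> 'u::{metric_space, second_countable_topology} \<Rightarrow> 'x measure measure"
    and c :: "'x \<Rightarrow> 'u \<Rightarrow> real" and \<beta> C :: real
  assumes eta: "(\<lambda>(\<pi>, u). eta \<pi> u) \<in> prob_algebra borel \<Otimes>\<^sub>M borel \<rightarrow>\<^sub>M prob_algebra (prob_algebra borel)"
    and eta_feller: "\<And>Z z u v w B. wconv Z z \<Longrightarrow> u \<longlonglongrightarrow> v \<Longrightarrow> weakly_continuous w \<Longrightarrow> bounded_on_beliefs w B \<Longrightarrow>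
      (\<lambda>n. \<integral>\<pi>. w \<pi> \<partial>eta (Z n) (u n)) \<longlonglongrightarrow> (\<integral>\<pi>. w \<pi> \<partial>eta z v)"
    and c_continuous: "continuous_on UNIV (\<lambda>(x, u). c x u)"
    and c_bounded: "\<And>x u. \<bar>c x u\<bar> \<le> C"
    and compact_actions: "compact (UNIV :: 'u set)"
    and \<beta>: "0 < \<beta>" "\<beta> < 1"
begin

lemma eta_prob:
  assumes "\<pi> \<in> prob_measures"
  shows "prob_space (eta \<pi> u)" "sets (eta \<pi> u) = sets (prob_algebra borel)" "space (eta \<pi> u) = prob_measures"
proof -
  have "(\<pi>, u) \<in> space (prob_algebra borel \<Otimes>\<^sub>M borel)" using assms by (simp add: space_pair_measure)
  from measurable_space[OF eta this] show "prob_space (eta \<pi> u)" "sets (eta \<pi> u) = sets (prob_algebra borel)"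
    by (auto simp: space_prob_algebra[of "prob_algebra borel"])
  then show "space (eta \<pi> u) = prob_measures" by (intro sets_eq_imp_space_eq)
qed

lemma
  assumes "\<pi> \<in> prob_measures" "w \<in> borel_measurable (prob_algebra borel)" "bounded_on_beliefs w B"
  shows eta_integrable: "integrable (eta \<pi> u) w"
    and eta_integral_bounded: "\<bar>\<integral>\<pi>'. w \<pi>' \<partial>eta \<pi> u\<bar> \<le> B"
proof -
  note e = eta_prob[OF assms(1), of u]
  have w: "w \<in> borel_measurable (eta \<pi> u)" using assms(2) by (simp add: measurable_cong_sets[OF e(2) refl])
  show "integrable (eta \<pi> u) w" "\<bar>\<integral>\<pi>'. w \<pi>' \<partial>eta \<pi> u\<bar> \<le> B"
    using assms(3) e(3) prob_space.integrable_bounded[OF e(1) w, of B] prob_space.integral_bounded[OF e(1) w, of B]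
    by (auto simp: bounded_on_beliefs_def)
qed

lemma c_measurable: "(\<lambda>x. c x u) \<in> borel_measurable borel"
proof -
  have "continuous_on UNIV (\<lambda>x. (\<lambda>(x, u). c x u) (x, u))"
    by (intro continuous_on_compose2[OF c_continuous] continuous_intros) auto
  then show ?thesis by (intro borel_measurable_continuous_UNIV) simp
qed

lemma cost_bounded: "\<pi> \<in> prob_measures \<Longrightarrow> \<bar>belief_cost c \<pi> u\<bar> \<le> C"
  unfolding belief_cost_def by (rule integral_prob_le[OF _ c_measurable c_bounded])

lemma C_nonneg: "0 \<le> C"
  using c_bounded[of undefined undefined] by (meson abs_ge_zero order_trans)

definition action_value :: "('x measure \<Rightarrow> real) \<Rightarrow> 'x measure \<Rightarrow> 'u \<Rightarrow> real" where
  "action_value w \<pi> u = belief_cost c \<pi> u + \<beta> * (\<integral>\<pi>'. w \<pi>' \<partial>eta \<pi> u)"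

definition bellman :: "('x measure \<Rightarrow> real) \<Rightarrow> 'x measure \<Rightarrow> real" where
  "bellman w \<pi> = (INF u. action_value w \<pi> u)"

lemma action_value_tendsto:
  assumes w: "weakly_continuous w" "bounded_on_beliefs w B" and Z: "wconv Z z" and u: "u \<longlonglongrightarrow> v"
  shows "(\<lambda>n. action_value w (Z n) (u n)) \<longlonglongrightarrow> action_value w z v"
  unfolding action_value_def
proof (intro tendsto_add tendsto_mult tendsto_const)
  have "bounded (range (\<lambda>(x, u). c x u))"
    using c_bounded by (intro bounded_range_realI[of _ C]) auto
  from wconv_parameter[OF Z u c_continuous this]
  show "(\<lambda>n. belief_cost c (Z n) (u n)) \<longlonglongrightarrow> belief_cost c z v" by (simp add: belief_cost_def)
  show "(\<lambda>n. \<integral>\<pi>. w \<pi> \<partial>eta (Z n) (u n)) \<longlonglongrightarrow> (\<integral>\<pi>. w \<pi> \<partial>eta z v)"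
    by (rule eta_feller[OF Z u w])
qed

lemma action_value_bounded:
  assumes "w \<in> borel_measurable (prob_algebra borel)" "bounded_on_beliefs w B" "\<pi> \<in> prob_measures"
  shows "\<bar>action_value w \<pi> u\<bar> \<le> C + \<beta> * B"
proof -
  have "\<beta> * \<bar>\<integral>\<pi>'. w \<pi>' \<partial>eta \<pi> u\<bar> \<le> \<beta> * B"
    using eta_integral_bounded[OF assms(3,1,2)] \<beta> by (intro mult_left_mono) auto
  moreover have "\<beta> * \<bar>\<integral>\<pi>'. w \<pi>' \<partial>eta \<pi> u\<bar> = \<bar>\<beta> * (\<integral>\<pi>'. w \<pi>' \<partial>eta \<pi> u)\<bar>"
    using \<beta> by (simp add: abs_mult)
  ultimately show ?thesis
    using cost_bounded[OF assms(3), of u] unfolding action_value_def by linarith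
qed

lemma action_value_continuous:
  assumes "weakly_continuous w" "bounded_on_beliefs w B" "\<pi> \<in> prob_measures"
  shows "continuous_on UNIV (action_value w \<pi>)"
  unfolding continuous_on_sequentially o_def
  using action_value_tendsto[OF assms(1,2) wconv_const[OF assms(3)]] by blast

lemma bellman_attained:
  assumes "weakly_continuous w" "bounded_on_beliefs w B" "\<pi> \<in> prob_measures"
  obtains u where "bellman w \<pi> = action_value w \<pi> u" "\<And>v. action_value w \<pi> u \<le> action_value w \<pi> v"
proof -
  from continuous_attains_inf[OF compact_actions _ action_value_continuous[OF assms]]
  obtain u where u: "\<And>v. action_value w \<pi> u \<le> action_value w \<pi> v" by auto
  then have "bellman w \<pi> = action_value w \<pi> u" unfolding bellman_def by (intro cINF_eq_minimum) auto
  with u show thesis by (rule that[rotated])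
qed

lemma bellman_le:
  assumes "weakly_continuous w" "bounded_on_beliefs w B" "\<pi> \<in> prob_measures"
  shows "bellman w \<pi> \<le> action_value w \<pi> u"
  by (rule bellman_attained[OF assms]) simp

lemma bellman_bounded:
  assumes w: "weakly_continuous w" "bounded_on_beliefs w B"
  shows "bounded_on_beliefs (bellman w) (C + \<beta> * B)"
  unfolding bounded_on_beliefs_def
proof
  fix \<pi> :: "'x measure" assume \<pi>: "\<pi> \<in> prob_measures"
  obtain u where "bellman w \<pi> = action_value w \<pi> u" using bellman_attained[OF w \<pi>] by blast
  then show "\<bar>bellman w \<pi>\<bar> \<le> C + \<beta> * B"
    using action_value_bounded[OF weakly_continuous_measurable[OF w(1)] w(2) \<pi>] by simp
qed

text \<open>Along a weakly convergent sequence of beliefs, minimizing actions have a convergent subsequence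
  because the action space is compact, and its limit is minimizing for the limit belief.\<close>

lemma bellman_weakly_continuous:
  assumes w: "weakly_continuous w" "bounded_on_beliefs w B"
  shows "weakly_continuous (bellman w)"
  unfolding weakly_continuous_def
proof (intro allI impI)
  fix Z :: "nat \<Rightarrow> 'x measure" and z assume Z: "wconv Z z"
  note Zz = wconvD(1,2)[OF Z]
  obtain v where v: "bellman w z = action_value w z v" using bellman_attained[OF w Zz(2)] by blast
  show "(\<lambda>n. bellman w (Z n)) \<longlonglongrightarrow> bellman w z"
  proof (rule tendsto_if_subseq)
    fix r :: "nat \<Rightarrow> nat" assume r: "strict_mono r"
    have "\<forall>n. \<exists>u. bellman w (Z (r n)) = action_value w (Z (r n)) u"
      using bellman_attained[OF w Zz(1)] by metis
    from choice[OF this] obtain u where u: "\<And>n. bellman w (Z (r n)) = action_value w (Z (r n)) (u n)" by blast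
    obtain l s where s: "strict_mono (s :: nat \<Rightarrow> nat)" "(u \<circ> s) \<longlonglongrightarrow> l"
      using seq_compactE[OF compact_imp_seq_compact[OF compact_actions], of u] by blast
    have Zrs: "wconv (\<lambda>n. Z (r (s n))) z"
      using wconv_subseq[OF wconv_subseq[OF Z r] s(1)] by (simp add: o_def)
    have lim: "(\<lambda>n. bellman w (Z (r (s n)))) \<longlonglongrightarrow> action_value w z l"
      using action_value_tendsto[OF w Zrs s(2)] by (simp add: u o_def)
    have "action_value w z l \<le> action_value w z v"
    proof (rule LIMSEQ_le[OF lim action_value_tendsto[OF w Zrs tendsto_const]])
      show "\<exists>N. \<forall>n\<ge>N. bellman w (Z (r (s n))) \<le> action_value w (Z (r (s n))) v"
        using bellman_le[OF w Zz(1)] by blast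
    qed
    with v bellman_le[OF w Zz(2), of l] have "bellman w z = action_value w z l" by simp
    with lim s(1) show "\<exists>s. strict_mono s \<and> (\<lambda>n. bellman w (Z (r (s n)))) \<longlonglongrightarrow> bellman w z" by auto
  qed
qed

lemma bellman_contraction:
  assumes w: "weakly_continuous w" "bounded_on_beliefs w B" and w': "weakly_continuous w'" "bounded_on_beliefs w' B'"
    and d: "\<And>\<pi>. \<pi> \<in> prob_measures \<Longrightarrow> \<bar>w \<pi> - w' \<pi>\<bar> \<le> d" and \<pi>: "\<pi> \<in> prob_measures"
  shows "\<bar>bellman w \<pi> - bellman w' \<pi>\<bar> \<le> \<beta> * d"
proof -
  note m = weakly_continuous_measurable[OF w(1)] and m' = weakly_continuous_measurable[OF w'(1)]
  have diff: "\<bar>action_value w \<pi> u - action_value w' \<pi> u\<bar> \<le> \<beta> * d" for u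
  proof -
    have "(\<integral>\<pi>'. w \<pi>' \<partial>eta \<pi> u) - (\<integral>\<pi>'. w' \<pi>' \<partial>eta \<pi> u) = (\<integral>\<pi>'. w \<pi>' - w' \<pi>' \<partial>eta \<pi> u)"
      using eta_integrable[OF \<pi> m w(2)] eta_integrable[OF \<pi> m' w'(2)] by simp
    then have "action_value w \<pi> u - action_value w' \<pi> u = \<beta> * (\<integral>\<pi>'. w \<pi>' - w' \<pi>' \<partial>eta \<pi> u)"
      by (simp add: action_value_def flip: right_diff_distrib)
    moreover have "\<bar>\<integral>\<pi>'. w \<pi>' - w' \<pi>' \<partial>eta \<pi> u\<bar> \<le> d"
      using d m m' by (intro eta_integral_bounded[OF \<pi>]) (auto simp: bounded_on_beliefs_def)
    ultimately show ?thesis using \<beta> by (simp add: abs_mult mult_left_mono)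
  qed
  obtain u where u: "bellman w \<pi> = action_value w \<pi> u" using bellman_attained[OF w \<pi>] by blast
  obtain u' where u': "bellman w' \<pi> = action_value w' \<pi> u'" using bellman_attained[OF w' \<pi>] by blast
  have "bellman w \<pi> \<le> action_value w \<pi> u'" "bellman w' \<pi> \<le> action_value w' \<pi> u"
    using bellman_le[OF w \<pi>] bellman_le[OF w' \<pi>] by auto
  with diff[of u] diff[of u'] u u' show ?thesis by linarith
qed

text \<open>The fixed point of the Bellman operator is obtained as the limit of the iterates from \<open>0\<close>, since
  the Lipschitz estimate below is proved along these iterates.\<close>

definition iterate :: "nat \<Rightarrow> 'x measure \<Rightarrow> real" where
  "iterate n = (bellman ^^ n) (\<lambda>_. 0)"

abbreviation (input) "bound \<equiv> C / (1 - \<beta>)"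

lemma bound_step: "C + \<beta> * bound = bound"
  using \<beta> by (simp add: field_simps)

lemma iterate: "weakly_continuous (iterate n) \<and> bounded_on_beliefs (iterate n) bound"
proof (induction n)
  case 0
  show ?case using C_nonneg \<beta> by (simp add: iterate_def weakly_continuous_def bounded_on_beliefs_def)
next
  case (Suc n)
  have S: "iterate (Suc n) = bellman (iterate n)" by (simp add: iterate_def)
  show ?case
    unfolding S
    using Suc bellman_weakly_continuous[of "iterate n"] bellman_bounded[of "iterate n" bound, unfolded bound_step] by blast
qed

lemma iterate_add: 
  assumes "\<pi> \<in> prob_measures"
  shows "\<bar>iterate (n + m) \<pi> - iterate n \<pi>\<bar> \<le> \<beta> ^ n * bound"
  using assms
proof (induction n arbitrary: \<pi>)
  case 0
  then show ?case using iterate[of m] by (auto simp: bounded_on_beliefs_def iterate_def[of 0])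
next
  case (Suc n)
  have S: "iterate (Suc k) = bellman (iterate k)" for k by (simp add: iterate_def)
  have "\<bar>bellman (iterate (n + m)) \<pi> - bellman (iterate n) \<pi>\<bar> \<le> \<beta> * (\<beta> ^ n * bound)"
    using iterate Suc by (intro bellman_contraction) auto
  then show ?case by (simp add: S mult.assoc)
qed

lemma rate_tendsto: "(\<lambda>n. \<beta> ^ n * bound) \<longlonglongrightarrow> 0"
  using \<beta> by (intro tendsto_mult_left_zero LIMSEQ_realpow_zero) auto

definition bellman_limit :: "'x measure \<Rightarrow> real" where
  "bellman_limit \<pi> = lim (\<lambda>n. iterate n \<pi>)"

lemma iterate_tendsto:
  assumes \<pi>: "\<pi> \<in> prob_measures"
  shows "(\<lambda>n. iterate n \<pi>) \<longlonglongrightarrow> bellman_limit \<pi>"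
proof -
  have "Cauchy (\<lambda>n. iterate n \<pi>)"
  proof (rule CauchyI')
    fix e :: real assume "0 < e"
    then have "\<forall>\<^sub>F n in sequentially. \<beta> ^ n * bound < e" by (rule order_tendstoD(2)[OF rate_tendsto])
    then obtain N where N: "\<And>n. n \<ge> N \<Longrightarrow> \<beta> ^ n * bound < e" by (auto simp: eventually_sequentially)
    have "dist (iterate m \<pi>) (iterate n \<pi>) < e" if "N \<le> m" "m < n" for m n
    proof -
      have "\<bar>iterate n \<pi> - iterate m \<pi>\<bar> < e"
        using iterate_add[OF \<pi>, of m "n - m"] N[OF that(1)] that(2) by simp
      then show ?thesis by (simp add: dist_real_def abs_minus_commute)
    qed
    then show "\<exists>M. \<forall>m\<ge>M. \<forall>n>m. dist (iterate m \<pi>) (iterate n \<pi>) < e" by blast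
  qed
  then show ?thesis unfolding bellman_limit_def by (simp add: Cauchy_convergent_iff convergent_LIMSEQ_iff)
qed

lemma iterate_limit_diff:
  assumes \<pi>: "\<pi> \<in> prob_measures"
  shows "\<bar>bellman_limit \<pi> - iterate n \<pi>\<bar> \<le> \<beta> ^ n * bound"
proof (rule LIMSEQ_le_const2)
  show "(\<lambda>m. \<bar>iterate (n + m) \<pi> - iterate n \<pi>\<bar>) \<longlonglongrightarrow> \<bar>bellman_limit \<pi> - iterate n \<pi>\<bar>"
    using LIMSEQ_ignore_initial_segment[OF iterate_tendsto[OF \<pi>], of n]
    by (intro tendsto_intros) (simp add: add.commute)
qed (use iterate_add[OF \<pi>] in auto)

lemma bellman_limit_bounded: "bounded_on_beliefs bellman_limit bound"
  unfolding bounded_on_beliefs_def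
proof
  fix \<pi> :: "'x measure" assume "\<pi> \<in> prob_measures"
  from iterate_limit_diff[OF this, of 0] show "\<bar>bellman_limit \<pi>\<bar> \<le> bound" by (simp add: iterate_def)
qed

lemma bellman_limit_weakly_continuous: "weakly_continuous bellman_limit"
  unfolding weakly_continuous_def
proof (intro allI impI)
  fix Z :: "nat \<Rightarrow> 'x measure" and z assume Z: "wconv Z z"
  note Zz = wconvD(1,2)[OF Z]
  show "(\<lambda>n. bellman_limit (Z n)) \<longlonglongrightarrow> bellman_limit z"
  proof (rule tendstoI)
    fix e :: real assume e: "0 < e"
    have "\<forall>\<^sub>F k in sequentially. \<beta> ^ k * bound < e / 3"
      by (rule order_tendstoD(2)[OF rate_tendsto]) (use e in simp)
    then obtain k where k: "\<beta> ^ k * bound < e / 3" by (auto simp: eventually_sequentially)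
    have "(\<lambda>n. iterate k (Z n)) \<longlonglongrightarrow> iterate k z" using iterate Z by (auto simp: weakly_continuous_def)
    from tendstoD[OF this, of "e / 3"] e
    have "\<forall>\<^sub>F n in sequentially. dist (iterate k (Z n)) (iterate k z) < e / 3" by simp
    then show "\<forall>\<^sub>F n in sequentially. dist (bellman_limit (Z n)) (bellman_limit z) < e"
    proof eventually_elim
      case (elim n)
      with iterate_limit_diff[OF Zz(1), of n k] iterate_limit_diff[OF Zz(2), of k] k
      show ?case unfolding dist_real_def by linarith
    qed
  qed
qed

lemma bellman_limit_fixed_point:
  assumes \<pi>: "\<pi> \<in> prob_measures"
  shows "bellman bellman_limit \<pi> = bellman_limit \<pi>"
proof -
  have "\<bar>bellman bellman_limit \<pi> - bellman_limit \<pi>\<bar> \<le> 2 * (\<beta> ^ n * bound)" for n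
  proof -
    have S: "iterate (Suc n) = bellman (iterate n)" by (simp add: iterate_def)
    have b: "0 \<le> \<beta> ^ n * bound" using \<beta> C_nonneg by simp
    have "\<bar>bellman bellman_limit \<pi> - bellman (iterate n) \<pi>\<bar> \<le> \<beta> * (\<beta> ^ n * bound)"
      using iterate iterate_limit_diff bellman_limit_weakly_continuous bellman_limit_bounded \<pi>
      by (intro bellman_contraction) auto
    moreover have "\<bar>bellman_limit \<pi> - bellman (iterate n) \<pi>\<bar> \<le> \<beta> * (\<beta> ^ n * bound)"
      using iterate_limit_diff[OF \<pi>, of "Suc n"] by (simp add: S mult.assoc)
    moreover have "\<beta> * (\<beta> ^ n * bound) \<le> 1 * (\<beta> ^ n * bound)"
      using b \<beta> by (intro mult_right_mono) auto
    ultimately show ?thesis by linarith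
  qed
  then have "\<bar>bellman bellman_limit \<pi> - bellman_limit \<pi>\<bar> \<le> 0"
    using LIMSEQ_le_const[OF tendsto_mult_right_zero[OF rate_tendsto, of 2]] by blast
  then show ?thesis by simp
qed

end

section \<open>Trajectories and optimality\<close>

context feller_control
begin

abbreviation (input) stages :: "('x measure \<times> 'u) measure" where
  "stages \<equiv> prob_algebra borel \<Otimes>\<^sub>M borel"

lemma next_belief_measurable:
  assumes z: "z \<in> prob_measures"
  shows "next_belief eta z k \<in> PiM {0..<k} (\<lambda>_. stages) \<rightarrow>\<^sub>M prob_algebra (prob_algebra borel)"
proof (cases k)
  case 0
  have "return (prob_algebra borel) z \<in> space (prob_algebra (prob_algebra borel))"
    using z by (simp add: space_prob_algebra[of "prob_algebra borel"] prob_space_return)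
  then show ?thesis by (simp add: next_belief_def[abs_def] 0)
next
  case (Suc j)
  have "(\<lambda>\<omega>. \<omega> j) \<in> PiM {0..<k} (\<lambda>_. stages) \<rightarrow>\<^sub>M stages"
    by (rule measurable_component_singleton) (simp add: Suc)
  from measurable_compose[OF this eta] show ?thesis
    by (simp add: next_belief_def[abs_def] Suc case_prod_beta)
qed

lemma policy_measurable:
  assumes \<gamma>: "\<gamma> \<in> policies"
  shows "(\<lambda>(\<omega>, \<pi>). (\<pi>, \<gamma> k (\<lambda>i\<in>{..k}. if i = k then \<pi> else fst (\<omega> i), \<lambda>i\<in>{..<k}. snd (\<omega> i))))
    \<in> PiM {0..<k} (\<lambda>_. stages) \<Otimes>\<^sub>M prob_algebra borel \<rightarrow>\<^sub>M stages"
proof -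
  let ?N = "PiM {0..<k} (\<lambda>_. stages) \<Otimes>\<^sub>M (prob_algebra borel :: 'x measure measure)"
  have comp: "(\<lambda>p. fst p i) \<in> ?N \<rightarrow>\<^sub>M stages" if "i < k" for i
    using measurable_compose[OF measurable_fst measurable_component_singleton[of i "{0..<k}" "\<lambda>_. stages"]] that by simp
  have "(\<lambda>p. \<lambda>i\<in>{..k}. if i = k then snd p else fst (fst p i)) \<in> ?N \<rightarrow>\<^sub>M PiM {..k} (\<lambda>_. prob_algebra borel)"
  proof (rule measurable_restrict)
    fix i assume "i \<in> {..k}"
    then show "(\<lambda>p. if i = k then snd p else fst (fst p i)) \<in> ?N \<rightarrow>\<^sub>M prob_algebra borel"
      using measurable_compose[OF comp measurable_fst, of i] by (cases "i = k") auto
  qed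
  moreover have "(\<lambda>p. \<lambda>i\<in>{..<k}. snd (fst p i)) \<in> ?N \<rightarrow>\<^sub>M PiM {..<k} (\<lambda>_. borel)"
    using measurable_compose[OF comp measurable_snd] by (intro measurable_restrict) auto
  ultimately have h: "(\<lambda>p. (\<lambda>i\<in>{..k}. if i = k then snd p else fst (fst p i), \<lambda>i\<in>{..<k}. snd (fst p i)))
      \<in> ?N \<rightarrow>\<^sub>M PiM {..k} (\<lambda>_. prob_algebra borel) \<Otimes>\<^sub>M PiM {..<k} (\<lambda>_. borel)"
    by (rule measurable_Pair)
  have "\<gamma> k \<in> PiM {..k} (\<lambda>_. prob_algebra borel) \<Otimes>\<^sub>M PiM {..<k} (\<lambda>_. borel) \<rightarrow>\<^sub>M borel"
    using \<gamma> by (simp add: policies_def)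
  from measurable_Pair[OF measurable_snd measurable_compose[OF h this]] show ?thesis
    by (simp add: case_prod_beta)
qed

lemma next_stage_measurable:
  assumes "z \<in> prob_measures" "\<gamma> \<in> policies"
  shows "next_stage eta \<gamma> z k \<in> PiM {0..<k} (\<lambda>_. stages) \<rightarrow>\<^sub>M prob_algebra stages"
  using measurable_distr_prob_space2[OF next_belief_measurable[OF assms(1), of k] policy_measurable[OF assms(2), of k]]
  by (simp add: next_stage_def[abs_def])

lemma Ionescu_Tulcea_next_stage:
  assumes "z \<in> prob_measures" "\<gamma> \<in> policies"
  shows "Ionescu_Tulcea (next_stage eta \<gamma> z) (\<lambda>_. stages)"
proof (rule Ionescu_Tulcea.intro)
  show "next_stage eta \<gamma> z i \<in> PiM {0..<i} (\<lambda>_. stages) \<rightarrow>\<^sub>M subprob_algebra stages" for i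
    using next_stage_measurable[OF assms] by (rule measurable_prob_algebraD)
  show "prob_space (next_stage eta \<gamma> z i \<omega>)" if "\<omega> \<in> space (PiM {0..<i} (\<lambda>_. stages))" for i \<omega>
    using measurable_space[OF next_stage_measurable[OF assms, of i] that] by (simp add: space_prob_algebra)
qed

definition history_law where
  "history_law \<gamma> z n = Ionescu_Tulcea.C (next_stage eta \<gamma> z) (\<lambda>_. stages) 0 n (\<lambda>_. undefined)"

definition expected :: "('x, 'u) policy \<Rightarrow> 'x measure \<Rightarrow> nat \<Rightarrow> ('x measure \<times> 'u \<Rightarrow> real) \<Rightarrow> real" where
  "expected \<gamma> z n h = (\<integral>\<omega>. h (\<omega> n) \<partial>trajectory_law eta \<gamma> z)"

lemma
  assumes "z \<in> prob_measures" "\<gamma> \<in> policies"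
  shows prob_space_trajectory_law: "prob_space (trajectory_law eta \<gamma> z)"
    and sets_trajectory_law: "sets (trajectory_law eta \<gamma> z) = sets (PiM UNIV (\<lambda>_. stages))"
    and space_history_law: "space (history_law \<gamma> z n) = space (PiM {0..<n} (\<lambda>_. stages))"
    and sets_history_law: "sets (history_law \<gamma> z n) = sets (PiM {0..<n} (\<lambda>_. stages))"
    and prob_space_history_law: "prob_space (history_law \<gamma> z n)"
    and trajectory_law_restrict:
      "distr (trajectory_law eta \<gamma> z) (PiM {0..<n} (\<lambda>_. stages)) (\<lambda>\<omega>. restrict \<omega> {0..<n}) = history_law \<gamma> z n"
proof -
  interpret IT: Ionescu_Tulcea "next_stage eta \<gamma> z" "\<lambda>_. stages" by (rule Ionescu_Tulcea_next_stage[OF assms])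
  have t: "trajectory_law eta \<gamma> z = IT.PF.lim" by (simp add: trajectory_law_def)
  have r: "(\<lambda>x. restrict x {}) \<in> IT.PF.lim \<rightarrow>\<^sub>M PiM {} (\<lambda>_. stages)"
    unfolding measurable_cong_sets[OF IT.PF.sets_lim refl] by (rule measurable_restrict_subset) simp
  have "prob_space (distr IT.PF.lim (PiM {} (\<lambda>_. stages)) (\<lambda>x. restrict x {}))"
    unfolding IT.distr_lim[OF finite.emptyI] by (rule IT.PF.prob_space_P) simp_all
  with r show "prob_space (trajectory_law eta \<gamma> z)" unfolding t by (rule prob_space_distrD)
  show "sets (trajectory_law eta \<gamma> z) = sets (PiM UNIV (\<lambda>_. stages))" unfolding t by (rule IT.PF.sets_lim)
  have u: "(\<lambda>_. undefined) \<in> space (PiM {0..<0::nat} (\<lambda>_. stages))" by (simp add: space_PiM)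
  show sp: "space (history_law \<gamma> z n) = space (PiM {0..<n} (\<lambda>_. stages))"
    and st: "sets (history_law \<gamma> z n) = sets (PiM {0..<n} (\<lambda>_. stages))"
    using IT.space_C[OF u, of n] IT.sets_C[OF u, of n] by (simp_all add: history_law_def)
  show "prob_space (history_law \<gamma> z n)" using IT.prob_space_C[OF u] by (simp add: history_law_def)
  have "IT.up_to {0..<n} = n"
  proof (rule antisym)
    show "IT.up_to {0..<n} \<le> n" by (simp add: IT.up_to_iff)
    show "n \<le> IT.up_to {0..<n}" using IT.up_to[of "{0..<n}"] by (cases "n = 0") auto
  qed
  then have "distr IT.PF.lim (PiM {0..<n} (\<lambda>_. stages)) (\<lambda>\<omega>. restrict \<omega> {0..<n})
      = distr (history_law \<gamma> z n) (PiM {0..<n} (\<lambda>_. stages)) (\<lambda>\<omega>. restrict \<omega> {0..<n})"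
    by (simp add: IT.distr_lim IT.CI_def history_law_def)
  also have "\<dots> = distr (history_law \<gamma> z n) (PiM {0..<n} (\<lambda>_. stages)) (\<lambda>\<omega>. \<omega>)"
    by (rule distr_cong) (auto simp: sp space_PiM)
  also have "\<dots> = history_law \<gamma> z n" by (rule distr_id2[OF st[symmetric]])
  finally show "distr (trajectory_law eta \<gamma> z) (PiM {0..<n} (\<lambda>_. stages)) (\<lambda>\<omega>. restrict \<omega> {0..<n}) = history_law \<gamma> z n"
    unfolding t .
qed

lemma expected_history:
  assumes z: "z \<in> prob_measures" and \<gamma>: "\<gamma> \<in> policies" and h: "h \<in> borel_measurable stages" and "k < n"
  shows "expected \<gamma> z k h = (\<integral>\<omega>. h (\<omega> k) \<partial>history_law \<gamma> z n)"
proof -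
  have m: "(\<lambda>\<omega>. h (\<omega> k)) \<in> borel_measurable (PiM {0..<n} (\<lambda>_. stages))"
    using measurable_compose[OF measurable_component_singleton[of k "{0..<n}" "\<lambda>_. stages"] h] \<open>k < n\<close> by simp
  have r: "(\<lambda>\<omega>. restrict \<omega> {0..<n}) \<in> trajectory_law eta \<gamma> z \<rightarrow>\<^sub>M PiM {0..<n} (\<lambda>_. stages)"
    unfolding measurable_cong_sets[OF sets_trajectory_law[OF z \<gamma>] refl]
    by (rule measurable_restrict_subset) simp
  show ?thesis
    unfolding expected_def trajectory_law_restrict[OF z \<gamma>, of n, symmetric] integral_distr[OF r m]
    using \<open>k < n\<close> by simp
qed

lemma expected_next_stage:
  assumes z: "z \<in> prob_measures" and \<gamma>: "\<gamma> \<in> policies" and h: "h \<in> borel_measurable stages"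
    and B: "\<forall>p\<in>space stages. \<bar>h p\<bar> \<le> B"
  shows "expected \<gamma> z n h = (\<integral>\<omega>. (\<integral>p. h p \<partial>next_stage eta \<gamma> z n \<omega>) \<partial>history_law \<gamma> z n)"
proof -
  interpret IT: Ionescu_Tulcea "next_stage eta \<gamma> z" "\<lambda>_. stages" by (rule Ionescu_Tulcea_next_stage[OF z \<gamma>])
  have m: "(\<lambda>\<omega>. h (\<omega> n)) \<in> borel_measurable (PiM {0..<Suc n} (\<lambda>_. stages))"
    using measurable_compose[OF measurable_component_singleton[of n "{0..<Suc n}" "\<lambda>_. stages"] h] by simp
  note sp = space_history_law[OF z \<gamma>] and st = sets_history_law[OF z \<gamma>]
  have "expected \<gamma> z n h = (\<integral>\<omega>. h (\<omega> n) \<partial>history_law \<gamma> z (Suc n))"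
    by (rule expected_history[OF z \<gamma> h]) simp
  also have "history_law \<gamma> z (Suc n) = history_law \<gamma> z n \<bind> IT.eP n" by (simp add: history_law_def)
  also have "(\<integral>\<omega>. h (\<omega> n) \<partial>(history_law \<gamma> z n \<bind> IT.eP n)) = (\<integral>\<omega>. (\<integral>\<omega>'. h (\<omega>' n) \<partial>IT.eP n \<omega>) \<partial>history_law \<gamma> z n)"
  proof (rule integral_bind[where B'=1 and B=B, OF m])
    show "\<bar>h (\<omega> n)\<bar> \<le> B" if "\<omega> \<in> space (PiM {0..<Suc n} (\<lambda>_. stages))" for \<omega>
      using that B by (auto simp: space_PiM)
    show "IT.eP n \<in> history_law \<gamma> z n \<rightarrow>\<^sub>M subprob_algebra (PiM {0..<Suc n} (\<lambda>_. stages))"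
      unfolding measurable_cong_sets[OF st refl] by (rule IT.measurable_eP)
    show "finite_measure (history_law \<gamma> z n)"
      by (rule prob_space.finite_measure[OF prob_space_history_law[OF z \<gamma>]])
    show "AE \<omega> in history_law \<gamma> z n. emeasure (IT.eP n \<omega>) (space (IT.eP n \<omega>)) \<le> ennreal 1"
      using prob_space.emeasure_space_1[OF IT.prob_space_eP] by (intro AE_I2) (simp add: sp)
  qed
  also have "\<dots> = (\<integral>\<omega>. (\<integral>p. h p \<partial>next_stage eta \<gamma> z n \<omega>) \<partial>history_law \<gamma> z n)"
  proof (rule Bochner_Integration.integral_cong[OF refl])
    fix \<omega> assume "\<omega> \<in> space (history_law \<gamma> z n)"
    then have \<omega>: "\<omega> \<in> space (PiM {0..<n} (\<lambda>_. stages))" by (simp add: sp)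
    have "fun_upd \<omega> n \<in> next_stage eta \<gamma> z n \<omega> \<rightarrow>\<^sub>M PiM {0..<Suc n} (\<lambda>_. stages)"
      unfolding measurable_cong_sets[OF IT.sets_P[OF \<omega>] refl] using \<omega>
      by (intro measurable_fun_upd[where J="{0..<n}"] measurable_const measurable_ident) auto
    from integral_distr[OF this m]
    show "(\<integral>\<omega>'. h (\<omega>' n) \<partial>IT.eP n \<omega>) = (\<integral>p. h p \<partial>next_stage eta \<gamma> z n \<omega>)"
      by (simp add: IT.eP_def)
  qed
  finally show ?thesis .
qed

lemma integral_next_stage:
  fixes h :: "'x measure \<times> 'u \<Rightarrow> real"
  assumes z: "z \<in> prob_measures" and \<gamma>: "\<gamma> \<in> policies" and h: "h \<in> borel_measurable stages"
    and \<omega>: "\<omega> \<in> space (PiM {0..<k} (\<lambda>_. stages))"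
  shows "(\<integral>p. h p \<partial>next_stage eta \<gamma> z k \<omega>)
    = (\<integral>\<pi>. h (\<pi>, \<gamma> k (\<lambda>i\<in>{..k}. if i = k then \<pi> else fst (\<omega> i), \<lambda>i\<in>{..<k}. snd (\<omega> i))) \<partial>next_belief eta z k \<omega>)"
  unfolding next_stage_def
proof (rule integral_distr[OF _ h])
  have sets: "sets (next_belief eta z k \<omega>) = sets (prob_algebra borel)"
    using measurable_space[OF next_belief_measurable[OF z] \<omega>] by (simp add: space_prob_algebra[of "prob_algebra borel"])
  have "(\<lambda>\<pi>. (\<omega>, \<pi>)) \<in> prob_algebra borel \<rightarrow>\<^sub>M PiM {0..<k} (\<lambda>_. stages) \<Otimes>\<^sub>M prob_algebra borel"
    using \<omega> by (intro measurable_Pair measurable_const) simp_all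
  from measurable_compose[OF this policy_measurable[OF \<gamma>, of k]]
  have "(\<lambda>\<pi>. (\<pi>, \<gamma> k (\<lambda>i\<in>{..k}. if i = k then \<pi> else fst (\<omega> i), \<lambda>i\<in>{..<k}. snd (\<omega> i))))
      \<in> prob_algebra borel \<rightarrow>\<^sub>M stages" by simp
  then show "(\<lambda>\<pi>. (\<pi>, \<gamma> k (\<lambda>i\<in>{..k}. if i = k then \<pi> else fst (\<omega> i), \<lambda>i\<in>{..<k}. snd (\<omega> i))))
      \<in> next_belief eta z k \<omega> \<rightarrow>\<^sub>M stages"
    unfolding measurable_cong_sets[OF sets refl] .
qed

lemma measurable_fst_stages: "w \<in> borel_measurable (prob_algebra borel) \<Longrightarrow> (\<lambda>p. w (fst p)) \<in> borel_measurable stages"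
  by (rule measurable_compose[OF measurable_fst])

lemma eta_integral_measurable:
  fixes w :: "'x measure \<Rightarrow> real"
  assumes "w \<in> borel_measurable (prob_algebra borel)"
  shows "(\<lambda>p. \<integral>\<pi>. w \<pi> \<partial>eta (fst p) (snd p)) \<in> borel_measurable stages"
  using measurable_compose[OF eta measurable_integral_prob[OF assms]] by (simp add: case_prod_beta)

lemma cost_measurable: "(\<lambda>p. belief_cost c (fst p) (snd p)) \<in> borel_measurable stages"
proof -
  have cm: "(\<lambda>(x, u). c x u) \<in> borel_measurable borel"
    using c_continuous by (rule borel_measurable_continuous_UNIV)
  have "(\<lambda>q. (snd q, snd (fst q))) \<in> stages \<Otimes>\<^sub>M (borel :: 'x measure) \<rightarrow>\<^sub>M borel \<Otimes>\<^sub>M borel" by measurable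
  then have "(\<lambda>(p, x). (x, snd p)) \<in> stages \<Otimes>\<^sub>M (borel :: 'x measure) \<rightarrow>\<^sub>M borel"
    by (simp add: case_prod_beta borel_prod)
  from measurable_distr_prob_space2[OF measurable_fst this]
  have "(\<lambda>p. distr (fst p) borel (\<lambda>x. (x, snd p))) \<in> stages \<rightarrow>\<^sub>M prob_algebra borel" .
  from measurable_compose[OF this measurable_integral_prob[OF cm]]
  show ?thesis
  proof (rule measurable_cong[THEN iffD1, rotated])
    fix p :: "'x measure \<times> 'u" assume "p \<in> space stages"
    then have p: "fst p \<in> prob_measures" by (auto simp: space_pair_measure)
    have "(\<lambda>x. (x, snd p)) \<in> fst p \<rightarrow>\<^sub>M borel"
      unfolding measurable_cong_sets[OF prob_measuresD(2)[OF p] refl]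
      by (intro borel_measurable_continuous_onI continuous_intros)
    from integral_distr[OF this cm]
    show "(\<integral>q. (case q of (x, u) \<Rightarrow> c x u) \<partial>distr (fst p) borel (\<lambda>x. (x, snd p))) = belief_cost c (fst p) (snd p)"
      by (simp add: belief_cost_def)
  qed
qed

text \<open>The Markov property, in the weak form that verification needs: given the whole past, the next
  belief depends only on the present belief and action.\<close>

lemma expected_Suc_belief:
  assumes z: "z \<in> prob_measures" and \<gamma>: "\<gamma> \<in> policies"
    and w: "w \<in> borel_measurable (prob_algebra borel)" "bounded_on_beliefs w B"
  shows "expected \<gamma> z (Suc n) (\<lambda>p. w (fst p)) = expected \<gamma> z n (\<lambda>p. \<integral>\<pi>. w \<pi> \<partial>eta (fst p) (snd p))"
proof -
  have B: "\<forall>p\<in>space stages. \<bar>w (fst p)\<bar> \<le> B"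
    using w(2) by (auto simp: bounded_on_beliefs_def space_pair_measure)
  have "expected \<gamma> z (Suc n) (\<lambda>p. w (fst p))
      = (\<integral>\<omega>. (\<integral>p. w (fst p) \<partial>next_stage eta \<gamma> z (Suc n) \<omega>) \<partial>history_law \<gamma> z (Suc n))"
    by (rule expected_next_stage[OF z \<gamma> measurable_fst_stages[OF w(1)] B])
  also have "\<dots> = (\<integral>\<omega>. (\<integral>\<pi>. w \<pi> \<partial>eta (fst (\<omega> n)) (snd (\<omega> n))) \<partial>history_law \<gamma> z (Suc n))"
  proof (rule Bochner_Integration.integral_cong[OF refl])
    fix \<omega> assume "\<omega> \<in> space (history_law \<gamma> z (Suc n))"
    then have "\<omega> \<in> space (PiM {0..<Suc n} (\<lambda>_. stages))" by (simp add: space_history_law[OF z \<gamma>])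
    from integral_next_stage[OF z \<gamma> measurable_fst_stages[OF w(1)] this]
    show "(\<integral>p. w (fst p) \<partial>next_stage eta \<gamma> z (Suc n) \<omega>) = (\<integral>\<pi>. w \<pi> \<partial>eta (fst (\<omega> n)) (snd (\<omega> n)))"
      by (simp add: next_belief_def)
  qed
  also have "\<dots> = expected \<gamma> z n (\<lambda>p. \<integral>\<pi>. w \<pi> \<partial>eta (fst p) (snd p))"
    by (rule expected_history[OF z \<gamma> eta_integral_measurable[OF w(1)], symmetric]) simp
  finally show ?thesis .
qed

lemma expected_0_belief:
  assumes z: "z \<in> prob_measures" and \<gamma>: "\<gamma> \<in> policies"
    and w: "w \<in> borel_measurable (prob_algebra borel)" "bounded_on_beliefs w B"
  shows "expected \<gamma> z 0 (\<lambda>p. w (fst p)) = w z"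
proof -
  interpret h: prob_space "history_law \<gamma> z 0" by (rule prob_space_history_law[OF z \<gamma>])
  have B: "\<forall>p\<in>space stages. \<bar>w (fst p)\<bar> \<le> B"
    using w(2) by (auto simp: bounded_on_beliefs_def space_pair_measure)
  have "expected \<gamma> z 0 (\<lambda>p. w (fst p))
      = (\<integral>\<omega>. (\<integral>p. w (fst p) \<partial>next_stage eta \<gamma> z 0 \<omega>) \<partial>history_law \<gamma> z 0)"
    by (rule expected_next_stage[OF z \<gamma> measurable_fst_stages[OF w(1)] B])
  also have "\<dots> = (\<integral>\<omega>. w z \<partial>history_law \<gamma> z 0)"
  proof (rule Bochner_Integration.integral_cong[OF refl])
    fix \<omega> assume "\<omega> \<in> space (history_law \<gamma> z 0)"
    then have "\<omega> \<in> space (PiM {0..<0} (\<lambda>_. stages))" by (simp add: space_history_law[OF z \<gamma>])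
    from integral_next_stage[OF z \<gamma> measurable_fst_stages[OF w(1)] this]
    show "(\<integral>p. w (fst p) \<partial>next_stage eta \<gamma> z 0 \<omega>) = w z"
      using z w(1) by (simp add: next_belief_def integral_return)
  qed
  finally show ?thesis by (simp add: h.prob_space)
qed

lemma trajectory_component:
  fixes h :: "'x measure \<times> 'u \<Rightarrow> real"
  assumes z: "z \<in> prob_measures" and \<gamma>: "\<gamma> \<in> policies" and h: "h \<in> borel_measurable stages"
    and B: "\<forall>p\<in>space stages. \<bar>h p\<bar> \<le> B"
  shows "(\<lambda>\<omega>. h (\<omega> n)) \<in> borel_measurable (trajectory_law eta \<gamma> z)"
    and "\<omega> \<in> space (trajectory_law eta \<gamma> z) \<Longrightarrow> \<omega> n \<in> space stages"
    and "integrable (trajectory_law eta \<gamma> z) (\<lambda>\<omega>. h (\<omega> n))"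
proof -
  note st = sets_trajectory_law[OF z \<gamma>]
  show m: "(\<lambda>\<omega>. h (\<omega> n)) \<in> borel_measurable (trajectory_law eta \<gamma> z)"
    unfolding measurable_cong_sets[OF st refl]
    using measurable_compose[OF measurable_component_singleton[of n UNIV "\<lambda>_. stages"] h] by simp
  show sp: "\<omega> n \<in> space stages" if "\<omega> \<in> space (trajectory_law eta \<gamma> z)" for \<omega>
    using that sets_eq_imp_space_eq[OF st] by (auto simp: space_PiM)
  show "integrable (trajectory_law eta \<gamma> z) (\<lambda>\<omega>. h (\<omega> n))"
    using B sp by (intro prob_space.integrable_bounded[OF prob_space_trajectory_law[OF z \<gamma>] m]) auto
qed

lemma expected_bounded:
  assumes "z \<in> prob_measures" "\<gamma> \<in> policies" "h \<in> borel_measurable stages"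
    "\<forall>p\<in>space stages. \<bar>h p\<bar> \<le> B"
  shows "\<bar>expected \<gamma> z n h\<bar> \<le> B"
  unfolding expected_def
  by (rule prob_space.integral_bounded[OF prob_space_trajectory_law[OF assms(1,2)]])
    (use trajectory_component[OF assms] assms(4) in auto)

abbreviation (input) stage_cost :: "'x measure \<times> 'u \<Rightarrow> real" where
  "stage_cost \<equiv> \<lambda>p. belief_cost c (fst p) (snd p)"

lemma stage_cost_bounded: "\<forall>p\<in>space stages. \<bar>stage_cost p\<bar> \<le> C"
  using cost_bounded by (auto simp: space_pair_measure)

lemma discounted_cost_sums:
  assumes z: "z \<in> prob_measures" and \<gamma>: "\<gamma> \<in> policies"
  shows "(\<lambda>k. \<beta> ^ k * expected \<gamma> z k stage_cost) sums discounted_cost eta c \<beta> z \<gamma>"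
proof -
  note t = trajectory_component[OF z \<gamma> cost_measurable stage_cost_bounded]
  interpret t: prob_space "trajectory_law eta \<gamma> z" by (rule prob_space_trajectory_law[OF z \<gamma>])
  let ?f = "\<lambda>k \<omega>. \<beta> ^ k * belief_cost c (fst (\<omega> k)) (snd (\<omega> k))"
  have b: "norm (?f k \<omega>) \<le> \<beta> ^ k * C" if "\<omega> \<in> space (trajectory_law eta \<gamma> z)" for k \<omega>
    using bspec[OF stage_cost_bounded t(2)[OF that, of k]] \<beta> by (simp add: abs_mult mult_left_mono)
  have s: "summable (\<lambda>k. \<beta> ^ k * C)" using \<beta> by (intro summable_mult2 summable_geometric) auto
  have i: "integrable (trajectory_law eta \<gamma> z) (?f k)" for k using t(3) by simp
  have ni: "norm (\<integral>\<omega>. norm (?f k \<omega>) \<partial>trajectory_law eta \<gamma> z) \<le> \<beta> ^ k * C" for k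
    using b borel_measurable_integrable[OF integrable_norm[OF i]] unfolding real_norm_def
    by (intro t.integral_bounded) auto
  have "(\<lambda>k. \<integral>\<omega>. ?f k \<omega> \<partial>trajectory_law eta \<gamma> z) sums (\<integral>\<omega>. (\<Sum>k. ?f k \<omega>) \<partial>trajectory_law eta \<gamma> z)"
  proof (rule sums_integral[OF i])
    show "AE \<omega> in trajectory_law eta \<gamma> z. summable (\<lambda>k. norm (?f k \<omega>))"
      using b by (intro AE_I2 summable_comparison_test'[OF s]) auto
    show "summable (\<lambda>k. \<integral>\<omega>. norm (?f k \<omega>) \<partial>trajectory_law eta \<gamma> z)"
      using ni by (intro summable_comparison_test'[OF s]) auto
  qed
  then show ?thesis by (simp add: discounted_cost_def expected_def)
qed

text \<open>The excess of the cost of a policy over the fixed point is the discounted sum of the expected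
  Bellman gaps along the trajectory. The gaps are nonnegative for every policy, and they vanish for
  a policy that always chooses a minimizer.\<close>

lemma expected_bellman_limit_telescope:
  assumes z: "z \<in> prob_measures" and \<gamma>: "\<gamma> \<in> policies"
  shows "(\<lambda>n. \<Sum>k<n. \<beta> ^ k * (expected \<gamma> z k (\<lambda>p. action_value bellman_limit (fst p) (snd p))
            - expected \<gamma> z k (\<lambda>p. bellman_limit (fst p))))
         \<longlonglongrightarrow> discounted_cost eta c \<beta> z \<gamma> - bellman_limit z"
proof -
  note w = weakly_continuous_measurable[OF bellman_limit_weakly_continuous] bellman_limit_bounded
  define a where "a k = expected \<gamma> z k (\<lambda>p. bellman_limit (fst p))" for k
  have av: "expected \<gamma> z k (\<lambda>p. action_value bellman_limit (fst p) (snd p)) = expected \<gamma> z k stage_cost + \<beta> * a (Suc k)" for k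
  proof -
    have "\<forall>p\<in>space stages. \<bar>\<integral>\<pi>. bellman_limit \<pi> \<partial>eta (fst p) (snd p)\<bar> \<le> bound"
      using eta_integral_bounded[OF _ w] by (auto simp: space_pair_measure)
    from trajectory_component(3)[OF z \<gamma> eta_integral_measurable[OF w(1)] this]
      trajectory_component(3)[OF z \<gamma> cost_measurable stage_cost_bounded]
    show ?thesis unfolding a_def expected_Suc_belief[OF z \<gamma> w] unfolding action_value_def expected_def by simp
  qed
  have eq: "(\<Sum>k<n. \<beta> ^ k * (expected \<gamma> z k (\<lambda>p. action_value bellman_limit (fst p) (snd p)) - a k))
      = (\<Sum>k<n. \<beta> ^ k * expected \<gamma> z k stage_cost) + \<beta> ^ n * a n - a 0" for n
    by (induction n) (simp_all add: av algebra_simps)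
  have a_bound: "\<bar>a n\<bar> \<le> bound" for n
    unfolding a_def using w(2)
    by (intro expected_bounded[OF z \<gamma> measurable_fst_stages[OF w(1)]]) (auto simp: bounded_on_beliefs_def space_pair_measure)
  have "(\<lambda>n. \<beta> ^ n * a n) \<longlonglongrightarrow> 0"
  proof (rule Lim_null_comparison[OF _ rate_tendsto])
    show "\<forall>\<^sub>F n in sequentially. norm (\<beta> ^ n * a n) \<le> \<beta> ^ n * bound"
      using a_bound \<beta> by (intro always_eventually) (simp add: abs_mult mult_left_mono del: times_divide_eq_right)
  qed
  from tendsto_diff[OF tendsto_add[OF discounted_cost_sums[OF z \<gamma>, unfolded sums_def] this] tendsto_const[of "a 0"]]
  show ?thesis unfolding eq[symmetric] using expected_0_belief[OF z \<gamma> w] by (simp add: a_def)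
qed

lemma bellman_limit_le_discounted_cost:
  assumes z: "z \<in> prob_measures" and \<gamma>: "\<gamma> \<in> policies"
  shows "bellman_limit z \<le> discounted_cost eta c \<beta> z \<gamma>"
proof -
  note w = bellman_limit_weakly_continuous bellman_limit_bounded
  note wm = weakly_continuous_measurable[OF w(1)]
  have avm: "(\<lambda>p. action_value bellman_limit (fst p) (snd p)) \<in> borel_measurable stages"
    unfolding action_value_def using cost_measurable eta_integral_measurable[OF wm] by simp
  have "expected \<gamma> z k (\<lambda>p. bellman_limit (fst p)) \<le> expected \<gamma> z k (\<lambda>p. action_value bellman_limit (fst p) (snd p))" for k
    unfolding expected_def
  proof (rule integral_mono)
    have b: "\<forall>p\<in>space stages. \<bar>bellman_limit (fst p)\<bar> \<le> bound"
      using w(2) by (auto simp: bounded_on_beliefs_def space_pair_measure)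
    have b': "\<forall>p\<in>space stages. \<bar>action_value bellman_limit (fst p) (snd p)\<bar> \<le> C + \<beta> * bound"
      using action_value_bounded[OF wm w(2)] by (auto simp: space_pair_measure)
    note t = trajectory_component[OF z \<gamma> measurable_fst_stages[OF wm] b]
    show "integrable (trajectory_law eta \<gamma> z) (\<lambda>\<omega>. bellman_limit (fst (\<omega> k)))" by (rule t(3))
    show "integrable (trajectory_law eta \<gamma> z) (\<lambda>\<omega>. action_value bellman_limit (fst (\<omega> k)) (snd (\<omega> k)))"
      by (rule trajectory_component(3)[OF z \<gamma> avm b'])
    fix \<omega> assume "\<omega> \<in> space (trajectory_law eta \<gamma> z)"
    from t(2)[OF this, of k] have "fst (\<omega> k) \<in> prob_measures" by (auto simp: space_pair_measure)
    then show "bellman_limit (fst (\<omega> k)) \<le> action_value bellman_limit (fst (\<omega> k)) (snd (\<omega> k))"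
      using bellman_le[OF w, of "fst (\<omega> k)"] bellman_limit_fixed_point[of "fst (\<omega> k)"] by metis
  qed
  then have "0 \<le> (\<Sum>k<n. \<beta> ^ k * (expected \<gamma> z k (\<lambda>p. action_value bellman_limit (fst p) (snd p))
            - expected \<gamma> z k (\<lambda>p. bellman_limit (fst p))))" for n
    using \<beta> by (intro sum_nonneg mult_nonneg_nonneg) auto
  with LIMSEQ_le_const[OF expected_bellman_limit_telescope[OF z \<gamma>]] show ?thesis by force
qed

lemma optimal_policy_exists:
  obtains \<gamma> where "\<gamma> \<in> policies" "\<And>z. z \<in> prob_measures \<Longrightarrow> discounted_cost eta c \<beta> z \<gamma> = bellman_limit z"
proof -
  note w = bellman_limit_weakly_continuous bellman_limit_bounded
  note wm = weakly_continuous_measurable[OF w(1)]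
  have avm: "(\<lambda>p. action_value bellman_limit (fst p) (snd p)) \<in> borel_measurable stages"
    unfolding action_value_def using cost_measurable eta_integral_measurable[OF wm] by simp
  have "\<exists>s \<in> prob_algebra borel \<rightarrow>\<^sub>M borel. \<forall>\<pi> \<in> prob_measures. \<forall>u.
      action_value bellman_limit \<pi> (s \<pi>) \<le> action_value bellman_limit \<pi> u"
  proof (rule measurable_argmin[OF _ _ compact_actions])
    fix u
    have "(\<lambda>\<pi>. (\<pi>, u)) \<in> prob_algebra borel \<rightarrow>\<^sub>M stages" by simp
    from measurable_compose[OF this avm]
    show "(\<lambda>\<pi>. action_value bellman_limit \<pi> u) \<in> borel_measurable (prob_algebra borel)" by simp
  qed (rule action_value_continuous[OF w])
  then obtain s where s: "s \<in> prob_algebra borel \<rightarrow>\<^sub>M borel"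
    "\<And>\<pi> u. \<pi> \<in> prob_measures \<Longrightarrow> action_value bellman_limit \<pi> (s \<pi>) \<le> action_value bellman_limit \<pi> u" by blast
  have opt: "action_value bellman_limit \<pi> (s \<pi>) = bellman_limit \<pi>" if "\<pi> \<in> prob_measures" for \<pi>
    using s(2)[OF that] bellman_le[OF w that] bellman_limit_fixed_point[OF that] bellman_attained[OF w that]
    by (metis order_antisym)
  define \<gamma> :: "('x, 'u) policy" where "\<gamma> = (\<lambda>k h. s (fst h k))"
  have \<gamma>: "\<gamma> \<in> policies"
    unfolding policies_def \<gamma>_def
  proof (intro CollectI allI)
    fix k :: nat
    have "(\<lambda>h. fst h k) \<in> PiM {..k} (\<lambda>_. prob_algebra borel) \<Otimes>\<^sub>M PiM {..<k} (\<lambda>_. borel) \<rightarrow>\<^sub>M prob_algebra borel"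
      by (rule measurable_compose[OF measurable_fst measurable_component_singleton]) simp
    from measurable_compose[OF this s(1)]
    show "(\<lambda>h. s (fst h k)) \<in> PiM {..k} (\<lambda>_. prob_algebra borel) \<Otimes>\<^sub>M PiM {..<k} (\<lambda>_. borel) \<rightarrow>\<^sub>M borel" .
  qed
  have "discounted_cost eta c \<beta> z \<gamma> = bellman_limit z" if z: "z \<in> prob_measures" for z
  proof -
    have "expected \<gamma> z k (\<lambda>p. action_value bellman_limit (fst p) (snd p)) = expected \<gamma> z k (\<lambda>p. bellman_limit (fst p))" for k
    proof -
      have b: "\<forall>p\<in>space stages. \<bar>bellman_limit (fst p)\<bar> \<le> bound"
        using w(2) by (auto simp: bounded_on_beliefs_def space_pair_measure)
      have b': "\<forall>p\<in>space stages. \<bar>action_value bellman_limit (fst p) (snd p)\<bar> \<le> C + \<beta> * bound"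
        using action_value_bounded[OF wm w(2)] by (auto simp: space_pair_measure)
      have "(\<integral>p. action_value bellman_limit (fst p) (snd p) \<partial>next_stage eta \<gamma> z k \<omega>)
          = (\<integral>p. bellman_limit (fst p) \<partial>next_stage eta \<gamma> z k \<omega>)"
        if "\<omega> \<in> space (history_law \<gamma> z k)" for \<omega>
      proof -
        have \<omega>: "\<omega> \<in> space (PiM {0..<k} (\<lambda>_. stages))" using that by (simp add: space_history_law[OF z \<gamma>])
        have "sets (next_belief eta z k \<omega>) = sets (prob_algebra borel)"
          using measurable_space[OF next_belief_measurable[OF z] \<omega>] by (simp add: space_prob_algebra[of "prob_algebra borel"])
        then have sp: "space (next_belief eta z k \<omega>) = prob_measures" by (rule sets_eq_imp_space_eq)
        show ?thesis
          unfolding integral_next_stage[OF z \<gamma> avm \<omega>] integral_next_stage[OF z \<gamma> measurable_fst_stages[OF wm] \<omega>]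
          by (rule Bochner_Integration.integral_cong[OF refl]) (simp add: sp \<gamma>_def opt)
      qed
      then show ?thesis
        unfolding expected_next_stage[OF z \<gamma> avm b'] expected_next_stage[OF z \<gamma> measurable_fst_stages[OF wm] b]
        by (rule Bochner_Integration.integral_cong[OF refl])
    qed
    with expected_bellman_limit_telescope[OF z \<gamma>]
    have "(\<lambda>n::nat. 0) \<longlonglongrightarrow> discounted_cost eta c \<beta> z \<gamma> - bellman_limit z" by simp
    then show ?thesis by (simp add: LIMSEQ_const_iff)
  qed
  with \<gamma> show thesis by (rule that)
qed

lemma value_function_eq:
  assumes z: "z \<in> prob_measures"
  shows "value_function eta c \<beta> z = bellman_limit z"
proof -
  obtain \<gamma> where \<gamma>: "\<gamma> \<in> policies" "discounted_cost eta c \<beta> z \<gamma> = bellman_limit z"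
    using optimal_policy_exists z by metis
  show ?thesis
    unfolding value_function_def \<gamma>(2)[symmetric]
    using bellman_limit_le_discounted_cost[OF z] \<gamma> by (intro cINF_eq_minimum) auto
qed

end

section \<open>Total variation, the Dobrushin coefficient and the Wasserstein metric\<close>

text \<open>Subtracting the midrange of a function halves the bound on its absolute value compared with its
  oscillation; every factor \<open>1 / 2\<close> in the final Lipschitz constant stems from this.\<close>

lemma oscillation_center:
  fixes f :: "'a \<Rightarrow> real"
  assumes "\<And>x y. f x - f y \<le> d"
  shows "\<exists>m. \<forall>x. \<bar>f x - m\<bar> \<le> d / 2"
proof -
  have bd: "bdd_above (range f)" "bdd_below (range f)"
  proof -
    have "f x \<le> f undefined + d" "f undefined - d \<le> f x" for x
      using assms[of x undefined] assms[of undefined x] by linarith+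
    then show "bdd_above (range f)" "bdd_below (range f)" by (auto intro!: bdd_aboveI2 bdd_belowI2)
  qed
  let ?a = "INF x. f x" and ?b = "SUP x. f x"
  have le: "?a \<le> f x" "f x \<le> ?b" for x
    using bd by (auto intro: cINF_lower cSUP_upper)
  have "?b - d \<le> f y" for y
  proof -
    have "f x \<le> f y + d" for x using assms[of x y] by linarith
    then have "?b \<le> f y + d" by (intro cSUP_least) auto
    then show ?thesis by linarith
  qed
  then have "?b - d \<le> ?a" by (intro cINF_greatest) auto
  then have "\<bar>f x - (?a + ?b) / 2\<bar> \<le> d / 2" for x using le[of x] by (simp add: abs_le_iff field_simps)
  then show ?thesis by blast
qed

lemma integral_prob_shift:
  fixes f :: "'a::topological_space \<Rightarrow> real"
  assumes "\<mu> \<in> prob_measures" "f \<in> borel_measurable borel" "\<And>x. \<bar>f x - m\<bar> \<le> B"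
  shows "(\<integral>x. f x - m \<partial>\<mu>) = (\<integral>x. f x \<partial>\<mu>) - m"
proof -
  interpret prob_space \<mu> using assms(1) by (rule prob_measuresD)
  have b: "\<bar>f x\<bar> \<le> B + \<bar>m\<bar>" for x using assms(3)[of x] by linarith
  from integrable_prob_bounded[OF assms(1,2) b] show ?thesis by (simp add: prob_space)
qed

lemma
  fixes f :: "'a::topological_space \<Rightarrow> real"
  assumes \<mu>: "\<mu> \<in> prob_measures" "\<nu> \<in> prob_measures"
    and f: "f \<in> borel_measurable borel" "\<And>x y. f x - f y \<le> d"
  shows oscillation_tv_bound: "\<bar>(\<integral>x. f x \<partial>\<mu>) - (\<integral>x. f x \<partial>\<nu>)\<bar> \<le> d / 2 * tv_dist \<mu> \<nu>"
    and oscillation_bound: "\<bar>(\<integral>x. f x \<partial>\<mu>) - (\<integral>x. f x \<partial>\<nu>)\<bar> \<le> d"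
proof -
  obtain m where m: "\<And>x. \<bar>f x - m\<bar> \<le> d / 2" using oscillation_center[of f d, OF f(2)] by blast
  have fm: "(\<lambda>x. f x - m) \<in> borel_measurable borel" using f(1) by simp
  have eq: "(\<integral>x. f x - m \<partial>\<mu>) - (\<integral>x. f x - m \<partial>\<nu>) = (\<integral>x. f x \<partial>\<mu>) - (\<integral>x. f x \<partial>\<nu>)"
    unfolding integral_prob_shift[OF \<mu>(1) f(1) m] integral_prob_shift[OF \<mu>(2) f(1) m] by linarith
  show "\<bar>(\<integral>x. f x \<partial>\<mu>) - (\<integral>x. f x \<partial>\<nu>)\<bar> \<le> d / 2 * tv_dist \<mu> \<nu>"
    using tv_dist_bound_scaled[OF \<mu> fm m] by (simp only: eq)
  show "\<bar>(\<integral>x. f x \<partial>\<mu>) - (\<integral>x. f x \<partial>\<nu>)\<bar> \<le> d"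
    using integral_prob_le[OF \<mu>(1) fm m] integral_prob_le[OF \<mu>(2) fm m] eq by linarith
qed

text \<open>Two laws differ on a function with values in \<open>[-1, 1]\<close> by at most the sum of the
  differences over its level sets (after rounding), which is \<open>2\<close> minus twice the sum of the minima.\<close>

lemma tv_dist_le_dobrushin:
  fixes K :: "'a \<Rightarrow> 'b::topological_space measure"
  assumes K: "\<And>x. K x \<in> prob_measures"
  shows "tv_dist (K x) (K y) \<le> 2 - 2 * dobrushin K"
proof (rule tv_dist_least, rule field_le_epsilon)
  fix f :: "'b \<Rightarrow> real" and e :: real
  assume f: "f \<in> borel_measurable borel" "\<And>x. \<bar>f x\<bar> \<le> 1" and e: "0 < e"
  obtain N :: nat where N: "2 / e < real N" using reals_Archimedean2 by blast
  have "0 < 2 / e" using e by simp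
  with N have N0: "0 < real N" by linarith
  define s where "s b = \<lfloor>real N * f b\<rfloor>" for b
  have s_range: "s b \<in> {- int N..int N}" for b
  proof -
    have "\<bar>real N * f b\<bar> \<le> real N * 1" unfolding abs_mult using f(2)[of b] by (intro mult_mono) auto
    then have "- real N \<le> real N * f b" "real N * f b \<le> real N" by linarith+
    then show ?thesis unfolding s_def by (auto simp: le_floor_iff floor_le_iff)
  qed
  have sb: "\<bar>real_of_int (s b)\<bar> \<le> real N" for b
  proof -
    have "- int N \<le> s b" "s b \<le> int N" using s_range[of b] by auto
    then show ?thesis by linarith
  qed
  have fs: "\<bar>f b - s b / N\<bar> \<le> 1 / N" for b
  proof -
    have "\<bar>real N * f b - s b\<bar> \<le> 1" unfolding s_def by linarith
    then show ?thesis using N0 by (simp add: abs_le_iff field_simps)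
  qed
  have "range s \<subseteq> {- int N..int N}" using s_range by blast
  then have fin: "finite (range s)" by (rule finite_subset) simp
  have sm: "s -` {k} \<in> sets borel" for k
  proof -
    have "s \<in> borel \<rightarrow>\<^sub>M count_space UNIV" unfolding s_def using f(1) by measurable
    from measurable_sets[OF this, of "{k}"] show ?thesis by simp
  qed
  let ?A = "(\<lambda>k. s -` {k}) ` range s"
  have inj: "inj_on (\<lambda>k. s -` {k}) (range s)" by (auto simp: inj_on_def)
  have part: "partition_on UNIV ?A" by (auto simp: partition_on_def disjoint_def)
  have I: "(\<integral>b. s b / N \<partial>M) = (\<Sum>k\<in>range s. (k / N) * measure M (s -` {k}))" and one: "(\<Sum>k\<in>range s. measure M (s -` {k})) = 1"
    if M: "M \<in> prob_measures" for M
  proof -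
    interpret M: prob_space M using M by (rule prob_measuresD)
    have sM: "s -` {k} \<in> sets M" for k using sm prob_measuresD(2)[OF M] by simp
    have sum: "(\<Sum>k\<in>range s. g k * indicator (s -` {k}) b) = g (s b)" for g :: "int \<Rightarrow> real" and b
    proof -
      have "(\<Sum>k\<in>range s. g k * indicator (s -` {k}) b) = (\<Sum>k\<in>range s. if k = s b then g k else 0)"
        by (intro sum.cong) (auto simp: indicator_def)
      then show ?thesis using fin by simp
    qed
    have *: "(\<integral>b. g (s b) \<partial>M) = (\<Sum>k\<in>range s. g k * measure M (s -` {k}))" for g :: "int \<Rightarrow> real"
    proof -
      have "(\<integral>b. g (s b) \<partial>M) = (\<integral>b. (\<Sum>k\<in>range s. g k * indicator (s -` {k}) b) \<partial>M)" by (simp add: sum)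
      also have "\<dots> = (\<Sum>k\<in>range s. \<integral>b. g k * indicator (s -` {k}) b \<partial>M)"
        using sM by (intro Bochner_Integration.integral_sum) (auto simp: M.emeasure_eq_measure)
      finally show ?thesis using sM by simp
    qed
    show "(\<integral>b. s b / N \<partial>M) = (\<Sum>k\<in>range s. (k / N) * measure M (s -` {k}))" using *[of "\<lambda>k. k / N"] .
    show "(\<Sum>k\<in>range s. measure M (s -` {k})) = 1" using *[of "\<lambda>_. 1"] by (simp add: M.prob_space)
  qed
  have close: "\<bar>(\<integral>b. f b \<partial>M) - (\<integral>b. s b / N \<partial>M)\<bar> \<le> 1 / N" if M: "M \<in> prob_measures" for M
  proof -
    have sm': "(\<lambda>b. s b / N) \<in> borel_measurable borel" unfolding s_def using f(1) by measurable
    have sb': "\<bar>s b / N\<bar> \<le> 1" for b using sb[of b] N0 by simp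
    have "(\<integral>b. f b \<partial>M) - (\<integral>b. s b / N \<partial>M) = (\<integral>b. f b - s b / N \<partial>M)"
      using integrable_prob_bounded[OF M f] integrable_prob_bounded[OF M sm' sb'] by simp
    also have "\<bar>\<dots>\<bar> \<le> 1 / N" using f(1) sm' fs by (intro integral_prob_le[OF M]) auto
    finally show ?thesis .
  qed
  let ?m = "\<lambda>z k. measure (K z) (s -` {k})"
  have "(\<Sum>k\<in>range s. (k / N) * ?m x k) - (\<Sum>k\<in>range s. (k / N) * ?m y k) = (\<Sum>k\<in>range s. (k / N) * (?m x k - ?m y k))"
    by (simp add: sum_subtractf right_diff_distrib)
  also have "\<bar>\<dots>\<bar> \<le> (\<Sum>k\<in>range s. \<bar>?m x k - ?m y k\<bar>)"
  proof (rule sum_abs[THEN order_trans], rule sum_mono)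
    fix k assume "k \<in> range s"
    then have "\<bar>k / N\<bar> \<le> 1" using sb N0 by auto
    then show "\<bar>(k / N) * (?m x k - ?m y k)\<bar> \<le> \<bar>?m x k - ?m y k\<bar>"
      unfolding abs_mult by (intro mult_left_le_one_le) auto
  qed
  also have "\<dots> = (\<Sum>k\<in>range s. ?m x k + ?m y k - 2 * min (?m x k) (?m y k))"
    by (intro sum.cong) auto
  also have "\<dots> = 2 - 2 * (\<Sum>k\<in>range s. min (?m x k) (?m y k))"
    by (simp add: sum_subtractf sum.distrib one[OF K] sum_distrib_left[symmetric])
  also have "(\<Sum>k\<in>range s. min (?m x k) (?m y k)) = (\<Sum>a\<in>?A. min (measure (K x) a) (measure (K y) a))"
    by (simp add: sum.reindex[OF inj])
  finally have 1: "\<bar>(\<Sum>k\<in>range s. (k / N) * ?m x k) - (\<Sum>k\<in>range s. (k / N) * ?m y k)\<bar>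
      \<le> 2 - 2 * (\<Sum>a\<in>?A. min (measure (K x) a) (measure (K y) a))" .
  have "dobrushin K \<le> (\<Sum>a\<in>?A. min (measure (K x) a) (measure (K y) a))"
    unfolding dobrushin_def
  proof (rule cInf_lower)
    show "(\<Sum>a\<in>?A. min (measure (K x) a) (measure (K y) a)) \<in> {(\<Sum>A\<in>\<A>. min (measure (K x) A) (measure (K y) A)) | x y \<A>.
     finite \<A> \<and> \<A> \<subseteq> sets borel \<and> partition_on UNIV \<A>}"
      using part sm fin by (intro CollectI exI[of _ x] exI[of _ y] exI[of _ ?A]) auto
  qed (auto intro!: bdd_belowI[of _ 0] sum_nonneg)
  moreover have "2 * (1 / N) \<le> e"
    using N e N0 by (simp add: field_simps)
  ultimately show "\<bar>(\<integral>b. f b \<partial>K x) - (\<integral>b. f b \<partial>K y)\<bar> \<le> 2 - 2 * dobrushin K + e"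
    using 1 close[OF K[of x]] close[OF K[of y]] unfolding I[OF K] by linarith
qed

lemma wasserstein1_commute: "wasserstein1 \<mu> \<nu> = wasserstein1 \<nu> \<mu>"
  by (simp add: wasserstein1_def abs_minus_commute)

context
  assumes compact: "compact (UNIV :: 'x::metric_space set)"
begin

lemma dist_le_diameter: "dist (x :: 'x) y \<le> diameter (UNIV :: 'x set)"
  using compact by (intro diameter_bounded_bound compact_imp_bounded) auto

lemma Lipschitz1_oscillation:
  fixes f :: "'x \<Rightarrow> real"
  assumes "1-lipschitz_on UNIV f"
  shows "f x - f y \<le> diameter (UNIV :: 'x set)" "f \<in> borel_measurable borel"
proof -
  have "\<bar>f x - f y\<bar> \<le> dist x y" using lipschitz_onD[OF assms, of x y] by (simp add: dist_real_def)
  then show "f x - f y \<le> diameter (UNIV :: 'x set)" using dist_le_diameter[of x y] by linarith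
  show "f \<in> borel_measurable borel"
    using lipschitz_on_continuous_on[OF assms] by (rule borel_measurable_continuous_UNIV)
qed

lemma
  fixes \<mu> \<nu> :: "'x measure"
  assumes \<mu>: "\<mu> \<in> prob_measures" "\<nu> \<in> prob_measures"
  shows wasserstein1_le_diameter: "wasserstein1 \<mu> \<nu> \<le> diameter (UNIV :: 'x set)"
    and wasserstein1_upper: "1-lipschitz_on UNIV f \<Longrightarrow> \<bar>(\<integral>x. f x \<partial>\<mu>) - (\<integral>x. f x \<partial>\<nu>)\<bar> \<le> wasserstein1 \<mu> \<nu>"
    and wasserstein1_approx: "0 < e \<Longrightarrow> \<exists>f. 1-lipschitz_on UNIV f \<and>
      wasserstein1 \<mu> \<nu> - e < (\<integral>x. f x \<partial>\<mu>) - (\<integral>x. f x \<partial>\<nu>)"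
proof -
  let ?L = "{f :: 'x \<Rightarrow> real. 1-lipschitz_on UNIV f}" and ?D = "\<lambda>f. \<bar>(\<integral>x. f x \<partial>\<mu>) - (\<integral>x. f x \<partial>\<nu>)\<bar>"
  have "(\<lambda>_. 0) \<in> ?L" by (auto intro: lipschitz_onI)
  then have ne: "?L \<noteq> {}" by blast
  have le: "?D f \<le> diameter (UNIV :: 'x set)" if "f \<in> ?L" for f
    using that Lipschitz1_oscillation[of f] by (intro oscillation_bound[OF \<mu>]) auto
  have bdd: "bdd_above (?D ` ?L)" using le by (rule bdd_aboveI2)
  show "wasserstein1 \<mu> \<nu> \<le> diameter (UNIV :: 'x set)"
    unfolding wasserstein1_def using ne le by (rule cSUP_least)
  show "?D f \<le> wasserstein1 \<mu> \<nu>" if "1-lipschitz_on UNIV f"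
    unfolding wasserstein1_def using that bdd by (intro cSUP_upper) auto
  assume "0 < e"
  then have "wasserstein1 \<mu> \<nu> - e < (SUP f\<in>?L. ?D f)" by (simp add: wasserstein1_def)
  then obtain f where f: "f \<in> ?L" "wasserstein1 \<mu> \<nu> - e < ?D f"
    using less_cSUP_iff[OF ne bdd] by blast
  show "\<exists>f. 1-lipschitz_on UNIV f \<and> wasserstein1 \<mu> \<nu> - e < (\<integral>x. f x \<partial>\<mu>) - (\<integral>x. f x \<partial>\<nu>)"
  proof (cases "0 \<le> (\<integral>x. f x \<partial>\<mu>) - (\<integral>x. f x \<partial>\<nu>)")
    case True with f show ?thesis by auto
  next
    case False
    have "1-lipschitz_on UNIV (\<lambda>x. - f x)" using f(1) by (simp add: lipschitz_on_def dist_real_def abs_minus_commute)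
    with False f(2) show ?thesis by (intro exI[of _ "\<lambda>x. - f x"]) auto
  qed
qed

lemma wasserstein1_nonneg:
  fixes \<mu> \<nu> :: "'x measure"
  assumes "\<mu> \<in> prob_measures" "\<nu> \<in> prob_measures"
  shows "0 \<le> wasserstein1 \<mu> \<nu>"
proof -
  have "1-lipschitz_on UNIV (\<lambda>_ :: 'x. 0 :: real)" by (rule lipschitz_onI) auto
  from wasserstein1_upper[OF assms this] show ?thesis by simp
qed

lemma wasserstein1_Lipschitz:
  fixes f :: "'x \<Rightarrow> real"
  assumes \<mu>: "\<mu> \<in> prob_measures" "\<nu> \<in> prob_measures" and K: "0 \<le> K" "\<And>x y. \<bar>f x - f y\<bar> \<le> K * dist x y"
  shows "\<bar>(\<integral>x. f x \<partial>\<mu>) - (\<integral>x. f x \<partial>\<nu>)\<bar> \<le> K * wasserstein1 \<mu> \<nu>"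
proof (cases "K = 0")
  case True
  then have "f = (\<lambda>_. f undefined)" using K(2) by auto
  then obtain a where "f = (\<lambda>_. a)" by blast
  moreover have "prob_space \<mu>" "prob_space \<nu>" using \<mu> by (auto dest: prob_measuresD)
  ultimately show ?thesis using True by (simp add: prob_space.prob_space)
next
  case False
  with K(1) have K0: "0 < K" by simp
  have "1-lipschitz_on UNIV (\<lambda>x. f x / K)"
    using K(2) K0 by (intro lipschitz_onI) (auto simp: dist_real_def diff_divide_distrib[symmetric] divide_le_eq mult.commute)
  from wasserstein1_upper[OF \<mu> this] show ?thesis
    using K0 by (simp add: diff_divide_distrib[symmetric] divide_le_eq mult.commute)
qed

end

section \<open>Countably many functions suffice for the Wasserstein metric\<close>

text \<open>Minima of finitely many cones interpolate a Lipschitz function from (nearly) its values on a finite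
  net; with rational heights and apices in a dense sequence they form a countable uniformly dense
  class.\<close>

fun cones :: "rat \<times> nat \<Rightarrow> (rat \<times> nat) list \<Rightarrow> 'a::{metric_space, second_countable_topology} \<Rightarrow> real" where
  "cones (q, i) [] x = real_of_rat q + dist x (dense_seq i)"
| "cones p ((q, i) # l) x = min (real_of_rat q + dist x (dense_seq i)) (cones p l x)"

lemma cones_le: "(q, i) \<in> set (p # l) \<Longrightarrow> cones p l x \<le> real_of_rat q + dist x (dense_seq i)"
  by (induction p l x rule: cones.induct) auto

lemma cones_attained: "\<exists>(q, i)\<in>set (p # l). cones p l x = real_of_rat q + dist x (dense_seq i)"
  by (induction p l x rule: cones.induct) (auto simp: min_def)

lemma cones_Lipschitz: "1-lipschitz_on UNIV (cones p l :: 'a::{metric_space, second_countable_topology} \<Rightarrow> real)"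
proof (rule lipschitz_onI)
  have le: "cones p l x \<le> cones p l y + dist x y" for x y :: 'a
  proof -
    obtain q i where qi: "(q, i) \<in> set (p # l)" "cones p l y = real_of_rat q + dist y (dense_seq i)"
      using cones_attained[of p l y] by auto
    have "dist x (dense_seq i) \<le> dist x y + dist y (dense_seq i)" by (rule dist_triangle)
    with cones_le[OF qi(1), of x] qi(2) show ?thesis by linarith
  qed
  fix x y :: 'a
  show "dist (cones p l x) (cones p l y) \<le> 1 * dist x y"
    using le[of x y] le[of y x] by (simp add: dist_real_def dist_commute abs_le_iff)
qed simp

lemma cones_approximate:
  fixes f :: "'x::{metric_space, second_countable_topology} \<Rightarrow> real"
  assumes compact: "compact (UNIV :: 'x set)" and f: "1-lipschitz_on UNIV f" and e: "0 < e"
  shows "\<exists>p l. \<forall>x. \<bar>f x - cones p l x\<bar> \<le> e"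
proof -
  have fd: "\<bar>f x - f y\<bar> \<le> dist x y" for x y using lipschitz_onD[OF f, of x y] by (simp add: dist_real_def)
  have "\<exists>q. f (dense_seq i) < real_of_rat q \<and> real_of_rat q < f (dense_seq i) + e / 2" for i
    using of_rat_dense[of "f (dense_seq i)" "f (dense_seq i) + e / 2"] e by auto
  then obtain q where q: "\<And>i. f (dense_seq i) < real_of_rat (q i)" "\<And>i. real_of_rat (q i) < f (dense_seq i) + e / 2"
    by metis
  have "UNIV \<subseteq> (\<Union>i. ball (dense_seq i :: 'x) (e / 4))"
    using dense_seq[of "e / 4"] e by fastforce
  then obtain I where I: "finite I" "UNIV \<subseteq> (\<Union>i\<in>I. ball (dense_seq i :: 'x) (e / 4))"
    using compactE_image[OF compact, of UNIV "\<lambda>i. ball (dense_seq i) (e / 4)"] by auto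
  obtain l where l: "set l = I" using finite_list[OF I(1)] by blast
  have "I \<noteq> {}" using I(2) by auto
  then obtain j l' where jl: "l = j # l'" using l by (cases l) auto
  let ?p = "(q j, j)" and ?l = "map (\<lambda>i. (q i, i)) l'"
  have set: "set (?p # ?l) = (\<lambda>i. (q i, i)) ` I" using l by (auto simp: jl)
  have "\<bar>f x - cones ?p ?l x\<bar> \<le> e" for x
  proof -
    obtain i where "(q i, i) \<in> set (?p # ?l)" "cones ?p ?l x = real_of_rat (q i) + dist x (dense_seq i)"
      using cones_attained[of ?p ?l x] unfolding set by auto
    then have 1: "f x \<le> cones ?p ?l x" using q(1)[of i] fd[of x "dense_seq i"] by linarith
    have "x \<in> (\<Union>i\<in>I. ball (dense_seq i) (e / 4))" using I(2) by blast
    then obtain i where i: "i \<in> I" "dist x (dense_seq i) < e / 4" by (auto simp: dist_commute)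
    then have "(q i, i) \<in> set (?p # ?l)" unfolding set by blast
    from cones_le[OF this, of x] have "cones ?p ?l x \<le> f x + e"
      using q(2)[of i] fd[of x "dense_seq i"] i(2) by linarith
    with 1 show ?thesis by linarith
  qed
  then show ?thesis by blast
qed

text \<open>A countable family makes the Wasserstein distance of two measurably varying measures measurable.
  The functions are shifted to be bounded by half the diameter.\<close>

lemma wasserstein1_countable:
  assumes compact: "compact (UNIV :: 'x::{metric_space, second_countable_topology} set)"
  obtains h :: "nat \<Rightarrow> 'x::{metric_space, second_countable_topology} \<Rightarrow> real" where
    "\<And>j. h j \<in> borel_measurable borel" "\<And>j x. \<bar>h j x\<bar> \<le> diameter (UNIV :: 'x::{metric_space, second_countable_topology} set) / 2"
    "\<And>j \<mu> \<nu>. \<mu> \<in> prob_measures \<Longrightarrow> \<nu> \<in> prob_measures \<Longrightarrow> (\<integral>x. h j x \<partial>\<mu>) - (\<integral>x. h j x \<partial>\<nu>) \<le> wasserstein1 \<mu> \<nu>"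
    "\<And>\<mu> \<nu> e. \<mu> \<in> prob_measures \<Longrightarrow> \<nu> \<in> prob_measures \<Longrightarrow> 0 < e \<Longrightarrow>
      \<exists>j. wasserstein1 \<mu> \<nu> - e < (\<integral>x. h j x \<partial>\<mu>) - (\<integral>x. h j x \<partial>\<nu>)"
proof -
  define g :: "nat \<Rightarrow> 'x \<Rightarrow> real" where "g j = (case from_nat j of (p, l) \<Rightarrow> cones p l)" for j
  have gL: "1-lipschitz_on UNIV (g j)" for j
    unfolding g_def by (cases "from_nat j :: (rat \<times> nat) \<times> (rat \<times> nat) list") (simp add: cones_Lipschitz)
  have "\<exists>m. \<forall>x. \<bar>g j x - m\<bar> \<le> diameter (UNIV :: 'x set) / 2" for j
    by (rule oscillation_center[of "g j", OF Lipschitz1_oscillation(1)[OF compact gL[of j]]])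
  then obtain m where m: "\<And>j x. \<bar>g j x - m j\<bar> \<le> diameter (UNIV :: 'x set) / 2" by metis
  have gm: "g j \<in> borel_measurable borel" for j using Lipschitz1_oscillation(2)[OF compact gL] .
  have eq: "(\<integral>x. g j x - m j \<partial>\<mu>) - (\<integral>x. g j x - m j \<partial>\<nu>) = (\<integral>x. g j x \<partial>\<mu>) - (\<integral>x. g j x \<partial>\<nu>)"
    if \<mu>: "\<mu> \<in> prob_measures" "\<nu> \<in> prob_measures" for \<mu> \<nu> j
    unfolding integral_prob_shift[OF \<mu>(1) gm m] integral_prob_shift[OF \<mu>(2) gm m] by linarith
  show thesis
  proof (rule that[of "\<lambda>j x. g j x - m j"])
    show "(\<lambda>x. g j x - m j) \<in> borel_measurable borel" for j using gm[of j] by simp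
    show "\<bar>g j x - m j\<bar> \<le> diameter (UNIV :: 'x set) / 2" for j x by (rule m)
    fix \<mu> \<nu> :: "'x measure" assume \<mu>: "\<mu> \<in> prob_measures" "\<nu> \<in> prob_measures"
    show "(\<integral>x. g j x - m j \<partial>\<mu>) - (\<integral>x. g j x - m j \<partial>\<nu>) \<le> wasserstein1 \<mu> \<nu>" for j
      unfolding eq[OF \<mu>] using wasserstein1_upper[OF compact \<mu> gL[of j]] by linarith
    fix e :: real assume "0 < e"
    then have e: "0 < e / 2" "0 < e / 4" by auto
    obtain f where f: "1-lipschitz_on UNIV f" "wasserstein1 \<mu> \<nu> - e / 2 < (\<integral>x. f x \<partial>\<mu>) - (\<integral>x. f x \<partial>\<nu>)"
      using wasserstein1_approx[OF compact \<mu> e(1)] by blast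
    obtain p l where pl: "\<And>x. \<bar>f x - cones p l x\<bar> \<le> e / 4" using cones_approximate[OF compact f(1) e(2)] by blast
    define j where "j = to_nat (p, l)"
    have gj: "g j = cones p l" by (simp add: g_def j_def)
    have fm: "f \<in> borel_measurable borel" using Lipschitz1_oscillation(2)[OF compact f(1)] .
    have close: "\<bar>(\<integral>x. f x \<partial>K) - (\<integral>x. g j x \<partial>K)\<bar> \<le> e / 4" if K: "K \<in> prob_measures" for K
    proof -
      have i: "integrable K h" if h: "1-lipschitz_on UNIV h" for h :: "'x \<Rightarrow> real"
      proof -
        obtain a where a: "\<And>x. \<bar>h x - a\<bar> \<le> diameter (UNIV :: 'x set) / 2"
          using oscillation_center[of h, OF Lipschitz1_oscillation(1)[OF compact h]] by blast
        have "\<bar>h x\<bar> \<le> diameter (UNIV :: 'x set) / 2 + \<bar>a\<bar>" for x using a[of x] by linarith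
        from integrable_prob_bounded[OF K Lipschitz1_oscillation(2)[OF compact h] this] show ?thesis .
      qed
      have "(\<integral>x. f x \<partial>K) - (\<integral>x. g j x \<partial>K) = (\<integral>x. f x - g j x \<partial>K)"
        using i[OF f(1)] i[OF gL] by simp
      also have "\<bar>\<dots>\<bar> \<le> e / 4" using fm gm[of j] pl by (intro integral_prob_le[OF K]) (auto simp: gj)
      finally show ?thesis .
    qed
    show "\<exists>j. wasserstein1 \<mu> \<nu> - e < (\<integral>x. g j x - m j \<partial>\<mu>) - (\<integral>x. g j x - m j \<partial>\<nu>)"
      unfolding eq[OF \<mu>] using f(2) close[OF \<mu>(1)] close[OF \<mu>(2)] by (intro exI[of _ j]) linarith
  qed
qed

section \<open>Lipschitz continuity of the value function\<close>

lemma measurable_argmax_finite: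
  fixes a :: "nat \<Rightarrow> 'a \<Rightarrow> real"
  assumes a: "\<And>j. a j \<in> borel_measurable M"
  shows "\<exists>J \<in> M \<rightarrow>\<^sub>M count_space UNIV. \<forall>y. J y \<le> n \<and> (\<forall>i\<le>n. a i y \<le> a (J y) y)"
proof (induction n)
  case 0
  show ?case by (intro bexI[of _ "\<lambda>_. 0"]) auto
next
  case (Suc n)
  then obtain J where J: "J \<in> M \<rightarrow>\<^sub>M count_space UNIV" "\<And>y. J y \<le> n" "\<And>y i. i \<le> n \<Longrightarrow> a i y \<le> a (J y) y"
    by blast
  have aJ: "(\<lambda>y. a (J y) y) \<in> borel_measurable M"
    by (rule measurable_compose_countable[OF a J(1)])
  let ?J = "\<lambda>y. if a (J y) y < a (Suc n) y then Suc n else J y"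
  have "?J \<in> M \<rightarrow>\<^sub>M count_space UNIV"
    using J(1) aJ a[of "Suc n"] by measurable
  moreover have "\<forall>y. ?J y \<le> Suc n \<and> (\<forall>i\<le>Suc n. a i y \<le> a (?J y) y)"
  proof
    fix y
    have "a i y \<le> a (?J y) y" if "i \<le> Suc n" for i
    proof (cases "i = Suc n")
      case False
      with that have "a i y \<le> a (J y) y" by (intro J(3)) simp
      then show ?thesis by simp
    qed simp
    moreover have "?J y \<le> Suc n" using J(2)[of y] by simp
    ultimately show "?J y \<le> Suc n \<and> (\<forall>i\<le>Suc n. a i y \<le> a (?J y) y)" by (intro conjI allI impI)
  qed
  ultimately show ?case by (intro bexI[of _ ?J])
qed

context pomdp
begin

lemma predict_tv_bound:
  assumes compact: "compact (UNIV :: 'x set)"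
    and \<alpha>: "0 \<le> \<alpha>" "\<And>x x' u. tv_dist (T x u) (T x' u) \<le> \<alpha> * dist x x'"
    and z: "z \<in> prob_measures" "z' \<in> prob_measures"
  shows "tv_dist (predict z u) (predict z' u) \<le> \<alpha> * wasserstein1 z z'"
proof (rule tv_dist_least)
  fix f :: "'x \<Rightarrow> real" assume f: "f \<in> borel_measurable borel" "\<And>x. \<bar>f x\<bar> \<le> 1"
  have "\<bar>(\<integral>y. f y \<partial>T x u) - (\<integral>y. f y \<partial>T x' u)\<bar> \<le> \<alpha> * dist x x'" for x x'
    using tv_dist_bound[OF T_prob T_prob f] \<alpha>(2) by (rule order_trans)
  from wasserstein1_Lipschitz[OF compact z \<alpha>(1) this]
  show "\<bar>(\<integral>x. f x \<partial>predict z u) - (\<integral>x. f x \<partial>predict z' u)\<bar> \<le> \<alpha> * wasserstein1 z z'"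
    by (simp add: integral_predict[OF z(1) f] integral_predict[OF z(2) f])
qed

text \<open>A function of the observation with values in \<open>[-1, 1]\<close>, averaged over the channel, has oscillation at
  most \<open>2 - 2 \<delta>(Q)\<close>.\<close>

lemma obs_law_tv_bound:
  assumes z: "z \<in> prob_measures" "z' \<in> prob_measures"
  shows "tv_dist (obs_law T Q z u) (obs_law T Q z' u)
    \<le> (1 - dobrushin (\<lambda>x. Q x u)) * tv_dist (predict z u) (predict z' u)"
proof (rule tv_dist_least)
  fix f :: "'y \<Rightarrow> real" assume f: "f \<in> borel_measurable borel" "\<And>x. \<bar>f x\<bar> \<le> 1"
  have m: "(\<lambda>x. \<integral>y. f y \<partial>Q x u) \<in> borel_measurable borel"
    using Q_measurable f(1) by (rule measurable_kernel_integral)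
  have osc: "(\<integral>y. f y \<partial>Q x u) - (\<integral>y. f y \<partial>Q x' u) \<le> 2 - 2 * dobrushin (\<lambda>x. Q x u)" for x x'
    using tv_dist_bound[OF Q_prob Q_prob f, of x u x' u] tv_dist_le_dobrushin[of "\<lambda>x. Q x u" x x', OF Q_prob] by linarith
  have "\<bar>(\<integral>x. (\<integral>y. f y \<partial>Q x u) \<partial>predict z u) - (\<integral>x. (\<integral>y. f y \<partial>Q x u) \<partial>predict z' u)\<bar>
      \<le> (2 - 2 * dobrushin (\<lambda>x. Q x u)) / 2 * tv_dist (predict z u) (predict z' u)"
    using m osc by (rule oscillation_tv_bound[OF predict_prob[OF z(1)] predict_prob[OF z(2)]])
  then show "\<bar>(\<integral>y. f y \<partial>obs_law T Q z u) - (\<integral>y. f y \<partial>obs_law T Q z' u)\<bar>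
      \<le> (1 - dobrushin (\<lambda>x. Q x u)) * tv_dist (predict z u) (predict z' u)"
    by (simp add: integral_obs_law[OF z(1) f] integral_obs_law[OF z(2) f] diff_divide_distrib)
qed

text \<open>The Wasserstein metric between the two updated beliefs is the limit of maxima over finitely many
  centered test functions. Selecting the maximizing function measurably in the observation turns
  the integral of such a maximum into a difference of integrals of one bounded function against the
  joint laws of state and observation, up to the error of integrating both updates against the
  observation law of \<open>z\<close>. The first contributes \<open>1\<close> and the second \<open>1 - \<delta>(Q)\<close> to the factor
  \<open>2 - \<delta>(Q)\<close>.\<close>

lemma updated_beliefs_wasserstein_bound:
  assumes compact: "compact (UNIV :: 'x set)"
    and z: "z \<in> prob_measures" "z' \<in> prob_measures"
  shows "(\<lambda>y. wasserstein1 (F z' u y) (F z u y)) \<in> borel_measurable borel"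
    and "(\<integral>y. wasserstein1 (F z' u y) (F z u y) \<partial>obs_law T Q z u)
      \<le> diameter (UNIV :: 'x set) / 2 * (2 - dobrushin (\<lambda>x. Q x u)) * tv_dist (predict z u) (predict z' u)"
proof -
  let ?D = "diameter (UNIV :: 'x set)"
  let ?H = "obs_law T Q z u" and ?H' = "obs_law T Q z' u" and ?\<mu> = "predict z u" and ?\<mu>' = "predict z' u"
  let ?\<delta> = "dobrushin (\<lambda>x. Q x u)"
  note H = obs_law_prob[OF z(1), of u] and H' = obs_law_prob[OF z(2), of u]
  note \<mu> = predict_prob[OF z(1), of u] and \<mu>' = predict_prob[OF z(2), of u]
  note Fz = F_prob[OF z(1), of u] and Fz' = F_prob[OF z(2), of u]
  obtain h :: "nat \<Rightarrow> 'x \<Rightarrow> real" where h: "\<And>j. h j \<in> borel_measurable borel" "\<And>j x. \<bar>h j x\<bar> \<le> ?D / 2"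
    and h_le: "\<And>j \<mu> \<nu>. \<mu> \<in> prob_measures \<Longrightarrow> \<nu> \<in> prob_measures \<Longrightarrow> (\<integral>x. h j x \<partial>\<mu>) - (\<integral>x. h j x \<partial>\<nu>) \<le> wasserstein1 \<mu> \<nu>"
    and h_sup: "\<And>\<mu> \<nu> e. \<mu> \<in> prob_measures \<Longrightarrow> \<nu> \<in> prob_measures \<Longrightarrow> 0 < e \<Longrightarrow>
      \<exists>j. wasserstein1 \<mu> \<nu> - e < (\<integral>x. h j x \<partial>\<mu>) - (\<integral>x. h j x \<partial>\<nu>)"
    using wasserstein1_countable[OF compact] by metis
  define r where "r j y = (\<integral>x. h j x \<partial>F z u y)" for j y
  define r' where "r' j y = (\<integral>x. h j x \<partial>F z' u y)" for j y
  have rm: "r j \<in> borel_measurable borel" "r' j \<in> borel_measurable borel" for j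
    unfolding r_def r'_def using F_measurable[OF z(1)] F_measurable[OF z(2)] h(1)
    by (auto intro: measurable_kernel_integral)
  have rB: "\<bar>r j y\<bar> \<le> ?D / 2" "\<bar>r' j y\<bar> \<le> ?D / 2" for j y
    unfolding r_def r'_def by (intro integral_prob_le Fz Fz' h)+
  define a where "a j y = r' j y - r j y" for j y
  have am: "a j \<in> borel_measurable borel" for j unfolding a_def using rm by simp
  have D0: "0 \<le> ?D" by (rule order_trans[OF zero_le_dist[of undefined undefined] dist_le_diameter[OF compact]])
  have "\<forall>n. \<exists>J. J \<in> borel \<rightarrow>\<^sub>M count_space UNIV \<and> (\<forall>y. J y \<le> n \<and> (\<forall>i\<le>n. a i y \<le> a (J y) y))"
    using measurable_argmax_finite[of a borel, OF am] by blast
  from choice[OF this] obtain J where J: "\<And>n. J n \<in> borel \<rightarrow>\<^sub>M count_space UNIV" "\<And>n y. J n y \<le> n"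
    "\<And>n y i. i \<le> n \<Longrightarrow> a i y \<le> a (J n y) y" by blast
  define G where "G n y = a (J n y) y" for n y
  have Gm: "G n \<in> borel_measurable borel" for n
    unfolding G_def by (rule measurable_compose_countable[OF am J(1)])
  have G_le: "G n y \<le> wasserstein1 (F z' u y) (F z u y)" for n y
    unfolding G_def a_def r_def r'_def by (rule h_le[OF Fz' Fz])
  have GB: "\<bar>G n y\<bar> \<le> ?D" for n y
    unfolding G_def a_def using rB[of "J n y" y] by linarith
  have G_lim: "(\<lambda>n. G n y) \<longlonglongrightarrow> wasserstein1 (F z' u y) (F z u y)" for y
  proof (rule LIMSEQ_I)
    fix e :: real assume e: "0 < e"
    obtain j where j: "wasserstein1 (F z' u y) (F z u y) - e < a j y"
      using h_sup[OF Fz' Fz e] unfolding a_def r_def r'_def by blast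
    have "norm (G n y - wasserstein1 (F z' u y) (F z u y)) < e" if "j \<le> n" for n
    proof -
      have "a j y \<le> G n y" unfolding G_def using that by (rule J(3))
      with j G_le[of n y] show ?thesis by simp
    qed
    then show "\<exists>no. \<forall>n\<ge>no. norm (G n y - wasserstein1 (F z' u y) (F z u y)) < e" by blast
  qed
  show Wm: "(\<lambda>y. wasserstein1 (F z' u y) (F z u y)) \<in> borel_measurable borel"
    using G_lim Gm by (rule borel_measurable_LIMSEQ_real)
  let ?t = "tv_dist ?\<mu> ?\<mu>'"
  have G_int: "(\<integral>y. G n y \<partial>?H) \<le> ?D / 2 * (2 - ?\<delta>) * ?t" for n
  proof -
    \<comment> \<open>\<open>I j\<close> indicates the observations at which \<open>h j\<close> is selected, \<open>q j x\<close> is their probability given the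
      next state \<open>x\<close>, and \<open>\<Phi>\<close> is the selected function averaged over the observation.\<close>
    define I :: "nat \<Rightarrow> 'y \<Rightarrow> real" where "I j y = indicator {y. J n y = j} y" for j y
    have Im: "(I j :: 'y \<Rightarrow> real) \<in> borel_measurable borel" for j
    proof -
      have "{y. J n y = j} \<in> sets borel" using measurable_sets[OF J(1), of "{j}" n] by (simp add: vimage_def)
      then show ?thesis unfolding I_def by simp
    qed
    have IB: "\<bar>I j y :: real\<bar> \<le> 1" for j y by (simp add: I_def indicator_def)
    have sum_I: "(\<Sum>j\<le>n. I j y * g j) = g (J n y)" for y and g :: "nat \<Rightarrow> real"
    proof -
      have "(\<Sum>j\<le>n. I j y * g j) = (\<Sum>j\<le>n. if j = J n y then g j else 0)"
        by (intro sum.cong) (auto simp: I_def indicator_def)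
      then show ?thesis using J(2)[of n y] by simp
    qed
    define q where "q j x = (\<integral>y. I j y \<partial>Q x u)" for j x
    have qm: "q j \<in> borel_measurable borel" for j
      unfolding q_def using Q_measurable Im by (rule measurable_kernel_integral)
    have q0: "0 \<le> q j x" for j x unfolding q_def by (intro integral_nonneg_AE) (auto simp: I_def)
    have iI: "integrable (Q x u) (I j :: 'y \<Rightarrow> real)" for x j by (rule integrable_prob_bounded[OF Q_prob Im IB])
    have q1: "(\<Sum>j\<le>n. q j x) = 1" for x
    proof -
      interpret Qx: prob_space "Q x u" by (rule prob_measuresD[OF Q_prob])
      have "(\<Sum>j\<le>n. q j x) = (\<integral>y. (\<Sum>j\<le>n. I j y) \<partial>Q x u)"
        unfolding q_def using iI by simp
      also have "\<dots> = (\<integral>y. 1 \<partial>Q x u)" using sum_I[of _ "\<lambda>_. 1"] by simp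
      finally show ?thesis by (simp add: Qx.prob_space)
    qed
    have qB: "\<bar>q j x\<bar> \<le> 1" for j x unfolding q_def by (intro integral_prob_le[OF Q_prob] Im IB)
    define \<Phi> where "\<Phi> x = (\<Sum>j\<le>n. h j x * q j x)" for x
    have \<Phi>m: "\<Phi> \<in> borel_measurable borel" unfolding \<Phi>_def using h(1) qm by simp
    have \<Phi>B: "\<bar>\<Phi> x\<bar> \<le> ?D / 2" for x
    proof -
      have "\<bar>\<Phi> x\<bar> \<le> (\<Sum>j\<le>n. ?D / 2 * q j x)"
        unfolding \<Phi>_def
        using mult_right_mono[OF h(2) q0]
        by (intro sum_abs[THEN order_trans] sum_mono) (simp only: abs_mult abs_of_nonneg[OF q0])
      also have "\<dots> = ?D / 2" by (simp only: sum_distrib_left[symmetric] q1 mult_1_right)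
      finally show ?thesis .
    qed
    have hqB: "\<bar>h j x * q j x\<bar> \<le> ?D / 2 * 1" for j x
      unfolding abs_mult using h(2) qB D0 by (intro mult_mono) auto
    have hqm: "(\<lambda>x. h j x * q j x) \<in> borel_measurable borel" for j using h(1) qm by simp
    have sum_int: "(\<integral>y. (\<Sum>j\<le>n. I j y * s j y) \<partial>M) = (\<Sum>j\<le>n. \<integral>y. I j y * s j y \<partial>M)"
      if M: "M \<in> prob_measures" and s: "\<And>j. s j \<in> borel_measurable borel" "\<And>j y. \<bar>s j y\<bar> \<le> ?D / 2" for M and s :: "nat \<Rightarrow> 'y \<Rightarrow> real"
    proof (rule Bochner_Integration.integral_sum)
      fix j
      show "integrable M (\<lambda>y. I j y * s j y)"
      proof (rule integrable_prob_bounded[OF M])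
        show "(\<lambda>y. I j y * s j y) \<in> borel_measurable borel" using Im s(1) by simp
        show "\<bar>I j y * s j y\<bar> \<le> 1 * (?D / 2)" for y
          unfolding abs_mult using IB s(2) D0 by (intro mult_mono) auto
      qed
    qed
    have sum_\<Phi>: "(\<integral>x. \<Phi> x \<partial>M) = (\<Sum>j\<le>n. \<integral>x. h j x * q j x \<partial>M)" if M: "M \<in> prob_measures" for M
      unfolding \<Phi>_def by (rule Bochner_Integration.integral_sum) (rule integrable_prob_bounded[OF M hqm hqB])
    have R: "(\<integral>y. r (J n y) y \<partial>?H) = (\<integral>x. \<Phi> x \<partial>?\<mu>)"
    proof -
      have "(\<integral>y. r (J n y) y \<partial>?H) = (\<Sum>j\<le>n. \<integral>y. I j y * r j y \<partial>?H)"
        using sum_int[OF H rm(1) rB(1)] by (simp only: sum_I)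
      also have "\<dots> = (\<Sum>j\<le>n. \<integral>x. h j x * q j x \<partial>?\<mu>)"
        unfolding r_def q_def by (intro sum.cong refl bayes[OF z(1) Im IB h(1) h(2)])
      finally show ?thesis by (simp only: sum_\<Phi>[OF \<mu>])
    qed
    have R': "(\<integral>y. r' (J n y) y \<partial>?H') = (\<integral>x. \<Phi> x \<partial>?\<mu>')"
    proof -
      have "(\<integral>y. r' (J n y) y \<partial>?H') = (\<Sum>j\<le>n. \<integral>y. I j y * r' j y \<partial>?H')"
        using sum_int[OF H' rm(2) rB(2)] by (simp only: sum_I)
      also have "\<dots> = (\<Sum>j\<le>n. \<integral>x. h j x * q j x \<partial>?\<mu>')"
        unfolding r'_def q_def by (intro sum.cong refl bayes[OF z(2) Im IB h(1) h(2)])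
      finally show ?thesis by (simp only: sum_\<Phi>[OF \<mu>'])
    qed
    have rJm: "(\<lambda>y. r (J n y) y) \<in> borel_measurable borel" "(\<lambda>y. r' (J n y) y) \<in> borel_measurable borel"
      by (rule measurable_compose_countable[OF rm(1) J(1)], rule measurable_compose_countable[OF rm(2) J(1)])
    have "(\<integral>y. G n y \<partial>?H) = (\<integral>y. r' (J n y) y \<partial>?H) - (\<integral>y. r (J n y) y \<partial>?H)"
      unfolding G_def a_def
      by (intro Bochner_Integration.integral_diff integrable_prob_bounded[OF H rJm(2) rB(2)]
          integrable_prob_bounded[OF H rJm(1) rB(1)])
    moreover have "\<bar>(\<integral>y. r' (J n y) y \<partial>?H) - (\<integral>y. r' (J n y) y \<partial>?H')\<bar> \<le> ?D / 2 * tv_dist ?H ?H'"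
      by (rule tv_dist_bound_scaled[OF H H' rJm(2) rB(2)])
    moreover have "\<bar>(\<integral>x. \<Phi> x \<partial>?\<mu>) - (\<integral>x. \<Phi> x \<partial>?\<mu>')\<bar> \<le> ?D / 2 * ?t"
      by (rule tv_dist_bound_scaled[OF \<mu> \<mu>' \<Phi>m \<Phi>B])
    moreover have "?D / 2 * tv_dist ?H ?H' \<le> ?D / 2 * ((1 - ?\<delta>) * ?t)"
      using obs_law_tv_bound[OF z, of u] D0 by (intro mult_left_mono) auto
    ultimately have "(\<integral>y. G n y \<partial>?H) \<le> ?D / 2 * ((1 - ?\<delta>) * ?t) + ?D / 2 * ?t"
      unfolding R R' by linarith
    also have "\<dots> = ?D / 2 * (2 - ?\<delta>) * ?t" by (simp add: algebra_simps)
    finally show ?thesis .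
  qed
  interpret H: prob_space ?H using H by (rule prob_measuresD)
  note cH = measurable_cong_sets[OF prob_measuresD(2)[OF H] refl]
  have "(\<lambda>n. \<integral>y. G n y \<partial>?H) \<longlonglongrightarrow> (\<integral>y. wasserstein1 (F z' u y) (F z u y) \<partial>?H)"
    by (rule integral_dominated_convergence[where w="\<lambda>_. ?D"])
      (use Gm Wm G_lim GB in \<open>auto simp: cH\<close>)
  then show "(\<integral>y. wasserstein1 (F z' u y) (F z u y) \<partial>?H) \<le> ?D / 2 * (2 - ?\<delta>) * ?t"
    by (rule LIMSEQ_le_const2) (use G_int in blast)
qed

text \<open>Passing from \<open>z\<close> to \<open>z'\<close> changes the law of the observation, which contributes \<open>1 - \<delta>(Q)\<close> because
  \<open>w\<close> oscillates by at most \<open>L\<close> times the diameter, and it changes the update, which contributes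
  \<open>2 - \<delta>(Q)\<close>.\<close>

lemma belief_kernel_Lipschitz:
  assumes compact: "compact (UNIV :: 'x set)"
    and w: "w \<in> borel_measurable (prob_algebra borel)" "bounded_on_beliefs w B"
    and L: "0 \<le> L" "\<And>\<mu> \<nu>. \<mu> \<in> prob_measures \<Longrightarrow> \<nu> \<in> prob_measures \<Longrightarrow> \<bar>w \<mu> - w \<nu>\<bar> \<le> L * wasserstein1 \<mu> \<nu>"
    and z: "z \<in> prob_measures" "z' \<in> prob_measures"
  shows "(\<integral>\<pi>. w \<pi> \<partial>belief_kernel T Q F z' u) - (\<integral>\<pi>. w \<pi> \<partial>belief_kernel T Q F z u)
    \<le> L * (diameter (UNIV :: 'x set) * (3 - 2 * dobrushin (\<lambda>x. Q x u)) / 2) * tv_dist (predict z u) (predict z' u)"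
proof -
  let ?D = "diameter (UNIV :: 'x set)"
  let ?H = "obs_law T Q z u" and ?H' = "obs_law T Q z' u"
  let ?t = "tv_dist (predict z u) (predict z' u)" and ?\<delta> = "dobrushin (\<lambda>x. Q x u)"
  note H = obs_law_prob[OF z(1), of u] and H' = obs_law_prob[OF z(2), of u]
  note Fz = F_prob[OF z(1), of u] and Fz' = F_prob[OF z(2), of u]
  note U = updated_beliefs_wasserstein_bound[OF compact z, of u]
  have wm: "(\<lambda>y. w (F z u y)) \<in> borel_measurable borel" "(\<lambda>y. w (F z' u y)) \<in> borel_measurable borel"
    using measurable_compose[OF F_measurable[OF z(1)] w(1)] measurable_compose[OF F_measurable[OF z(2)] w(1)] .
  have wB: "\<bar>w (F z u y)\<bar> \<le> B" "\<bar>w (F z' u y)\<bar> \<le> B" for y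
    using w(2) Fz Fz' by (auto simp: bounded_on_beliefs_def)
  have D0: "0 \<le> ?D" by (rule order_trans[OF zero_le_dist[of undefined undefined] dist_le_diameter[OF compact]])
  have "w (F z' u y) - w (F z' u y') \<le> L * ?D" for y y'
  proof -
    have "L * wasserstein1 (F z' u y) (F z' u y') \<le> L * ?D"
      using wasserstein1_le_diameter[OF compact Fz' Fz'] L(1) by (intro mult_left_mono)
    with L(2)[OF Fz' Fz', of y y'] show ?thesis by linarith
  qed
  from oscillation_tv_bound[OF H H' wm(2) this]
  have 1: "\<bar>(\<integral>y. w (F z' u y) \<partial>?H) - (\<integral>y. w (F z' u y) \<partial>?H')\<bar> \<le> L * ?D / 2 * tv_dist ?H ?H'" .
  have "L * ?D / 2 * tv_dist ?H ?H' \<le> L * ?D / 2 * ((1 - ?\<delta>) * ?t)"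
    using obs_law_tv_bound[OF z, of u] L(1) D0 by (intro mult_left_mono) auto
  note 1 = order_trans[OF 1 this]
  have iW: "integrable ?H (\<lambda>y. L * wasserstein1 (F z' u y) (F z u y))"
  proof (intro integrable_mult_right integrable_prob_bounded[OF H U(1)])
    show "\<bar>wasserstein1 (F z' u y) (F z u y)\<bar> \<le> ?D" for y
      using wasserstein1_le_diameter[OF compact Fz' Fz] wasserstein1_nonneg[OF compact Fz' Fz] by simp
  qed
  have "(\<integral>y. w (F z' u y) \<partial>?H) - (\<integral>y. w (F z u y) \<partial>?H) = (\<integral>y. w (F z' u y) - w (F z u y) \<partial>?H)"
    by (intro Bochner_Integration.integral_diff[symmetric] integrable_prob_bounded[OF H wm(2) wB(2)]
        integrable_prob_bounded[OF H wm(1) wB(1)])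
  also have "\<dots> \<le> (\<integral>y. L * wasserstein1 (F z' u y) (F z u y) \<partial>?H)"
  proof (rule integral_mono[OF _ iW])
    show "integrable ?H (\<lambda>y. w (F z' u y) - w (F z u y))"
      by (intro Bochner_Integration.integrable_diff integrable_prob_bounded[OF H wm(2) wB(2)]
        integrable_prob_bounded[OF H wm(1) wB(1)])
    show "w (F z' u y) - w (F z u y) \<le> L * wasserstein1 (F z' u y) (F z u y)" for y
      using L(2)[OF Fz' Fz, of y y] by linarith
  qed
  also have "\<dots> = L * (\<integral>y. wasserstein1 (F z' u y) (F z u y) \<partial>?H)" by simp
  also have "\<dots> \<le> L * (?D / 2 * (2 - ?\<delta>) * ?t)" using U(2) L(1) by (rule mult_left_mono)
  finally have 2: "(\<integral>y. w (F z' u y) \<partial>?H) - (\<integral>y. w (F z u y) \<partial>?H) \<le> L * (?D / 2 * (2 - ?\<delta>) * ?t)" .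
  have "L * ?D / 2 * ((1 - ?\<delta>) * ?t) + L * (?D / 2 * (2 - ?\<delta>) * ?t) = L * (?D * (3 - 2 * ?\<delta>) / 2) * ?t"
    by (simp add: field_simps)
  with 1 2 show ?thesis
    unfolding integral_belief_kernel[OF z(1) w(1)] integral_belief_kernel[OF z(2) w(1)] by linarith
qed

lemma belief_kernel_wasserstein_Lipschitz:
  assumes compact: "compact (UNIV :: 'x set)"
    and \<alpha>: "0 \<le> \<alpha>" "\<And>x x' u. tv_dist (T x u) (T x' u) \<le> \<alpha> * dist x x'"
    and w: "w \<in> borel_measurable (prob_algebra borel)" "bounded_on_beliefs w B"
    and L: "0 \<le> L" "\<And>\<mu> \<nu>. \<mu> \<in> prob_measures \<Longrightarrow> \<nu> \<in> prob_measures \<Longrightarrow> \<bar>w \<mu> - w \<nu>\<bar> \<le> L * wasserstein1 \<mu> \<nu>"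
    and z: "z \<in> prob_measures" "z' \<in> prob_measures"
  shows "\<bar>(\<integral>\<pi>. w \<pi> \<partial>belief_kernel T Q F z u) - (\<integral>\<pi>. w \<pi> \<partial>belief_kernel T Q F z' u)\<bar>
    \<le> (\<alpha> * diameter (UNIV :: 'x set) * (3 - 2 * dobrushin (\<lambda>x. Q x u)) / 2) * L * wasserstein1 z z'"
proof -
  let ?D = "diameter (UNIV :: 'x set)" and ?\<delta> = "dobrushin (\<lambda>x. Q x u)"
  have D0: "0 \<le> ?D" by (rule order_trans[OF zero_le_dist[of undefined undefined] dist_le_diameter[OF compact]])
  have "?\<delta> \<le> 1"
    using tv_dist_le_dobrushin[of "\<lambda>x. Q x u" undefined undefined, OF Q_prob] tv_dist_nonneg[OF Q_prob Q_prob, of undefined u undefined u]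
    by linarith
  then have c: "0 \<le> L * (?D * (3 - 2 * ?\<delta>) / 2)" using D0 L(1) by simp
  have "(\<integral>\<pi>. w \<pi> \<partial>belief_kernel T Q F a u) - (\<integral>\<pi>. w \<pi> \<partial>belief_kernel T Q F b u)
      \<le> L * (?D * (3 - 2 * ?\<delta>) / 2) * (\<alpha> * wasserstein1 b a)" if "a \<in> prob_measures" "b \<in> prob_measures" for a b
    using belief_kernel_Lipschitz[OF compact w L that(2,1), of u]
      mult_left_mono[OF predict_tv_bound[OF compact \<alpha> that(2,1), of u] c] by linarith
  note le = this[OF z] this[OF z(2,1)]
  have "L * (?D * (3 - 2 * ?\<delta>) / 2) * (\<alpha> * wasserstein1 z z') = (\<alpha> * ?D * (3 - 2 * ?\<delta>) / 2) * L * wasserstein1 z z'"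
    by simp
  with le show ?thesis unfolding wasserstein1_commute[of z' z] by linarith
qed

end

context feller_control
begin

text \<open>If \<open>w\<close> is \<open>L\<close>-Lipschitz then \<open>bellman w\<close> is \<open>(K\<^sub>1 + \<beta> K\<^sub>2 L)\<close>-Lipschitz, so that the fixed
  point \<open>K\<^sub>1 / (1 - \<beta> K\<^sub>2)\<close> of this recursion is a Lipschitz constant of all iterates and of their
  limit.\<close>

lemma bellman_limit_Lipschitz:
  assumes compact: "compact (UNIV :: 'x set)"
    and K\<^sub>1: "0 \<le> K\<^sub>1" "\<And>x x' u. \<bar>c x u - c x' u\<bar> \<le> K\<^sub>1 * dist x x'"
    and K\<^sub>2: "\<beta> * K\<^sub>2 < 1" "\<And>w B L z z' u. w \<in> borel_measurable (prob_algebra borel) \<Longrightarrow> bounded_on_beliefs w B \<Longrightarrow> 0 \<le> L \<Longrightarrow>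
        (\<And>\<mu> \<nu>. \<mu> \<in> prob_measures \<Longrightarrow> \<nu> \<in> prob_measures \<Longrightarrow> \<bar>w \<mu> - w \<nu>\<bar> \<le> L * wasserstein1 \<mu> \<nu>) \<Longrightarrow>
        z \<in> prob_measures \<Longrightarrow> z' \<in> prob_measures \<Longrightarrow>
        \<bar>(\<integral>\<pi>. w \<pi> \<partial>eta z u) - (\<integral>\<pi>. w \<pi> \<partial>eta z' u)\<bar> \<le> K\<^sub>2 * L * wasserstein1 z z'"
    and z: "z \<in> prob_measures" "z' \<in> prob_measures"
  shows "\<bar>bellman_limit z - bellman_limit z'\<bar> \<le> K\<^sub>1 / (1 - \<beta> * K\<^sub>2) * wasserstein1 z z'"
proof -
  let ?L = "K\<^sub>1 / (1 - \<beta> * K\<^sub>2)"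
  have L0: "0 \<le> ?L" using K\<^sub>1(1) K\<^sub>2(1) by simp
  have fix_L: "K\<^sub>1 + \<beta> * (K\<^sub>2 * ?L) = ?L" using K\<^sub>2(1) by (simp add: field_simps)
  have it: "\<bar>iterate n z - iterate n z'\<bar> \<le> ?L * wasserstein1 z z'" if "z \<in> prob_measures" "z' \<in> prob_measures" for n z z'
    using that
  proof (induction n arbitrary: z z')
    case 0
    have "0 \<le> ?L * wasserstein1 z z'" by (rule mult_nonneg_nonneg[OF L0 wasserstein1_nonneg[OF compact 0]])
    then show ?case unfolding iterate_def by simp
  next
    case (Suc n)
    note it = iterate[of n, THEN conjunct1] iterate[of n, THEN conjunct2]
    have S: "iterate (Suc n) = bellman (iterate n)" by (simp add: iterate_def)
    have av: "\<bar>action_value (iterate n) z u - action_value (iterate n) z' u\<bar> \<le> ?L * wasserstein1 z z'" for u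
    proof -
      have "\<bar>belief_cost c z u - belief_cost c z' u\<bar> \<le> K\<^sub>1 * wasserstein1 z z'"
        unfolding belief_cost_def by (rule wasserstein1_Lipschitz[OF compact Suc.prems K\<^sub>1])
      moreover have "\<bar>\<beta> * (\<integral>\<pi>. iterate n \<pi> \<partial>eta z u) - \<beta> * (\<integral>\<pi>. iterate n \<pi> \<partial>eta z' u)\<bar> \<le> \<beta> * (K\<^sub>2 * ?L * wasserstein1 z z')"
      proof -
        have "\<bar>\<beta> * (\<integral>\<pi>. iterate n \<pi> \<partial>eta z u) - \<beta> * (\<integral>\<pi>. iterate n \<pi> \<partial>eta z' u)\<bar>
            = \<beta> * \<bar>(\<integral>\<pi>. iterate n \<pi> \<partial>eta z u) - (\<integral>\<pi>. iterate n \<pi> \<partial>eta z' u)\<bar>"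
          using \<beta> by (simp add: abs_mult flip: right_diff_distrib)
        also have "\<dots> \<le> \<beta> * (K\<^sub>2 * ?L * wasserstein1 z z')"
          using \<beta> by (intro mult_left_mono K\<^sub>2(2)[OF weakly_continuous_measurable[OF it(1)] it(2) L0 Suc.IH Suc.prems]) auto
        finally show ?thesis .
      qed
      ultimately have "\<bar>action_value (iterate n) z u - action_value (iterate n) z' u\<bar>
          \<le> K\<^sub>1 * wasserstein1 z z' + \<beta> * (K\<^sub>2 * ?L * wasserstein1 z z')"
        unfolding action_value_def by linarith
      also have "\<dots> = (K\<^sub>1 + \<beta> * (K\<^sub>2 * ?L)) * wasserstein1 z z'"
        by (simp only: distrib_right mult.assoc)
      finally show ?thesis unfolding fix_L .
    qed
    obtain u where u: "bellman (iterate n) z = action_value (iterate n) z u"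
      using bellman_attained[OF it Suc.prems(1)] by blast
    obtain u' where u': "bellman (iterate n) z' = action_value (iterate n) z' u'"
      using bellman_attained[OF it Suc.prems(2)] by blast
    show ?case
      unfolding S using av[of u] av[of u'] u u' bellman_le[OF it Suc.prems(1), of u'] bellman_le[OF it Suc.prems(2), of u]
      by linarith
  qed
  have "(\<lambda>n. \<bar>iterate n z - iterate n z'\<bar>) \<longlonglongrightarrow> \<bar>bellman_limit z - bellman_limit z'\<bar>"
    by (intro tendsto_intros iterate_tendsto z)
  then show ?thesis by (rule LIMSEQ_le_const2) (use it[OF z] in blast)
qed

end

lemma feller_control_belief_kernel:
  fixes T :: "'x::{metric_space, second_countable_topology}
                \<Rightarrow> 'u::{metric_space, second_countable_topology} \<Rightarrow> 'x measure"
    and Q :: "'x \<Rightarrow> 'u \<Rightarrow> 'y::{metric_space, second_countable_topology} measure"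
  assumes "pomdp T Q F" "pomdp.feller T Q F"
    and "continuous_on UNIV (\<lambda>(x, u). c x u)" "\<And>x u. \<bar>c x u\<bar> \<le> C"
    and "compact (UNIV :: 'u set)" "0 < \<beta>" "\<beta> < 1"
  shows "feller_control (belief_kernel T Q F) c \<beta> C"
proof -
  interpret pomdp T Q F by (rule assms(1))
  show ?thesis
  proof (rule feller_control.intro)
    fix Z :: "nat \<Rightarrow> 'x measure" and z and u :: "nat \<Rightarrow> 'u" and v B and w :: "'x measure \<Rightarrow> real"
    assume "wconv Z z" "u \<longlonglongrightarrow> v" "weakly_continuous w" "bounded_on_beliefs w B"
    then show "(\<lambda>n. \<integral>\<pi>. w \<pi> \<partial>belief_kernel T Q F (Z n) (u n)) \<longlonglongrightarrow> (\<integral>\<pi>. w \<pi> \<partial>belief_kernel T Q F z v)"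
      using assms(2) unfolding feller_def bounded_on_beliefs_def by blast
  qed (use assms(3-) belief_kernel_measurable in auto)
qed

section \<open>Optimal policies and regularity of the value function\<close>

theorem mainTheorem1:
  fixes T :: "'x::{metric_space, second_countable_topology}
                \<Rightarrow> 'u::{metric_space, second_countable_topology} \<Rightarrow> 'x measure"
    and Q :: "'x \<Rightarrow> 'u \<Rightarrow> 'y::{metric_space, second_countable_topology} measure"
    and c :: "'x \<Rightarrow> 'u \<Rightarrow> real"
    and F :: "'x measure \<Rightarrow> 'u \<Rightarrow> 'y \<Rightarrow> 'x measure"
    and eX :: "'x \<Rightarrow> 'px::polish_space"
    and eY :: "'y \<Rightarrow> 'py::polish_space"
    and eU :: "'u \<Rightarrow> 'pu::polish_space"
  assumes "standard_borel_via eX" and "standard_borel_via eY" and "standard_borel_via eU"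
    and "controlled_kernel T" and "controlled_kernel Q"
    and "belief_update T Q F"
  defines "\<eta> \<equiv> belief_kernel T Q F"
  shows
    "(continuous_on UNIV (\<lambda>(x, u). c x u) \<and> bounded (range (\<lambda>(x, u). c x u)) \<and>
      compact (UNIV :: 'u set) \<and>
      (weakly_continuous_kernel T \<and> tv_continuous_kernel Q \<or>
       tv_continuous_kernel T \<and> (\<exists>Q\<^sub>0. \<forall>x u. Q x u = Q\<^sub>0 x))
      \<longrightarrow>
      (\<forall>\<beta>. 0 < \<beta> \<and> \<beta> < 1 \<longrightarrow>
        (\<exists>\<gamma> \<in> policies. \<forall>z \<in> prob_measures.
           discounted_cost \<eta> c \<beta> z \<gamma> = value_function \<eta> c \<beta> z) \<and>
        bounded (value_function \<eta> c \<beta> ` prob_measures) \<and>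
        continuous_map weak_topology euclideanreal (value_function \<eta> c \<beta>)))
     \<and>
     (\<forall>Q\<^sub>0 \<alpha> K\<^sub>1 D K\<^sub>2 \<beta>.
        (\<forall>x u. Q x u = Q\<^sub>0 x) \<and>
        compact (UNIV :: 'x set) \<and> D = diameter (UNIV :: 'x set) \<and>
        tv_continuous_kernel T \<and>
        0 \<le> \<alpha> \<and> (\<forall>x x' u. tv_dist (T x u) (T x' u) \<le> \<alpha> * dist x x') \<and>
        0 \<le> K\<^sub>1 \<and> (\<forall>x x' u. \<bar>c x u - c x' u\<bar> \<le> K\<^sub>1 * dist x x') \<and>
        continuous_on UNIV (\<lambda>(x, u). c x u) \<and> bounded (range (\<lambda>(x, u). c x u)) \<and>
        compact (UNIV :: 'u set) \<and>
        K\<^sub>2 = \<alpha> * D * (3 - 2 * dobrushin Q\<^sub>0) / 2 \<and>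
        0 < \<beta> \<and> \<beta> < 1 \<and> \<beta> * K\<^sub>2 < 1
        \<longrightarrow>
        (\<exists>L\<ge>0. \<forall>\<mu> \<in> prob_measures. \<forall>\<nu> \<in> prob_measures.
           \<bar>value_function \<eta> c \<beta> \<mu> - value_function \<eta> c \<beta> \<nu>\<bar> \<le> L * wasserstein1 \<mu> \<nu>))"
proof -
  interpret pomdp T Q F using assms(4-6) by (rule pomdp.intro)
  have control: "feller_control \<eta> c \<beta> C"
    if "feller" "continuous_on UNIV (\<lambda>(x, u). c x u)" "\<And>x u. \<bar>c x u\<bar> \<le> C" "compact (UNIV :: 'u set)" "0 < \<beta>" "\<beta> < 1"
    for \<beta> C
    unfolding \<eta>_def using pomdp_axioms that by (rule feller_control_belief_kernel)
  have cost_bound: "\<exists>C. \<forall>x u. \<bar>c x u\<bar> \<le> C" if "bounded (range (\<lambda>(x, u). c x u))"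
    using that by (auto simp: bounded_iff)
  have "(\<exists>\<gamma> \<in> policies. \<forall>z \<in> prob_measures. discounted_cost \<eta> c \<beta> z \<gamma> = value_function \<eta> c \<beta> z) \<and>
        bounded (value_function \<eta> c \<beta> ` prob_measures) \<and>
        continuous_map weak_topology euclideanreal (value_function \<eta> c \<beta>)"
    if c: "continuous_on UNIV (\<lambda>(x, u). c x u)" "bounded (range (\<lambda>(x, u). c x u))" and U: "compact (UNIV :: 'u set)"
      and K: "weakly_continuous_kernel T \<and> tv_continuous_kernel Q \<or> tv_continuous_kernel T \<and> (\<exists>Q\<^sub>0. \<forall>x u. Q x u = Q\<^sub>0 x)"
      and disc: "0 < \<beta>" "\<beta> < 1" for \<beta>
  proof -
    have feller using K feller_if_weak_transition feller_if_tv_transition by blast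
    moreover obtain C where "\<And>x u. \<bar>c x u\<bar> \<le> C" using cost_bound[OF c(2)] by blast
    ultimately interpret feller_control \<eta> c \<beta> C using c(1) U disc by (intro control)
    obtain \<gamma> where "\<gamma> \<in> policies" "\<And>z. z \<in> prob_measures \<Longrightarrow> discounted_cost \<eta> c \<beta> z \<gamma> = bellman_limit z"
      using optimal_policy_exists by blast
    then have "\<exists>\<gamma> \<in> policies. \<forall>z \<in> prob_measures. discounted_cost \<eta> c \<beta> z \<gamma> = value_function \<eta> c \<beta> z"
      by (intro bexI[of _ \<gamma>]) (simp_all add: value_function_eq)
    moreover have "bounded (value_function \<eta> c \<beta> ` prob_measures)"
      using bellman_limit_bounded value_function_eq unfolding bounded_on_beliefs_def bounded_iff
      by (intro exI[of _ "C / (1 - \<beta>)"]) auto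
    moreover have "continuous_map weak_topology euclideanreal (value_function \<eta> c \<beta>)"
      by (rule continuous_map_eq[OF weakly_continuous_continuous_map[OF bellman_limit_weakly_continuous]])
        (simp add: topspace_weak_topology value_function_eq)
    ultimately show ?thesis by blast
  qed
  moreover have "\<exists>L\<ge>0. \<forall>\<mu> \<in> prob_measures. \<forall>\<nu> \<in> prob_measures.
      \<bar>value_function \<eta> c \<beta> \<mu> - value_function \<eta> c \<beta> \<nu>\<bar> \<le> L * wasserstein1 \<mu> \<nu>"
    if Q\<^sub>0: "\<forall>x u. Q x u = Q\<^sub>0 x" and X: "compact (UNIV :: 'x set)" and D: "D = diameter (UNIV :: 'x set)"
      and T: "tv_continuous_kernel T" and \<alpha>: "0 \<le> \<alpha>" "\<forall>x x' u. tv_dist (T x u) (T x' u) \<le> \<alpha> * dist x x'"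
      and K\<^sub>1: "0 \<le> K\<^sub>1" "\<forall>x x' u. \<bar>c x u - c x' u\<bar> \<le> K\<^sub>1 * dist x x'"
      and c: "continuous_on UNIV (\<lambda>(x, u). c x u)" "bounded (range (\<lambda>(x, u). c x u))" and U: "compact (UNIV :: 'u set)"
      and K\<^sub>2: "K\<^sub>2 = \<alpha> * D * (3 - 2 * dobrushin Q\<^sub>0) / 2" and disc: "0 < \<beta>" "\<beta> < 1" "\<beta> * K\<^sub>2 < 1"
    for Q\<^sub>0 \<alpha> K\<^sub>1 D K\<^sub>2 \<beta>
  proof -
    have feller using feller_if_tv_transition[OF T] Q\<^sub>0 by blast
    moreover obtain C where "\<And>x u. \<bar>c x u\<bar> \<le> C" using cost_bound[OF c(2)] by blast
    ultimately interpret feller_control \<eta> c \<beta> C using c(1) U disc(1,2) by (intro control)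
    have Q_eq: "(\<lambda>x. Q x u) = Q\<^sub>0" for u using Q\<^sub>0 by auto
    have "\<bar>bellman_limit \<mu> - bellman_limit \<nu>\<bar> \<le> K\<^sub>1 / (1 - \<beta> * K\<^sub>2) * wasserstein1 \<mu> \<nu>"
      if \<mu>: "\<mu> \<in> prob_measures" "\<nu> \<in> prob_measures" for \<mu> \<nu>
    proof (rule bellman_limit_Lipschitz[OF X K\<^sub>1(1) _ disc(3) _ \<mu>])
      show "\<bar>c x u - c x' u\<bar> \<le> K\<^sub>1 * dist x x'" for x x' u using K\<^sub>1(2) by blast
      fix w :: "'x measure \<Rightarrow> real" and B L :: real and z z' :: "'x measure" and u :: 'u
      assume w: "w \<in> borel_measurable (prob_algebra borel)" "bounded_on_beliefs w B" "0 \<le> L"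
        "\<And>\<mu> \<nu>. \<mu> \<in> prob_measures \<Longrightarrow> \<nu> \<in> prob_measures \<Longrightarrow> \<bar>w \<mu> - w \<nu>\<bar> \<le> L * wasserstein1 \<mu> \<nu>"
        and z: "z \<in> prob_measures" "z' \<in> prob_measures"
      show "\<bar>(\<integral>\<pi>. w \<pi> \<partial>\<eta> z u) - (\<integral>\<pi>. w \<pi> \<partial>\<eta> z' u)\<bar> \<le> K\<^sub>2 * L * wasserstein1 z z'"
        using belief_kernel_wasserstein_Lipschitz[OF X \<alpha>(1) \<alpha>(2)[rule_format] w z, of u]
        unfolding \<eta>_def K\<^sub>2 D Q_eq .
    qed
    moreover have "0 \<le> K\<^sub>1 / (1 - \<beta> * K\<^sub>2)" using K\<^sub>1(1) disc(3) by simp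
    ultimately show ?thesis
      by (intro exI[of _ "K\<^sub>1 / (1 - \<beta> * K\<^sub>2)"]) (simp add: value_function_eq)
  qed
  ultimately show ?thesis by blast
qed

end
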